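(* Let $X$ be a Banach space and $\{T(t)\}_{t\ge0}$ a bounded $C_0$-semigroup on $X$ with sun-dual semigroup $\{T^\odot(t)\}_{t\ge0}$ on $X^\odot$. Suppose the $w^*$-closure $\mathcal T^\odot$ of $\{T^\odot(t)\}_{t\ge0}$ in $L(X^\odot)$ is abelian, let $P$ be a minimal idempotent of $\mathcal T^\odot$, $X^\odot_a:=PX^\odot$, and let $x^\odot\in X^\odot_a$. Then the following are equivalent: (1) the $\sigma(X^\odot,X)$-closure of $O(x^\odot)=\{T^\odot(t)x^\odot:t\ge0\}$ is norm separable; (2) $x^\odot\in X^\odot_{uds}$; (3) $O(x^\odot)$ is relatively norm compact.
   Context: $X^\odot:=\{x^*\in X^*:\|T^*(t)x^*-x^*\|\to0 \text{ as } t\to0\}$ and $T^\odot(t):=T^*(t)|_{X^\odot}$. For $U_\alpha,U\in L(X^\odot)$, $w^*\text{-}\lim_\alpha U_\alpha=U$ means $\langle x,U_\alpha y\rangle\to\langle x,Uy\rangle$ for all $x\in X,y\in X^\odot$; the $w^*$-closure $\mathcal T^\odot$ of $\{T^\odot(t)\}$ consists of operators on $X^\odot$ and is a compact semigroup under composition. An idempotent $P\in\mathcal T^\odot$ is minimal if for every idempotent $Q\in\mathcal T^\odot$ with $PQ=Q$ one has $QP=P$. $X^\odot_{uds}$ is the norm-closed linear span of those $y\in X^\odot$ for which there is $\lambda:\mathcal T^\odot\to\mathbb C$ with $|\lambda(U)|=1$ and $Uy=\lambda(U)y$ for all $U\in\mathcal T^\odot$. *)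

theory Defs
  imports "HOL-Analysis.Analysis"
begin

text \<open>A complex Banach space is modelled as a real Banach space type 'a together with
  a complex scalar multiplication cs extending the real one, with norm (cs c x) = |c| norm x.\<close>
definition cplx_struct :: "(complex \<Rightarrow> 'a::real_normed_vector \<Rightarrow> 'a) \<Rightarrow> bool" where
  "cplx_struct cs \<longleftrightarrow>
     (\<forall>r x. cs (complex_of_real r) x = r *\<^sub>R x) \<and>
     (\<forall>a b x. cs a (cs b x) = cs (a * b) x) \<and>
     (\<forall>a x y. cs a (x + y) = cs a x + cs a y) \<and>
     (\<forall>a b x. cs (a + b) x = cs a x + cs b x) \<and>
     (\<forall>a x. norm (cs a x) = cmod a * norm x)"

definition cscale :: "complex \<Rightarrow> ('a::real_normed_vector \<Rightarrow>\<^sub>L complex) \<Rightarrow> ('a \<Rightarrow>\<^sub>L complex)" where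
  "cscale c f = blinfun_mult_left c o\<^sub>L f"

definition bounded_C0_semigroup ::
  "(complex \<Rightarrow> 'a::real_normed_vector \<Rightarrow> 'a) \<Rightarrow> (real \<Rightarrow> 'a \<Rightarrow>\<^sub>L 'a) \<Rightarrow> bool" where
  "bounded_C0_semigroup cs T \<longleftrightarrow>
     (\<forall>t\<ge>0. \<forall>c x. blinfun_apply (T t) (cs c x) = cs c (blinfun_apply (T t) x)) \<and>
     T 0 = id_blinfun \<and>
     (\<forall>s\<ge>0. \<forall>t\<ge>0. T (s + t) = T s o\<^sub>L T t) \<and>
     (\<forall>x. ((\<lambda>t. blinfun_apply (T t) x) \<longlongrightarrow> x) (at_right 0)) \<and>
     (\<exists>M. \<forall>t\<ge>0. norm (T t) \<le> M)"

definition cdual :: "(complex \<Rightarrow> 'a::real_normed_vector \<Rightarrow> 'a) \<Rightarrow> ('a \<Rightarrow>\<^sub>L complex) set" where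
  "cdual cs = {f. \<forall>c x. blinfun_apply f (cs c x) = c * blinfun_apply f x}"

definition sun_dual ::
  "(complex \<Rightarrow> 'a::real_normed_vector \<Rightarrow> 'a) \<Rightarrow> (real \<Rightarrow> 'a \<Rightarrow>\<^sub>L 'a) \<Rightarrow> ('a \<Rightarrow>\<^sub>L complex) set" where
  "sun_dual cs T = {f \<in> cdual cs. ((\<lambda>t. f o\<^sub>L T t) \<longlongrightarrow> f) (at_right 0)}"

text \<open>Operators on X^sun are represented as functions that vanish outside X^sun.\<close>
definition sun_op ::
  "(complex \<Rightarrow> 'a::real_normed_vector \<Rightarrow> 'a) \<Rightarrow> (real \<Rightarrow> 'a \<Rightarrow>\<^sub>L 'a) \<Rightarrow> real
     \<Rightarrow> ('a \<Rightarrow>\<^sub>L complex) \<Rightarrow> ('a \<Rightarrow>\<^sub>L complex)" where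
  "sun_op cs T t = (\<lambda>f. if f \<in> sun_dual cs T then f o\<^sub>L T t else 0)"

definition bounded_op_sun ::
  "(complex \<Rightarrow> 'a::real_normed_vector \<Rightarrow> 'a) \<Rightarrow> (real \<Rightarrow> 'a \<Rightarrow>\<^sub>L 'a)
     \<Rightarrow> (('a \<Rightarrow>\<^sub>L complex) \<Rightarrow> ('a \<Rightarrow>\<^sub>L complex)) \<Rightarrow> bool" where
  "bounded_op_sun cs T U \<longleftrightarrow>
     (\<forall>f. f \<notin> sun_dual cs T \<longrightarrow> U f = 0) \<and>
     (\<forall>f\<in>sun_dual cs T. U f \<in> sun_dual cs T) \<and>
     (\<forall>f\<in>sun_dual cs T. \<forall>g\<in>sun_dual cs T. U (f + g) = U f + U g) \<and>
     (\<forall>c. \<forall>f\<in>sun_dual cs T. U (cscale c f) = cscale c (U f)) \<and>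
     (\<exists>K. \<forall>f\<in>sun_dual cs T. norm (U f) \<le> K * norm f)"

text \<open>The w*-closure of {T^sun(t) : t >= 0} in L(X^sun): closure w.r.t. the topology of
  convergence of all pairings (x, U y), x in X, y in X^sun (written via basic neighbourhoods).\<close>
definition wstar_closure ::
  "(complex \<Rightarrow> 'a::real_normed_vector \<Rightarrow> 'a) \<Rightarrow> (real \<Rightarrow> 'a \<Rightarrow>\<^sub>L 'a)
     \<Rightarrow> (('a \<Rightarrow>\<^sub>L complex) \<Rightarrow> ('a \<Rightarrow>\<^sub>L complex)) set" where
  "wstar_closure cs T = {U. bounded_op_sun cs T U \<and>
     (\<forall>F G (\<epsilon>::real). finite F \<and> finite G \<and> G \<subseteq> sun_dual cs T \<and> \<epsilon> > 0 \<longrightarrow>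
        (\<exists>t\<ge>0. \<forall>x\<in>F. \<forall>y\<in>G. cmod (blinfun_apply (U y) x - blinfun_apply (sun_op cs T t y) x) < \<epsilon>))}"

definition minimal_idempotent ::
  "(complex \<Rightarrow> 'a::real_normed_vector \<Rightarrow> 'a) \<Rightarrow> (real \<Rightarrow> 'a \<Rightarrow>\<^sub>L 'a)
     \<Rightarrow> (('a \<Rightarrow>\<^sub>L complex) \<Rightarrow> ('a \<Rightarrow>\<^sub>L complex)) \<Rightarrow> bool" where
  "minimal_idempotent cs T P \<longleftrightarrow> P \<in> wstar_closure cs T \<and> P \<circ> P = P \<and>
     (\<forall>Q\<in>wstar_closure cs T. Q \<circ> Q = Q \<and> P \<circ> Q = Q \<longrightarrow> Q \<circ> P = P)"

definition sun_orbit ::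
  "(complex \<Rightarrow> 'a::real_normed_vector \<Rightarrow> 'a) \<Rightarrow> (real \<Rightarrow> 'a \<Rightarrow>\<^sub>L 'a)
     \<Rightarrow> ('a \<Rightarrow>\<^sub>L complex) \<Rightarrow> ('a \<Rightarrow>\<^sub>L complex) set" where
  "sun_orbit cs T y = {sun_op cs T t y | t. t \<ge> 0}"

definition weak_star_closure_sun ::
  "(complex \<Rightarrow> 'a::real_normed_vector \<Rightarrow> 'a) \<Rightarrow> (real \<Rightarrow> 'a \<Rightarrow>\<^sub>L 'a)
     \<Rightarrow> ('a \<Rightarrow>\<^sub>L complex) set \<Rightarrow> ('a \<Rightarrow>\<^sub>L complex) set" where
  "weak_star_closure_sun cs T S = {y \<in> sun_dual cs T. \<forall>F (\<epsilon>::real). finite F \<and> \<epsilon> > 0 \<longrightarrow>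
     (\<exists>s\<in>S. \<forall>v\<in>F. cmod (blinfun_apply s v - blinfun_apply y v) < \<epsilon>)}"

definition norm_separable :: "'b::metric_space set \<Rightarrow> bool" where
  "norm_separable S \<longleftrightarrow> (\<exists>D. D \<subseteq> S \<and> countable D \<and> S \<subseteq> closure D)"

definition cspan :: "('a::real_normed_vector \<Rightarrow>\<^sub>L complex) set \<Rightarrow> ('a \<Rightarrow>\<^sub>L complex) set" where
  "cspan S = {f. \<exists>(I::nat set) c v. finite I \<and> (\<forall>i\<in>I. v i \<in> S) \<and>
                  f = (\<Sum>i\<in>I. cscale (c i) (v i))}"

definition unimodular_eigvecs ::
  "(complex \<Rightarrow> 'a::real_normed_vector \<Rightarrow> 'a) \<Rightarrow> (real \<Rightarrow> 'a \<Rightarrow>\<^sub>L 'a) \<Rightarrow> ('a \<Rightarrow>\<^sub>L complex) set" where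
  "unimodular_eigvecs cs T = {y \<in> sun_dual cs T. \<exists>lam.
      \<forall>U\<in>wstar_closure cs T. cmod (lam U) = 1 \<and> U y = cscale (lam U) y}"

definition X_uds ::
  "(complex \<Rightarrow> 'a::real_normed_vector \<Rightarrow> 'a) \<Rightarrow> (real \<Rightarrow> 'a \<Rightarrow>\<^sub>L 'a) \<Rightarrow> ('a \<Rightarrow>\<^sub>L complex) set" where
  "X_uds cs T = closure (cspan (unimodular_eigvecs cs T))"

end

theory Submission
  imports Defs "HOL-Complex_Analysis.Great_Picard"
begin

text \<open>
The closure is compact and abelian, so the sets \<open>U\<T>\<close> have a common point; minimality of \<open>P\<close> then makes
every \<open>U\<close> invertible modulo \<open>P\<close>. Hence the operators act on the orbit of \<open>x\<close> like a group of
uniformly bounded invertible maps.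

If the weak* closure of the orbit is norm separable, Baire's theorem gives a weak* open piece of it of
small norm diameter, and finitely many translates of this piece cover the orbit, which is thus
totally bounded.

If the orbit is relatively compact, \<open>t \<mapsto> T(t)x\<close> extends to an almost periodic function \<open>F\<close> on \<open>\<real>\<close>.
Let \<open>h\<close> be the autocorrelation of a bump function of \<open>\<parallel>F(t) - x\<parallel>\<close>; the mean of \<open>h F\<close> is close to a
multiple of \<open>x\<close>. As \<open>h\<close> is positive definite and almost periodic, it is a uniform limit of combinations of
characters \<open>\<xi>\<close>, and the mean of \<open>\<xi> F\<close> is an eigenvector. For this approximation theorem it
suffices that a nonzero almost periodic positive definite \<open>r\<close> dominates a positive multiple of a
character. Such a character is found among the normalized positive definite \<open>q\<close> for which the
convolution of \<open>r\<close> and \<open>q\<close> is \<open>\<mu> q\<close> with \<open>\<mu>\<close> maximal: it is an extreme point of this compact convex set.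
\<close>

text \<open>Eigenvectors of a compact orbit are usually found by integrating characters over a
  compact group. Here the acting group is \<open>real\<close> taken without its topology, and
  averages over finitely many translates replace integration: averaging an almost periodic function
  contracts its oscillation, so there is a unique invariant mean. Inverses exist only modulo
  \<open>P\<close>, which is why the one-parameter group lives on the range of \<open>P\<close>.
  Positive definiteness serves as an order in which one number controls a whole function, since such
  a function is bounded by its value at 0. Suprema and limits of values at 0 therefore become
  uniform statements, both in the search for \<mu> and when characters are split off one after
  another. Compactness comes from convolution by \<open>r\<close>, whose results all share the nets
  of \<open>r\<close>. The bump function need not be positive definite, hence its autocorrelation.
  The support stays under control: if the orbit is near \<open>x\<close> at \<open>s\<close> and at
  \<open>s + t\<close>, it is near \<open>x\<close> at \<open>t\<close>, because the operators of
  the group are bounded by a common constant.\<close>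

subsection \<open>Almost periodic functions on an abelian group and their mean\<close>

text \<open>Bochner's condition for the discrete group: the set of translates is totally bounded in the
supremum norm.\<close>

definition almost_periodic :: "('g::ab_group_add \<Rightarrow> 'b::real_normed_vector) \<Rightarrow> bool" where
  "almost_periodic F \<longleftrightarrow> (\<forall>e>0. \<exists>N. finite N \<and> (\<forall>s. \<exists>n\<in>N. \<forall>t. norm (F (t + s) - F (t + n)) \<le> e))"

definition avg :: "'g::ab_group_add list \<Rightarrow> ('g \<Rightarrow> 'b::real_normed_vector) \<Rightarrow> 'g \<Rightarrow> 'b" where
  "avg xs F t = (1 / real (length xs)) *\<^sub>R (\<Sum>s\<leftarrow>xs. F (t + s))"

text \<open>The convolution of two counting measures. Coinciding sums must count with multiplicity,
  which is why averages run over lists and not over finite sets.\<close>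

definition shift_sums :: "'g::ab_group_add list \<Rightarrow> 'g list \<Rightarrow> 'g list" where
  "shift_sums xs ys = concat (map (\<lambda>x. map (\<lambda>y. x + y) ys) xs)"

lemma length_shift_sums: "length (shift_sums xs ys) = length xs * length ys"
  by (induction xs) (auto simp: shift_sums_def)

lemma shift_sums_eq_Nil_iff: "shift_sums xs ys = [] \<longleftrightarrow> xs = [] \<or> ys = []"
  using length_shift_sums[of xs ys] by (metis length_0_conv mult_eq_0_iff)

lemma sum_list_shift_sums:
  fixes f :: "'g::ab_group_add \<Rightarrow> 'b::comm_monoid_add"
  shows "(\<Sum>s\<leftarrow>shift_sums xs ys. f s) = (\<Sum>x\<leftarrow>xs. \<Sum>y\<leftarrow>ys. f (x + y))"
  by (induction xs) (auto simp: shift_sums_def comp_def)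

lemma sum_list_swap:
  fixes f :: "'a \<Rightarrow> 'b \<Rightarrow> 'c::comm_monoid_add"
  shows "(\<Sum>x\<leftarrow>xs. \<Sum>y\<leftarrow>ys. f x y) = (\<Sum>y\<leftarrow>ys. \<Sum>x\<leftarrow>xs. f x y)"
  by (induction xs) (auto simp: sum_list_addf)

lemma sum_list_scaleR:
  fixes f :: "'a \<Rightarrow> 'b::real_vector"
  shows "(\<Sum>x\<leftarrow>xs. c *\<^sub>R f x) = c *\<^sub>R (\<Sum>x\<leftarrow>xs. f x)"
  by (induction xs) (auto simp: scaleR_add_right)

lemma avg_shift_sums: "avg (shift_sums xs ys) F t = avg xs (avg ys F) t"
proof -
  have "avg xs (avg ys F) t = (1 / real (length xs)) *\<^sub>R
      (\<Sum>x\<leftarrow>xs. (1 / real (length ys)) *\<^sub>R (\<Sum>y\<leftarrow>ys. F (t + x + y)))"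
    by (simp add: avg_def)
  also have "\<dots> = avg (shift_sums xs ys) F t"
    by (simp add: sum_list_scaleR avg_def length_shift_sums sum_list_shift_sums add.assoc)
  finally show ?thesis by simp
qed

text \<open>Together with \<open>avg_shift_sums\<close> this says that averaging operators commute;
  here commutativity of the group enters.\<close>

lemma avg_shift_sums': "avg (shift_sums xs ys) F t = avg ys (avg xs F) t"
proof -
  have "avg (shift_sums xs ys) F t = (1 / real (length xs * length ys)) *\<^sub>R
      (\<Sum>y\<leftarrow>ys. \<Sum>x\<leftarrow>xs. F (t + (x + y)))"
    unfolding avg_def length_shift_sums sum_list_shift_sums by (subst sum_list_swap) simp
  also have "\<dots> = avg (shift_sums ys xs) F t"
    unfolding avg_def length_shift_sums sum_list_shift_sums by (simp add: add.commute mult.commute)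
  finally show ?thesis by (simp add: avg_shift_sums)
qed

lemma norm_sum_list_le:
  fixes f :: "'a \<Rightarrow> 'b::real_normed_vector"
  assumes "\<And>x. x \<in> set xs \<Longrightarrow> norm (f x) \<le> e"
  shows "norm (\<Sum>x\<leftarrow>xs. f x) \<le> real (length xs) * e"
  using assms
proof (induction xs)
  case (Cons a xs)
  have "norm (f a + (\<Sum>x\<leftarrow>xs. f x)) \<le> e + real (length xs) * e"
    using Cons by (intro norm_triangle_le add_mono) auto
  then show ?case by (simp add: algebra_simps)
qed simp

lemma avg_const [simp]: "xs \<noteq> [] \<Longrightarrow> avg xs (\<lambda>_. c) t = c"
proof -
  assume "xs \<noteq> []"
  have "(\<Sum>s\<leftarrow>xs. c) = real (length xs) *\<^sub>R c"
    by (induction xs) (auto simp: algebra_simps)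
  then show ?thesis using \<open>xs \<noteq> []\<close> by (simp add: avg_def)
qed

lemma avg_add: "avg xs (\<lambda>t. F t + G t) t = avg xs F t + avg xs G t"
  by (simp add: avg_def sum_list_addf scaleR_add_right)

lemma avg_diff: "avg xs (\<lambda>t. F t - G t) t = avg xs F t - avg xs G t"
  by (simp add: avg_def sum_list_subtractf scaleR_diff_right)

lemma avg_bounded_linear:
  assumes "bounded_linear L"
  shows "avg xs (\<lambda>t. L (F t)) t = L (avg xs F t)"
proof -
  interpret bounded_linear L by fact
  have "L (\<Sum>s\<leftarrow>xs. F (t + s)) = (\<Sum>s\<leftarrow>xs. L (F (t + s)))"
    by (induction xs) (auto simp: add zero)
  then show ?thesis by (simp add: avg_def scaleR)
qed

lemma avg_translate: "avg xs (\<lambda>t. F (t + a)) t = avg xs F (t + a)"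
  by (simp add: avg_def algebra_simps)

lemma norm_avg_le:
  assumes "\<And>t. norm (F t) \<le> e" "xs \<noteq> []"
  shows "norm (avg xs F t) \<le> e"
proof -
  have "norm (\<Sum>s\<leftarrow>xs. F (t + s)) \<le> real (length xs) * e"
    by (rule norm_sum_list_le) (use assms in auto)
  then show ?thesis using assms(2) by (simp add: avg_def field_simps)
qed

lemma dist_avg_le:
  assumes "\<And>t. norm (F t - c) \<le> e" "xs \<noteq> []"
  shows "norm (avg xs F t - c) \<le> e"
  using norm_avg_le[of "\<lambda>t. F t - c" e xs t] assms by (simp add: avg_diff)

lemma dist_avg_avg_le:
  assumes "\<And>t. norm (F (t + a) - F (t + b)) \<le> e" "xs \<noteq> []"
  shows "norm (avg xs F (t + a) - avg xs F (t + b)) \<le> e"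
  using norm_avg_le[of "\<lambda>t. F (t + a) - F (t + b)" e xs t] assms
  by (simp add: avg_diff avg_translate)

text \<open>Von Neumann's mean: a constant that is a uniform limit of averages of translates.
  Uniformity in \<open>t\<close> makes it unique and translation invariant, so that it can stand in
  for a Haar integral.\<close>

definition has_mean :: "('g::ab_group_add \<Rightarrow> 'b::real_normed_vector) \<Rightarrow> 'b \<Rightarrow> bool" where
  "has_mean F c \<longleftrightarrow> (\<forall>e>0. \<exists>xs. xs \<noteq> [] \<and> (\<forall>t. norm (avg xs F t - c) \<le> e))"

text \<open>An average that is uniformly near a constant stays so under any further averaging, so
  \<open>shift_sums\<close> of the two lists serves both functions.\<close>

lemma has_mean_common:
  assumes "has_mean F c" "has_mean G d" "e > 0"
  shows "\<exists>xs. xs \<noteq> [] \<and> (\<forall>t. norm (avg xs F t - c) \<le> e \<and> norm (avg xs G t - d) \<le> e)"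
proof -
  obtain xs ys where xs: "xs \<noteq> []" "\<And>t. norm (avg xs F t - c) \<le> e"
    and ys: "ys \<noteq> []" "\<And>t. norm (avg ys G t - d) \<le> e"
    using assms unfolding has_mean_def by meson
  have "norm (avg ys (avg xs F) t - c) \<le> e" "norm (avg xs (avg ys G) t - d) \<le> e" for t
    by (rule dist_avg_le; use xs ys in simp)+
  then have "norm (avg (shift_sums xs ys) F t - c) \<le> e" "norm (avg (shift_sums xs ys) G t - d) \<le> e" for t
    using avg_shift_sums'[of xs ys F t] avg_shift_sums[of xs ys G t] by auto
  then show ?thesis
    using xs(1) ys(1) by (intro exI[of _ "shift_sums xs ys"]) (auto simp: shift_sums_eq_Nil_iff)
qed

lemma has_mean_add:
  assumes "has_mean F c" "has_mean G d"
  shows "has_mean (\<lambda>t. F t + G t) (c + d)"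
  unfolding has_mean_def
proof (intro allI impI)
  fix e :: real assume "e > 0"
  then obtain xs where xs: "xs \<noteq> []" "\<And>t. norm (avg xs F t - c) \<le> e / 2" "\<And>t. norm (avg xs G t - d) \<le> e / 2"
    using has_mean_common[OF assms half_gt_zero] by blast
  have "norm (avg xs (\<lambda>t. F t + G t) t - (c + d)) \<le> e" for t
    using norm_triangle_ineq[of "avg xs F t - c" "avg xs G t - d"] xs(2)[of t] xs(3)[of t]
    by (simp add: avg_add algebra_simps)
  with xs(1) show "\<exists>xs. xs \<noteq> [] \<and> (\<forall>t. norm (avg xs (\<lambda>t. F t + G t) t - (c + d)) \<le> e)" by blast
qed

lemma has_mean_norm_mono:
  assumes "has_mean F c" "has_mean g d" "\<And>t. norm (F t) \<le> g t"
  shows "norm c \<le> d"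
proof (rule field_le_epsilon)
  fix e :: real assume "e > 0"
  then obtain xs where xs: "xs \<noteq> []" "\<And>t. norm (avg xs F t - c) \<le> e / 2" "\<And>t. norm (avg xs g t - d) \<le> e / 2"
    using has_mean_common[OF assms(1,2) half_gt_zero] by blast
  have "norm (\<Sum>s\<leftarrow>xs. F (0 + s)) \<le> (\<Sum>s\<leftarrow>xs. g (0 + s))"
  proof (induction xs)
    case (Cons a xs)
    then show ?case using assms(3)[of "0 + a"] norm_triangle_ineq[of "F (0 + a)" "\<Sum>s\<leftarrow>xs. F (0 + s)"] by simp
  qed simp
  then have "norm (avg xs F 0) \<le> avg xs g 0" unfolding avg_def by (simp add: divide_right_mono)
  moreover have "\<bar>avg xs g 0 - d\<bar> \<le> e / 2" using xs(3)[of 0] by simp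
  ultimately show "norm c \<le> d + e"
    using xs(2)[of 0] norm_triangle_sub[of c "avg xs F 0"] norm_minus_commute[of c "avg xs F 0"] by linarith
qed

lemma has_mean_bounded_linear:
  assumes "bounded_linear L" "has_mean F c"
  shows "has_mean (\<lambda>t. L (F t)) (L c)"
  unfolding has_mean_def
proof (intro allI impI)
  fix e :: real assume "e > 0"
  interpret bounded_linear L by fact
  obtain K where K: "K > 0" "\<And>x. norm (L x) \<le> norm x * K"
    using pos_bounded by blast
  then obtain xs where xs: "xs \<noteq> []" "\<And>t. norm (avg xs F t - c) \<le> e / K"
    using assms \<open>e > 0\<close> unfolding has_mean_def by (meson divide_pos_pos)
  have "norm (avg xs (\<lambda>t. L (F t)) t - L c) \<le> e" for t
  proof -
    have "norm (L (avg xs F t - c)) \<le> norm (avg xs F t - c) * K" by (rule K)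
    also have "\<dots> \<le> e / K * K" using xs K by (intro mult_right_mono) auto
    finally show ?thesis using K by (simp add: avg_bounded_linear[OF assms(1)] diff)
  qed
  with xs show "\<exists>xs. xs \<noteq> [] \<and> (\<forall>t. norm (avg xs (\<lambda>t. L (F t)) t - L c) \<le> e)" by blast
qed

lemma has_mean_const: "has_mean (\<lambda>_. c) c"
  unfolding has_mean_def by (intro allI impI exI[of _ "[0]"]) auto

lemma has_mean_norm_le:
  assumes "has_mean F c" "\<And>t. norm (F t) \<le> B"
  shows "norm c \<le> B"
proof (rule field_le_epsilon)
  fix e :: real assume "e > 0"
  then obtain xs where xs: "xs \<noteq> []" "\<And>t. norm (avg xs F t - c) \<le> e"
    using assms unfolding has_mean_def by blast
  have "norm c \<le> norm (avg xs F 0) + norm (c - avg xs F 0)"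
    by (rule norm_triangle_sub)
  then show "norm c \<le> B + e"
    using norm_avg_le[of F B xs 0] assms xs by (metis add_mono norm_minus_commute order_trans)
qed

lemma has_mean_diff:
  assumes "has_mean F c" "has_mean G d"
  shows "has_mean (\<lambda>t. F t - G t) (c - d)"
  using has_mean_add[OF assms(1) has_mean_bounded_linear[OF bounded_linear_minus[OF bounded_linear_ident] assms(2)]]
  by simp

lemma has_mean_dist_le:
  assumes "has_mean F c" "has_mean G d" "\<And>t. norm (F t - G t) \<le> B"
  shows "norm (c - d) \<le> B"
  using has_mean_norm_le[OF has_mean_diff[OF assms(1,2)]] assms(3) by blast

lemma has_mean_unique: "has_mean F c \<Longrightarrow> has_mean F d \<Longrightarrow> c = d"
  using has_mean_dist_le[of F c F d 0] by simp

lemma has_mean_translate: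
  assumes "has_mean F c" shows "has_mean (\<lambda>t. F (t + a)) c"
  using assms unfolding has_mean_def avg_translate by meson

lemma has_mean_reflect:
  assumes "has_mean F c" shows "has_mean (\<lambda>t. F (- t)) c"
proof -
  have "avg (map uminus xs) (\<lambda>t. F (- t)) t = avg xs F (- t)" for xs t
    by (simp add: avg_def comp_def)
  then show ?thesis using assms unfolding has_mean_def by (metis map_is_Nil_conv)
qed

lemma has_mean_nonneg:
  fixes F :: "'g::ab_group_add \<Rightarrow> real"
  assumes "has_mean F c" "\<And>t. 0 \<le> F t"
  shows "0 \<le> c"
proof (rule field_le_epsilon)
  fix e :: real assume "e > 0"
  then obtain xs where xs: "xs \<noteq> []" "\<And>t. norm (avg xs F t - c) \<le> e"
    using assms unfolding has_mean_def by blast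
  have "0 \<le> avg xs F 0"
    unfolding avg_def using assms(2) by (auto intro!: divide_nonneg_nonneg sum_list_nonneg)
  then show "0 \<le> c + e" using xs(2)[of 0] by (simp add: abs_le_iff)
qed

lemma has_mean_mono:
  fixes F :: "'g::ab_group_add \<Rightarrow> real"
  assumes "has_mean F c" "has_mean G d" "\<And>t. F t \<le> G t"
  shows "c \<le> d"
  using has_mean_nonneg[OF has_mean_diff[OF assms(2,1)]] assms(3) by simp

lemma has_mean_sum:
  assumes "finite I" "\<And>i. i \<in> I \<Longrightarrow> has_mean (F i) (c i)"
  shows "has_mean (\<lambda>t. \<Sum>i\<in>I. F i t) (\<Sum>i\<in>I. c i)"
  using assms by (induction I rule: finite_induct) (auto intro: has_mean_const has_mean_add)

text \<open>Averaging over a net contracts the oscillation: of the \<open>n\<close> pairs of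
  summands in the two averages, one can be matched up to \<open>e\<close>, and the other
  \<open>n - 1\<close> differ by at most \<open>B\<close> each.\<close>

lemma almost_periodic_osc_avg:
  assumes xs: "xs \<noteq> []"
    and net: "\<And>s. \<exists>n\<in>set xs. \<forall>t. norm (G (t + s) - G (t + n)) \<le> e"
    and osc: "\<And>s t. norm (G s - G t) \<le> B"
  shows "norm (avg xs G s - avg xs G t) \<le> (1 - 1 / real (length xs)) * B + e / real (length xs)"
proof -
  obtain a as where as: "xs = a # as" using xs by (cases xs) auto
  define n where "n = length xs"
  have "n > 0" using xs n_def by simp
  \<comment> \<open>The net point for the shift \<open>s + a - t\<close>; at \<open>u = t\<close> it
    pairs \<open>G (s + a)\<close> with \<open>G (t + b)\<close>.\<close>
  obtain b where b: "b \<in> set xs" "\<And>u. norm (G (u + (s + a - t)) - G (u + b)) \<le> e"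
    using net by blast
  obtain bs cs where bc: "xs = bs @ b # cs" using b(1) by (meson split_list)
  have sum_b: "(\<Sum>y\<leftarrow>xs. G (t + y)) = G (t + b) + (\<Sum>y\<leftarrow>bs @ cs. G (t + y))"
    by (simp add: bc algebra_simps)
  have len: "length (bs @ cs) = length as" using bc as by (metis append_Cons length_append_singleton
        length_append list.size(4) add_Suc_right nat.inject add_0_right One_nat_def)
  have pair: "norm ((\<Sum>x\<leftarrow>us. G (s + x)) - (\<Sum>y\<leftarrow>vs. G (t + y))) \<le> real (length us) * B"
    if "length us = length vs" for us vs
    using that
  proof (induction us vs rule: list_induct2)
    case (Cons x us y vs)
    have "norm ((G (s + x) - G (t + y)) + ((\<Sum>x\<leftarrow>us. G (s + x)) - (\<Sum>y\<leftarrow>vs. G (t + y))))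
        \<le> B + real (length us) * B"
      by (intro norm_triangle_le add_mono Cons osc)
    then show ?case by (simp add: algebra_simps)
  qed simp
  have "norm ((G (s + a) - G (t + b)) + ((\<Sum>x\<leftarrow>as. G (s + x)) - (\<Sum>y\<leftarrow>bs @ cs. G (t + y))))
      \<le> e + real (length as) * B"
    using b(2)[of t] pair[OF len[symmetric]]
    by (intro norm_triangle_le add_mono) (auto simp: ac_simps)
  then have "norm ((\<Sum>x\<leftarrow>xs. G (s + x)) - (\<Sum>y\<leftarrow>xs. G (t + y))) \<le> e + (real n - 1) * B"
    unfolding sum_b by (simp add: as n_def algebra_simps)
  then have "norm (avg xs G s - avg xs G t) \<le> (1 / real n) * (e + (real n - 1) * B)"
    unfolding avg_def n_def[symmetric] scaleR_diff_right[symmetric]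
    using \<open>n > 0\<close> by (simp add: divide_right_mono)
  also have "\<dots> = (1 - 1 / real n) * B + e / real n"
    using \<open>n > 0\<close> by (simp add: field_simps)
  finally show ?thesis by (simp add: n_def)
qed

lemma almost_periodic_bounded:
  assumes "almost_periodic F" shows "\<exists>B. \<forall>t. norm (F t) \<le> B"
proof -
  obtain N where N: "finite N" "\<And>s. \<exists>n\<in>N. \<forall>t. norm (F (t + s) - F (t + n)) \<le> 1"
    using assms unfolding almost_periodic_def by (meson zero_less_one)
  have "norm (F s) \<le> 1 + Max (insert 0 ((\<lambda>n. norm (F n)) ` N))" for s
  proof -
    obtain n where n: "n \<in> N" "norm (F (0 + s) - F (0 + n)) \<le> 1" using N by blast
    have "norm (F s) \<le> norm (F n) + norm (F s - F n)" by (rule norm_triangle_sub)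
    moreover have "norm (F n) \<le> Max (insert 0 ((\<lambda>n. norm (F n)) ` N))"
      using N n by (intro Max_ge) auto
    ultimately show ?thesis using n by simp
  qed
  then show ?thesis by blast
qed

text \<open>The contraction is iterated with one net \<open>xs\<close>, which remains a net for
  every average of \<open>F\<close>. With \<open>q = 1 - 1 / n\<close>, the number
  \<open>e / 2\<close> is the fixed point of \<open>B \<mapsto> q * B + (e / 2) / n\<close>, so the
  oscillation is bounded by \<open>e / 2\<close> plus a geometric term.\<close>

lemma almost_periodic_small_osc:
  fixes F :: "'g::ab_group_add \<Rightarrow> 'b::real_normed_vector"
  assumes "almost_periodic F" "e > 0"
  shows "\<exists>ys. ys \<noteq> [] \<and> (\<forall>s t. norm (avg ys F s - avg ys F t) \<le> e)"
proof -
  obtain N where N: "finite N" "\<And>s. \<exists>n\<in>N. \<forall>t. norm (F (t + s) - F (t + n)) \<le> e / 2"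
    using assms unfolding almost_periodic_def by (meson half_gt_zero)
  obtain xs where xs: "set xs = N" using N(1) finite_list by blast
  then have "xs \<noteq> []" using N(2) by auto
  obtain B0 where B0: "\<And>t. norm (F t) \<le> B0" using almost_periodic_bounded assms(1) by blast
  then have "0 \<le> B0" by (meson norm_ge_zero order_trans)
  define n where "n = length xs"
  define q where "q = 1 - 1 / real n"
  have "n > 0" using \<open>xs \<noteq> []\<close> n_def by simp
  then have q: "0 \<le> q" "q < 1" "(1 - q) = 1 / real n" by (auto simp: q_def field_simps)
  have "\<exists>ys. ys \<noteq> [] \<and> (\<forall>s t. norm (avg ys F s - avg ys F t) \<le> q ^ k * (2 * B0) + e / 2)" for k
  proof (induction k)
    case 0
    have "norm (F s - F t) \<le> 2 * B0 + e / 2" for s t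
      using norm_triangle_ineq4[of "F s" "F t"] B0[of s] B0[of t] \<open>e > 0\<close> by linarith
    then show ?case by (intro exI[of _ "[0]"]) (auto simp: avg_def)
  next
    case (Suc k)
    then obtain ys where ys: "ys \<noteq> []"
      "\<And>s t. norm (avg ys F s - avg ys F t) \<le> q ^ k * (2 * B0) + e / 2" by blast
    have "\<exists>n\<in>set xs. \<forall>t. norm (avg ys F (t + s) - avg ys F (t + n)) \<le> e / 2" for s
      using dist_avg_avg_le[of F s _ "e / 2" ys] N(2) ys(1) xs by metis
    then have "norm (avg xs (avg ys F) s - avg xs (avg ys F) t)
        \<le> q * (q ^ k * (2 * B0) + e / 2) + (e / 2) / real n" for s t
      using almost_periodic_osc_avg[OF \<open>xs \<noteq> []\<close>, of "avg ys F" "e / 2" _ s t] ys(2)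
      unfolding n_def q_def by blast
    moreover have "q * (q ^ k * (2 * B0) + e / 2) + (e / 2) / real n = q ^ Suc k * (2 * B0) + e / 2"
    proof -
      have "(e / 2) / real n = (e / 2) * (1 - q)" unfolding q(3) by simp
      then show ?thesis by (simp add: algebra_simps)
    qed
    ultimately show ?case
      using \<open>xs \<noteq> []\<close> ys(1)
      by (intro exI[of _ "shift_sums xs ys"]) (simp add: avg_shift_sums shift_sums_eq_Nil_iff)
  qed
  moreover have "\<exists>k. q ^ k * (2 * B0) < e / 2"
  proof -
    have "(\<lambda>k. q ^ k * (2 * B0)) \<longlonglongrightarrow> 0 * (2 * B0)"
      using q by (intro tendsto_intros LIMSEQ_realpow_zero) auto
    then have "\<forall>\<^sub>F k in sequentially. q ^ k * (2 * B0) < e / 2"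
      using \<open>e > 0\<close> by (intro order_tendstoD) auto
    then show ?thesis by (auto simp: eventually_sequentially)
  qed
  ultimately obtain k ys where "q ^ k * (2 * B0) < e / 2" "ys \<noteq> []"
    "\<And>s t. norm (avg ys F s - avg ys F t) \<le> q ^ k * (2 * B0) + e / 2" by meson
  then have "norm (avg ys F s - avg ys F t) \<le> e" for s t
    by (smt (verit, best) field_sum_of_halves)
  with \<open>ys \<noteq> []\<close> show ?thesis by blast
qed

lemma almost_periodic_has_mean_exists:
  fixes F :: "'g::ab_group_add \<Rightarrow> 'b::banach"
  assumes "almost_periodic F" shows "\<exists>c. has_mean F c"
proof -
  have "\<forall>k. \<exists>ys. ys \<noteq> [] \<and> (\<forall>s t. norm (avg ys F s - avg ys F t) \<le> 1 / real (Suc k))"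
    using almost_periodic_small_osc[OF assms] by simp
  then obtain ys where ys: "\<And>k. ys k \<noteq> []"
    "\<And>k s t. norm (avg (ys k) F s - avg (ys k) F t) \<le> 1 / real (Suc k)" by metis
  have near: "norm (avg (ys j) F s - avg (ys k) F t) \<le> 1 / real (Suc j) + 1 / real (Suc k)" for j k s t
  proof -
    \<comment> \<open>A common refinement: averaging either average further by the other list leads
      to this value, and moves it by no more than its oscillation.\<close>
    let ?z = "avg (shift_sums (ys j) (ys k)) F 0"
    have "norm (avg (ys k) (avg (ys j) F) 0 - avg (ys j) F s) \<le> 1 / real (Suc j)"
      "norm (avg (ys j) (avg (ys k) F) 0 - avg (ys k) F t) \<le> 1 / real (Suc k)"
      by (intro dist_avg_le ys)+
    then have "norm (?z - avg (ys j) F s) \<le> 1 / real (Suc j)" "norm (?z - avg (ys k) F t) \<le> 1 / real (Suc k)"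
      by (simp_all only: avg_shift_sums avg_shift_sums' flip: avg_shift_sums'[of "ys j" "ys k" F 0])
    then show ?thesis
      using norm_triangle_ineq4[of "?z - avg (ys k) F t" "?z - avg (ys j) F s"] by simp
  qed
  have small: "\<exists>M. \<forall>j\<ge>M. 1 / real (Suc j) < e" if "e > 0" for e :: real
  proof -
    have "(\<lambda>j. 1 / real (Suc j)) \<longlonglongrightarrow> 0" by (rule LIMSEQ_Suc[OF lim_1_over_n])
    from order_tendstoD(2)[OF this that] show ?thesis unfolding eventually_sequentially .
  qed
  have "Cauchy (\<lambda>k. avg (ys k) F 0)"
  proof (rule metric_CauchyI)
    fix e :: real assume "e > 0"
    then obtain M where M: "\<And>j. j \<ge> M \<Longrightarrow> 1 / real (Suc j) < e / 2"
      using small[of "e / 2"] by auto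
    show "\<exists>M. \<forall>m\<ge>M. \<forall>n\<ge>M. dist (avg (ys m) F 0) (avg (ys n) F 0) < e"
    proof (intro exI allI impI)
      fix m n assume "m \<ge> M" "n \<ge> M"
      then show "dist (avg (ys m) F 0) (avg (ys n) F 0) < e"
        using near[of m 0 n 0] M[of m] M[of n] unfolding dist_norm by linarith
    qed
  qed
  then obtain c where c: "(\<lambda>k. avg (ys k) F 0) \<longlonglongrightarrow> c"
    using Cauchy_convergent convergent_def by blast
  have "has_mean F c"
    unfolding has_mean_def
  proof (intro allI impI)
    fix e :: real assume "e > 0"
    then obtain M where M: "\<And>j. j \<ge> M \<Longrightarrow> 1 / real (Suc j) < e / 2"
      using small[of "e / 2"] by auto
    have "norm (avg (ys M) F t - c) \<le> e" for t
    proof (rule Lim_norm_ubound[OF trivial_limit_sequentially])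
      show "(\<lambda>k. avg (ys M) F t - avg (ys k) F 0) \<longlonglongrightarrow> avg (ys M) F t - c"
        by (intro tendsto_intros c)
      show "\<forall>\<^sub>F k in sequentially. norm (avg (ys M) F t - avg (ys k) F 0) \<le> e"
        unfolding eventually_sequentially
      proof (intro exI allI impI)
        fix k assume "k \<ge> M"
        then show "norm (avg (ys M) F t - avg (ys k) F 0) \<le> e"
          using near[of M t k 0] M[of M] M[of k] by linarith
      qed
    qed
    with ys(1) show "\<exists>xs. xs \<noteq> [] \<and> (\<forall>t. norm (avg xs F t - c) \<le> e)" by blast
  qed
  then show ?thesis by blast
qed

definition mean :: "('g::ab_group_add \<Rightarrow> 'b::real_normed_vector) \<Rightarrow> 'b" where
  "mean F = (THE c. has_mean F c)"

lemma mean_eqI: "has_mean F c \<Longrightarrow> mean F = c"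
  unfolding mean_def using has_mean_unique by blast

lemma has_mean_mean: "almost_periodic F \<Longrightarrow> has_mean F (mean F)" for F :: "'g::ab_group_add \<Rightarrow> 'b::banach"
  using almost_periodic_has_mean_exists mean_eqI by metis

section \<open>Stability of almost periodicity\<close>

lemma almost_periodic_common_net:
  assumes "almost_periodic F" "almost_periodic G" "e > 0"
  shows "\<exists>N. finite N \<and> (\<forall>s. \<exists>n\<in>N. \<forall>t. norm (F (t + s) - F (t + n)) \<le> e \<and> norm (G (t + s) - G (t + n)) \<le> e)"
proof -
  obtain N where N: "finite N" "\<And>s. \<exists>n\<in>N. \<forall>t. norm (F (t + s) - F (t + n)) \<le> e / 2"
    using assms unfolding almost_periodic_def by (meson half_gt_zero)
  obtain N' where N': "finite N'" "\<And>s. \<exists>n\<in>N'. \<forall>t. norm (G (t + s) - G (t + n)) \<le> e / 2"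
    using assms unfolding almost_periodic_def by (meson half_gt_zero)
  define near where "near = (\<lambda>(n, m) s. (\<forall>t. norm (F (t + s) - F (t + n)) \<le> e / 2) \<and>
    (\<forall>t. norm (G (t + s) - G (t + m)) \<le> e / 2))"
  \<comment> \<open>The nets \<open>N\<close> and \<open>N'\<close> have different points, so each
    pair of classes gets one representative lying in both; comparison through the net points doubles
    \<open>e / 2\<close>. For a pair that no \<open>s\<close> meets, the value of \<open>rep\<close>
    is arbitrary and harmless.\<close>
  define rep where "rep = (\<lambda>p. SOME s. near p s)"
  have "\<exists>n\<in>rep ` (N \<times> N'). \<forall>t. norm (F (t + s) - F (t + n)) \<le> e \<and> norm (G (t + s) - G (t + n)) \<le> e" for s
  proof -
    obtain n m where nm: "n \<in> N" "m \<in> N'" "near (n, m) s"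
      using N(2)[of s] N'(2)[of s] unfolding near_def by auto
    have "near (n, m) (rep (n, m))" unfolding rep_def using nm(3) by (rule someI)
    then have r: "\<And>t. norm (F (t + rep (n, m)) - F (t + n)) \<le> e / 2"
        "\<And>t. norm (G (t + rep (n, m)) - G (t + m)) \<le> e / 2"
      and s: "\<And>t. norm (F (t + s) - F (t + n)) \<le> e / 2" "\<And>t. norm (G (t + s) - G (t + m)) \<le> e / 2"
      using nm(3) by (auto simp: near_def)
    have "norm (F (t + s) - F (t + rep (n, m))) \<le> e" "norm (G (t + s) - G (t + rep (n, m))) \<le> e" for t
      using norm_triangle_ineq4[of "F (t + s) - F (t + n)" "F (t + rep (n, m)) - F (t + n)"]
        norm_triangle_ineq4[of "G (t + s) - G (t + m)" "G (t + rep (n, m)) - G (t + m)"]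
        r[of t] s[of t] by simp_all
    with nm show ?thesis by blast
  qed
  moreover have "finite (rep ` (N \<times> N'))" using N N' by blast
  ultimately show ?thesis by blast
qed

lemma almost_periodic_Lipschitz:
  assumes "almost_periodic F" "\<And>s t. norm (G s - G t) \<le> K * norm (F s - F t)"
  shows "almost_periodic G"
  unfolding almost_periodic_def
proof (intro allI impI)
  fix e :: real assume "e > 0"
  then have "e / (\<bar>K\<bar> + 1) > 0" by simp
  then obtain N where N: "finite N" "\<And>s. \<exists>n\<in>N. \<forall>t. norm (F (t + s) - F (t + n)) \<le> e / (\<bar>K\<bar> + 1)"
    using assms(1) unfolding almost_periodic_def by meson
  have "norm (G s - G t) \<le> e" if "norm (F s - F t) \<le> e / (\<bar>K\<bar> + 1)" for s t
  proof -
    have "norm (G s - G t) \<le> (\<bar>K\<bar> + 1) * norm (F s - F t)"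
      using assms(2)[of s t] by (rule order_trans) (intro mult_right_mono, auto)
    also have "\<dots> \<le> (\<bar>K\<bar> + 1) * (e / (\<bar>K\<bar> + 1))" by (intro mult_left_mono that) auto
    also have "\<dots> = e" by (simp add: add_nonneg_eq_0_iff)
    finally show ?thesis .
  qed
  with N show "\<exists>N. finite N \<and> (\<forall>s. \<exists>n\<in>N. \<forall>t. norm (G (t + s) - G (t + n)) \<le> e)" by meson
qed

lemma almost_periodic_const: "almost_periodic (\<lambda>_. c)"
  unfolding almost_periodic_def by (intro allI impI exI[of _ "{0}"]) auto

lemma almost_periodic_bounded_linear:
  assumes "bounded_linear L" "almost_periodic F" shows "almost_periodic (\<lambda>t. L (F t))"
proof -
  interpret bounded_linear L by fact
  obtain K where "\<And>x. norm (L x) \<le> norm x * K" using bounded by blast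
  then show ?thesis
    by (intro almost_periodic_Lipschitz[OF assms(2), of _ K]) (simp add: mult.commute flip: diff)
qed

lemma almost_periodic_translate: assumes "almost_periodic F" shows "almost_periodic (\<lambda>t. F (t + a))"
  unfolding almost_periodic_def
proof (intro allI impI)
  fix e :: real assume "e > 0"
  then obtain N where N: "finite N" "\<And>s. \<exists>n\<in>N. \<forall>t. norm (F (t + s) - F (t + n)) \<le> e"
    using assms unfolding almost_periodic_def by meson
  have "\<exists>n\<in>N. \<forall>t. norm (F (t + s + a) - F (t + n + a)) \<le> e" for s
  proof -
    obtain n where "n \<in> N" "\<And>t. norm (F (t + s) - F (t + n)) \<le> e" using N by blast
    then have "norm (F (t + s + a) - F (t + n + a)) \<le> e" for t
      by (metis add.assoc add.commute)
    with \<open>n \<in> N\<close> show ?thesis by blast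
  qed
  with N show "\<exists>N. finite N \<and> (\<forall>s. \<exists>n\<in>N. \<forall>t. norm (F (t + s + a) - F (t + n + a)) \<le> e)" by blast
qed

lemma almost_periodic_reflect: assumes "almost_periodic F" shows "almost_periodic (\<lambda>t. F (- t))"
  unfolding almost_periodic_def
proof (intro allI impI)
  fix e :: real assume "e > 0"
  then obtain N where N: "finite N" "\<And>s. \<exists>n\<in>N. \<forall>t. norm (F (t + s) - F (t + n)) \<le> e"
    using assms unfolding almost_periodic_def by meson
  have "\<exists>n\<in>uminus ` N. \<forall>t. norm (F (- (t + s)) - F (- (t + n))) \<le> e" for s
  proof -
    obtain n where "n \<in> N" "\<And>t. norm (F (t + (- s)) - F (t + n)) \<le> e" using N by blast
    then have "norm (F (- (t + s)) - F (- (t + - n))) \<le> e" for t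
      by (metis minus_add_distrib minus_minus)
    with \<open>n \<in> N\<close> show ?thesis by blast
  qed
  with N show "\<exists>N. finite N \<and> (\<forall>s. \<exists>n\<in>N. \<forall>t. norm (F (- (t + s)) - F (- (t + n))) \<le> e)"
    by (meson finite_imageI)
qed

lemma almost_periodic_add: assumes "almost_periodic F" "almost_periodic G" shows "almost_periodic (\<lambda>t. F t + G t)"
  unfolding almost_periodic_def
proof (intro allI impI)
  fix e :: real assume "e > 0"
  then obtain N where N: "finite N" "\<And>s. \<exists>n\<in>N. \<forall>t. norm (F (t + s) - F (t + n)) \<le> e / 2 \<and> norm (G (t + s) - G (t + n)) \<le> e / 2"
    using almost_periodic_common_net[OF assms, of "e / 2"] by auto
  have "norm (F s + G s - (F t + G t)) \<le> e"
    if "norm (F s - F t) \<le> e / 2 \<and> norm (G s - G t) \<le> e / 2" for s t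
    using that norm_triangle_ineq[of "F s - F t" "G s - G t"] by (simp add: algebra_simps)
  with N show "\<exists>N. finite N \<and> (\<forall>s. \<exists>n\<in>N. \<forall>t. norm (F (t + s) + G (t + s) - (F (t + n) + G (t + n))) \<le> e)"
    by meson
qed

lemma almost_periodic_bilinear:
  assumes "bounded_bilinear pr" "almost_periodic F" "almost_periodic G" shows "almost_periodic (\<lambda>t. pr (F t) (G t))"
  unfolding almost_periodic_def
proof (intro allI impI)
  fix e :: real assume "e > 0"
  interpret bounded_bilinear pr by fact
  obtain K where K: "K > 0" "\<And>a b. norm (pr a b) \<le> norm a * norm b * K"
    using pos_bounded by blast
  obtain B where B: "\<And>t. norm (F t) \<le> B" using almost_periodic_bounded assms by blast
  obtain C where C: "\<And>t. norm (G t) \<le> C" using almost_periodic_bounded assms by blast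
  have BC: "B \<ge> 0" "C \<ge> 0" using B C norm_ge_zero order_trans by blast+
  define d where "d = e / ((B + C + 1) * K)"
  have "d > 0" using \<open>e > 0\<close> K BC by (simp add: d_def)
  then obtain N where N: "finite N" "\<And>s. \<exists>n\<in>N. \<forall>t. norm (F (t + s) - F (t + n)) \<le> d \<and> norm (G (t + s) - G (t + n)) \<le> d"
    using almost_periodic_common_net[OF assms(2,3), of d] by auto
  have "norm (pr (F s) (G s) - pr (F t) (G t)) \<le> e"
    if h: "norm (F s - F t) \<le> d \<and> norm (G s - G t) \<le> d" for s t
  proof -
    have "pr (F s) (G s) - pr (F t) (G t) = pr (F s) (G s - G t) + pr (F s - F t) (G t)"
      by (simp add: diff_left diff_right)
    then have "norm (pr (F s) (G s) - pr (F t) (G t)) \<le> norm (F s) * norm (G s - G t) * K + norm (F s - F t) * norm (G t) * K"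
      by (simp only:) (intro norm_triangle_le add_mono K(2))
    also have "\<dots> \<le> B * d * K + d * C * K"
      using h B C BC K \<open>d > 0\<close> by (intro add_mono mult_right_mono mult_mono) auto
    also have "\<dots> = d * ((B + C) * K)" by (simp add: algebra_simps)
    also have "\<dots> \<le> d * ((B + C + 1) * K)"
      using \<open>d > 0\<close> K by (intro mult_left_mono mult_right_mono) auto
    also have "\<dots> = e" using K BC by (simp add: d_def)
    finally show ?thesis .
  qed
  with N show "\<exists>N. finite N \<and> (\<forall>s. \<exists>n\<in>N. \<forall>t. norm (pr (F (t + s)) (G (t + s)) - pr (F (t + n)) (G (t + n))) \<le> e)"
    by meson
qed

lemmas almost_periodic_mult = almost_periodic_bilinear[OF bounded_bilinear_mult]
lemmas almost_periodic_cnj = almost_periodic_bounded_linear[OF bounded_linear_cnj]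
lemmas almost_periodic_Re = almost_periodic_bounded_linear[OF bounded_linear_Re]

lemma almost_periodic_diff: "almost_periodic F \<Longrightarrow> almost_periodic G \<Longrightarrow> almost_periodic (\<lambda>t. F t - G t)"
  using almost_periodic_add[of F "\<lambda>t. - G t"] almost_periodic_bounded_linear[OF bounded_linear_minus[OF bounded_linear_ident], of G]
  by simp

lemma almost_periodic_sum:
  assumes "finite I" "\<And>i. i \<in> I \<Longrightarrow> almost_periodic (F i)"
  shows "almost_periodic (\<lambda>t. \<Sum>i\<in>I. F i t)"
  using assms by (induction I rule: finite_induct) (auto intro: almost_periodic_const almost_periodic_add)

lemma almost_periodic_reflect_translate: assumes "almost_periodic F" shows "almost_periodic (\<lambda>t. F (a - t))"
proof -
  have "almost_periodic (\<lambda>t. F (- t + a))" using almost_periodic_reflect[OF almost_periodic_translate[OF assms]] .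
  then show ?thesis by simp
qed

lemma almost_periodic_uniform_limit:
  assumes "\<And>e. e > 0 \<Longrightarrow> \<exists>G. almost_periodic G \<and> (\<forall>t. norm (F t - G t) \<le> e)"
  shows "almost_periodic F"
  unfolding almost_periodic_def
proof (intro allI impI)
  fix e :: real assume "e > 0"
  then obtain G where G: "almost_periodic G" "\<And>t. norm (F t - G t) \<le> e / 3" using assms[of "e / 3"] by auto
  obtain N where N: "finite N" "\<And>s. \<exists>n\<in>N. \<forall>t. norm (G (t + s) - G (t + n)) \<le> e / 3"
    using G(1) \<open>e > 0\<close> unfolding almost_periodic_def by (meson divide_pos_pos zero_less_numeral)
  have "norm (F s - F t) \<le> e" if "norm (G s - G t) \<le> e / 3" for s t
  proof -
    have "norm (F s - F t) \<le> norm (F s - G s) + norm ((G s - G t) - (F t - G t))"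
      using norm_triangle_ineq[of "F s - G s" "(G s - G t) - (F t - G t)"] by simp
    also have "norm ((G s - G t) - (F t - G t)) \<le> norm (G s - G t) + norm (F t - G t)"
      by (rule norm_triangle_ineq4)
    finally show ?thesis using that G(2)[of s] G(2)[of t] by linarith
  qed
  with N show "\<exists>N. finite N \<and> (\<forall>s. \<exists>n\<in>N. \<forall>t. norm (F (t + s) - F (t + n)) \<le> e)" by meson
qed

text \<open>The mean is faithful: at every \<open>t\<close> some translate of \<open>G\<close> by a
  net point has a value close to \<open>G a\<close>, so a finite sum of translates is at least
  \<open>G a / 2\<close> everywhere, while its mean is \<open>card N * c\<close>.\<close>

lemma has_mean_pos:
  fixes G :: "'g::ab_group_add \<Rightarrow> real"
  assumes "almost_periodic G" "has_mean G c" "\<And>t. G t \<ge> 0" "G a > 0"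
  shows "c > 0"
proof -
  obtain N where N: "finite N" "\<And>s. \<exists>n\<in>N. \<forall>t. norm (G (t + s) - G (t + n)) \<le> G a / 2"
    using assms(1,4) unfolding almost_periodic_def by (meson half_gt_zero)
  have "G a / 2 \<le> (\<Sum>n\<in>N. G (t + n))" for t
  proof -
    obtain n where n: "n \<in> N" "norm (G (t + (a - t)) - G (t + n)) \<le> G a / 2" using N by blast
    then have "\<bar>G a - G (t + n)\<bar> \<le> G a / 2" by simp
    then have "G a / 2 \<le> G (t + n)" by linarith
    also have "\<dots> \<le> (\<Sum>n\<in>N. G (t + n))"
      using n N assms(3) by (intro member_le_sum) auto
    finally show ?thesis .
  qed
  moreover have "has_mean (\<lambda>t. \<Sum>n\<in>N. G (t + n)) (\<Sum>n\<in>N. c)"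
    by (rule has_mean_sum[OF N(1)]) (rule has_mean_translate[OF assms(2)])
  ultimately have "G a / 2 \<le> (\<Sum>n\<in>N. c)"
    using has_mean_mono[OF has_mean_const] by blast
  then have "0 < real (card N) * c" using assms(4) by simp
  then show ?thesis by (simp add: zero_less_mult_iff)
qed

section \<open>Uniform limits and compactness\<close>

lemma uniform_limit_sequentially_leI:
  fixes q :: "nat \<Rightarrow> 'a \<Rightarrow> 'b::metric_space"
  assumes "\<And>e. e > 0 \<Longrightarrow> \<exists>K. \<forall>k\<ge>K. \<forall>t\<in>A. dist (q k t) (p t) \<le> e"
  shows "uniform_limit A q p sequentially"
proof (rule uniform_limitI)
  fix e :: real assume "e > 0"
  then obtain K where "\<forall>k\<ge>K. \<forall>t\<in>A. dist (q k t) (p t) \<le> e / 2" using assms[of "e / 2"] by auto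
  then have "\<forall>k\<ge>K. \<forall>t\<in>A. dist (q k t) (p t) < e" using \<open>e > 0\<close> by fastforce
  then show "\<forall>\<^sub>F k in sequentially. \<forall>t\<in>A. dist (q k t) (p t) < e"
    by (auto simp: eventually_sequentially)
qed

text \<open>Arzela-Ascoli without a topology on the domain: in place of equicontinuity,
  \<open>net\<close> provides finitely many points that represent all others for every
  \<open>k\<close> at once. A diagonal sequence that converges on the countable union of these nets
  converges uniformly.\<close>

lemma uniform_subsequence:
  fixes q :: "nat \<Rightarrow> 'g \<Rightarrow> complex"
  assumes bdd: "\<And>k t. norm (q k t) \<le> B"
    and net: "\<And>e. e > 0 \<Longrightarrow> \<exists>N. finite N \<and> (\<forall>s. \<exists>n\<in>N. \<forall>k. norm (q k s - q k n) \<le> e)"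
  shows "\<exists>\<phi> p. strict_mono (\<phi>::nat \<Rightarrow> nat) \<and> uniform_limit UNIV (\<lambda>k. q (\<phi> k)) p sequentially"
proof -
  have "\<forall>j. \<exists>N. finite N \<and> (\<forall>s. \<exists>n\<in>N. \<forall>k. norm (q k s - q k n) \<le> 1 / real (Suc j))"
    using net by simp
  then obtain N where N: "\<And>j. finite (N j)"
    "\<And>j s. \<exists>n\<in>N j. \<forall>k. norm (q k s - q k n) \<le> 1 / real (Suc j)" by metis
  have cD: "countable (\<Union>j. N j)" using N(1) by (simp add: countable_finite)
  obtain \<phi> where \<phi>: "strict_mono \<phi>" "\<And>x. x \<in> (\<Union>j. N j) \<Longrightarrow> \<exists>l. (\<lambda>n. q (\<phi> n) x) \<longlonglongrightarrow> l"
    using function_convergent_subsequence[OF cD, of q B] bdd by metis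
  have unif: "\<exists>K. \<forall>k\<ge>K. \<forall>l\<ge>K. \<forall>t. norm (q (\<phi> k) t - q (\<phi> l) t) \<le> e" if "e > 0" for e
  proof -
    obtain j where j: "1 / real (Suc j) < e / 3"
      using nat_approx_posE[OF divide_pos_pos[OF \<open>e > 0\<close> zero_less_numeral]] .
    have "\<forall>n\<in>N j. \<exists>K. \<forall>k\<ge>K. \<forall>l\<ge>K. norm (q (\<phi> k) n - q (\<phi> l) n) < e / 3"
    proof
      fix n assume "n \<in> N j"
      then have "Cauchy (\<lambda>k. q (\<phi> k) n)"
        using \<phi>(2) LIMSEQ_imp_Cauchy by blast
      then show "\<exists>K. \<forall>k\<ge>K. \<forall>l\<ge>K. norm (q (\<phi> k) n - q (\<phi> l) n) < e / 3"
        using that CauchyD[of "\<lambda>k. q (\<phi> k) n" "e / 3"] by auto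
    qed
    then obtain K where K: "\<And>n k l. n \<in> N j \<Longrightarrow> k \<ge> K n \<Longrightarrow> l \<ge> K n \<Longrightarrow> norm (q (\<phi> k) n - q (\<phi> l) n) < e / 3"
      by metis
    show ?thesis
    proof (intro exI[of _ "Max (insert 0 (K ` N j))"] allI impI)
      fix k l t assume kl: "Max (insert 0 (K ` N j)) \<le> k" "Max (insert 0 (K ` N j)) \<le> l"
      obtain n where n: "n \<in> N j" "\<And>k. norm (q k t - q k n) \<le> 1 / real (Suc j)" using N(2) by blast
      then have "K n \<le> Max (insert 0 (K ` N j))" using N(1) by (intro Max_ge) auto
      then have "norm (q (\<phi> k) n - q (\<phi> l) n) < e / 3" using K n kl by (meson order_trans)
      moreover have "norm (q (\<phi> k) t - q (\<phi> l) t) \<le> norm (q (\<phi> k) t - q (\<phi> k) n)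
          + norm ((q (\<phi> k) n - q (\<phi> l) n) - (q (\<phi> l) t - q (\<phi> l) n))"
        using norm_triangle_ineq[of "q (\<phi> k) t - q (\<phi> k) n"
            "(q (\<phi> k) n - q (\<phi> l) n) - (q (\<phi> l) t - q (\<phi> l) n)"] by simp
      moreover have "norm ((q (\<phi> k) n - q (\<phi> l) n) - (q (\<phi> l) t - q (\<phi> l) n))
          \<le> norm (q (\<phi> k) n - q (\<phi> l) n) + norm (q (\<phi> l) t - q (\<phi> l) n)"
        by (rule norm_triangle_ineq4)
      ultimately show "norm (q (\<phi> k) t - q (\<phi> l) t) \<le> e"
        using n(2)[of "\<phi> k"] n(2)[of "\<phi> l"] j by linarith
    qed
  qed
  have "convergent (\<lambda>k. q (\<phi> k) t)" for t
  proof (rule Cauchy_convergent, rule metric_CauchyI)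
    fix e :: real assume "e > 0"
    then obtain K where "\<forall>k\<ge>K. \<forall>l\<ge>K. \<forall>t. norm (q (\<phi> k) t - q (\<phi> l) t) \<le> e / 2"
      using unif[of "e / 2"] by auto
    then show "\<exists>M. \<forall>m\<ge>M. \<forall>n\<ge>M. dist (q (\<phi> m) t) (q (\<phi> n) t) < e"
      unfolding dist_norm using \<open>e > 0\<close> by (metis le_less_trans less_divide_eq_numeral1(1) mult_2_right less_add_same_cancel1 divide_less_eq_numeral1(1))
  qed
  then obtain p where p: "\<And>t. (\<lambda>k. q (\<phi> k) t) \<longlonglongrightarrow> p t" unfolding convergent_def by metis
  have "\<exists>K. \<forall>k\<ge>K. \<forall>t. norm (q (\<phi> k) t - p t) \<le> e" if "e > 0" for e
  proof -
    obtain K where K: "\<And>k l t. k \<ge> K \<Longrightarrow> l \<ge> K \<Longrightarrow> norm (q (\<phi> k) t - q (\<phi> l) t) \<le> e"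
      using unif[OF \<open>e > 0\<close>] by blast
    have "norm (q (\<phi> k) t - p t) \<le> e" if "k \<ge> K" for k t
    proof (rule Lim_norm_ubound[OF trivial_limit_sequentially])
      show "(\<lambda>l. q (\<phi> k) t - q (\<phi> l) t) \<longlonglongrightarrow> q (\<phi> k) t - p t" by (intro tendsto_intros p)
      show "\<forall>\<^sub>F l in sequentially. norm (q (\<phi> k) t - q (\<phi> l) t) \<le> e"
        using K[OF that] by (auto simp: eventually_sequentially)
    qed
    then show ?thesis by blast
  qed
  then have "uniform_limit UNIV (\<lambda>k. q (\<phi> k)) p sequentially"
    by (intro uniform_limit_sequentially_leI) (simp add: dist_norm)
  with \<phi>(1) show ?thesis by blast
qed

subsection \<open>Positive definite functions\<close>

text \<open>The symmetry condition makes the quadratic form real, so the condition on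
  \<open>Re\<close> is the usual nonnegativity.\<close>

definition positive_definite :: "('g::ab_group_add \<Rightarrow> complex) \<Rightarrow> bool" where
  "positive_definite q \<longleftrightarrow> (\<forall>t. q (- t) = cnj (q t)) \<and>
     (\<forall>(n::nat) u c. 0 \<le> Re (\<Sum>i<n. \<Sum>j<n. c i * cnj (c j) * q (u i - u j)))"

lemma positive_definite_minus: "positive_definite q \<Longrightarrow> q (- t) = cnj (q t)"
  by (simp add: positive_definite_def)

lemma positive_definite_finite:
  assumes "positive_definite q" "finite I"
  shows "0 \<le> Re (\<Sum>i\<in>I. \<Sum>j\<in>I. c i * cnj (c j) * q (u i - u j))"
proof -
  obtain h where h: "bij_betw h {..<card I} I"
    using ex_bij_betw_nat_finite[OF assms(2)] by (auto simp: lessThan_atLeast0)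
  have "(\<Sum>i\<in>I. \<Sum>j\<in>I. c i * cnj (c j) * q (u i - u j)) =
      (\<Sum>i<card I. \<Sum>j<card I. c (h i) * cnj (c (h j)) * q (u (h i) - u (h j)))"
    by (simp add: sum.reindex_bij_betw[OF h, symmetric])
  also have "Re \<dots> \<ge> 0"
    using assms(1) unfolding positive_definite_def by (elim conjE allE[of _ "card I"] allE[of _ "u \<circ> h"] allE[of _ "c \<circ> h"]) simp
  finally show ?thesis .
qed

text \<open>Convolution of \<open>q\<close> with a finitely supported measure and its adjoint; the
  quadratic form of the result is that of \<open>q\<close> on the points \<open>w a + u i\<close>
  with coefficients \<open>d a * c i\<close>. It turns a quadratic form into a value at
  \<open>0\<close>, and with two points it produces decompositions of \<open>q\<close>.\<close>

lemma positive_definite_twist: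
  assumes "positive_definite q" "finite I"
  shows "positive_definite (\<lambda>t. \<Sum>i\<in>I. \<Sum>j\<in>I. c i * cnj (c j) * q (t + (u i - u j)))"
  unfolding positive_definite_def
proof (intro conjI allI)
  fix t
  have "(\<Sum>i\<in>I. \<Sum>j\<in>I. c i * cnj (c j) * q (- t + (u i - u j))) =
      (\<Sum>i\<in>I. \<Sum>j\<in>I. c i * cnj (c j) * cnj (q (t + (u j - u i))))"
    by (intro sum.cong refl arg_cong2[of _ _ _ _ "(*)"]) (simp flip: positive_definite_minus[OF assms(1)])
  also have "\<dots> = (\<Sum>j\<in>I. \<Sum>i\<in>I. c i * cnj (c j) * cnj (q (t + (u j - u i))))"
    by (rule sum.swap)
  also have "\<dots> = cnj (\<Sum>i\<in>I. \<Sum>j\<in>I. c i * cnj (c j) * q (t + (u i - u j)))"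
    by (simp add: cnj_sum mult.commute mult.left_commute)
  finally show "(\<Sum>i\<in>I. \<Sum>j\<in>I. c i * cnj (c j) * q (- t + (u i - u j))) = \<dots>" .
next
  fix n :: nat and w :: "nat \<Rightarrow> _" and d :: "nat \<Rightarrow> complex"
  let ?c = "\<lambda>(a, i). d a * c i" and ?u = "\<lambda>(a, i). w a + u i"
  have "(\<Sum>a<n. \<Sum>b<n. d a * cnj (d b) * (\<Sum>i\<in>I. \<Sum>j\<in>I. c i * cnj (c j) * q (w a - w b + (u i - u j))))
      = (\<Sum>a<n. \<Sum>b<n. \<Sum>i\<in>I. \<Sum>j\<in>I. d a * c i * cnj (d b * c j) * q (w a + u i - (w b + u j)))"
    by (simp add: sum_distrib_left algebra_simps)
  also have "\<dots> = (\<Sum>a<n. \<Sum>i\<in>I. \<Sum>b<n. \<Sum>j\<in>I. d a * c i * cnj (d b * c j) * q (w a + u i - (w b + u j)))"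
    by (intro sum.cong refl sum.swap)
  also have "\<dots> = (\<Sum>x\<in>{..<n} \<times> I. \<Sum>y\<in>{..<n} \<times> I. ?c x * cnj (?c y) * q (?u x - ?u y))"
    by (simp add: sum.cartesian_product')
  also have "Re \<dots> \<ge> 0"
    using assms by (intro positive_definite_finite) auto
  finally show "0 \<le> Re (\<Sum>a<n. \<Sum>b<n. d a * cnj (d b) * (\<Sum>i\<in>I. \<Sum>j\<in>I. c i * cnj (c j) * q (w a - w b + (u i - u j))))" .
qed

lemma positive_definite_zero:
  assumes "positive_definite q" shows "q 0 = of_real (Re (q 0))" "Re (q 0) \<ge> 0"
proof -
  have "q 0 = cnj (q 0)" using positive_definite_minus[OF assms, of 0] by simp
  then show "q 0 = of_real (Re (q 0))" by (simp add: complex_eq_iff)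
  show "Re (q 0) \<ge> 0" using positive_definite_finite[OF assms, of "{0}" "\<lambda>_. 1" "\<lambda>_. 0"] by simp
qed

text \<open>For \<open>q t \<noteq> 0\<close>, the form on the points \<open>t\<close> and
  \<open>0\<close> with coefficients \<open>1\<close> and \<open>- sgn (q t)\<close> equals
  \<open>2 * (q 0 - norm (q t))\<close>.\<close>

lemma positive_definite_norm_le:
  assumes "positive_definite q" shows "norm (q t) \<le> Re (q 0)"
proof -
  have "0 \<le> Re (\<Sum>i\<in>{True, False}. \<Sum>j\<in>{True, False}.
      (if i then 1 else - sgn (q t)) * cnj (if j then 1 else - sgn (q t)) *
      q ((if i then t else 0) - (if j then t else 0)))"
    by (rule positive_definite_finite[OF assms]) auto
  also have "(\<Sum>i\<in>{True, False}. \<Sum>j\<in>{True, False}.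
      (if i then 1 else - sgn (q t)) * cnj (if j then 1 else - sgn (q t)) *
      q ((if i then t else 0) - (if j then t else 0)))
      = q 0 - cnj (sgn (q t)) * q t - sgn (q t) * cnj (q t) + (sgn (q t) * cnj (sgn (q t))) * q 0"
    by (simp add: positive_definite_minus[OF assms] algebra_simps)
  also have "cnj (sgn (q t)) * q t = of_real (norm (q t))"
    by (simp add: sgn_eq mult.commute complex_norm_square[symmetric] power2_eq_square)
  also have "sgn (q t) * cnj (q t) = of_real (norm (q t))"
    by (simp add: sgn_eq complex_norm_square[symmetric] power2_eq_square)
  also have "sgn (q t) * cnj (sgn (q t)) = of_real ((norm (sgn (q t)))\<^sup>2)"
    by (simp only: complex_norm_square)
  finally show ?thesis
    using positive_definite_zero[OF assms] by (cases "q t = 0") (auto simp: norm_sgn)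
qed

lemma positive_definite_add: "positive_definite p \<Longrightarrow> positive_definite q \<Longrightarrow> positive_definite (\<lambda>t. p t + q t)"
  unfolding positive_definite_def by (auto simp: algebra_simps sum.distrib)

lemma positive_definite_scale: assumes "positive_definite p" "a \<ge> 0" shows "positive_definite (\<lambda>t. complex_of_real a * p t)"
  unfolding positive_definite_def
proof (intro conjI allI)
  fix n :: nat and u and c :: "nat \<Rightarrow> complex"
  have "(\<Sum>i<n. \<Sum>j<n. c i * cnj (c j) * (complex_of_real a * p (u i - u j)))
      = complex_of_real a * (\<Sum>i<n. \<Sum>j<n. c i * cnj (c j) * p (u i - u j))"
    by (simp add: sum_distrib_left algebra_simps)
  then show "0 \<le> Re (\<Sum>i<n. \<Sum>j<n. c i * cnj (c j) * (complex_of_real a * p (u i - u j)))"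
    using assms positive_definite_finite[OF assms(1), of "{..<n}" c u] by simp
qed (simp add: positive_definite_minus[OF assms(1)])

lemma positive_definite_limit:
  assumes "\<And>k. positive_definite (q k)" "\<And>t. (\<lambda>k::nat. q k t) \<longlonglongrightarrow> p t"
  shows "positive_definite p"
  unfolding positive_definite_def
proof (intro conjI allI)
  fix t
  have "(\<lambda>k. cnj (q k t)) \<longlonglongrightarrow> cnj (p t)" by (intro tendsto_intros assms)
  moreover have "(\<lambda>k. cnj (q k t)) \<longlonglongrightarrow> p (- t)" using assms(2)[of "- t"] assms(1) by (simp add: positive_definite_minus)
  ultimately show "p (- t) = cnj (p t)" using LIMSEQ_unique by blast
next
  fix n :: nat and u c
  have "(\<lambda>k. Re (\<Sum>i<n. \<Sum>j<n. c i * cnj (c j) * q k (u i - u j))) \<longlonglongrightarrow>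
      Re (\<Sum>i<n. \<Sum>j<n. c i * cnj (c j) * p (u i - u j))"
    by (intro tendsto_intros assms)
  then show "0 \<le> Re (\<Sum>i<n. \<Sum>j<n. c i * cnj (c j) * p (u i - u j))"
    by (rule LIMSEQ_le_const) (use assms(1) in \<open>auto simp: positive_definite_def\<close>)
qed

section \<open>Unitary characters\<close>

definition character :: "('g::ab_group_add \<Rightarrow> complex) \<Rightarrow> bool" where
  "character \<xi> \<longleftrightarrow> (\<forall>s t. \<xi> (s + t) = \<xi> s * \<xi> t) \<and> (\<forall>t. norm (\<xi> t) = 1)"

lemma character_zero: assumes "character \<xi>" shows "\<xi> 0 = 1"
proof -
  have "\<xi> 0 * \<xi> 0 = \<xi> 0" "norm (\<xi> 0) = 1"
    using assms unfolding character_def by (metis add_0)+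
  then show ?thesis by auto
qed

lemma character_minus: assumes "character \<xi>" shows "\<xi> (- t) = cnj (\<xi> t)"
proof -
  have "\<xi> t * \<xi> (- t) = 1"
    using assms character_zero[OF assms] unfolding character_def by (metis add.right_inverse)
  moreover have "\<xi> t * cnj (\<xi> t) = 1"
    using assms unfolding character_def by (simp add: complex_norm_square[symmetric])
  ultimately show ?thesis by (metis mult_cancel_left mult_zero_left zero_neq_one)
qed

lemma character_const_1: "character (\<lambda>_. 1)"
  by (simp add: character_def)

lemma positive_definite_character: assumes "character \<xi>" shows "positive_definite \<xi>"
  unfolding positive_definite_def
proof (intro conjI allI)
  fix n :: nat and u c
  have d: "\<xi> (s - t) = \<xi> s * cnj (\<xi> t)" for s t
    using assms character_minus[OF assms] unfolding character_def by (metis diff_conv_add_uminus)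
  have "(\<Sum>i<n. \<Sum>j<n. c i * cnj (c j) * \<xi> (u i - u j)) =
      (\<Sum>i<n. c i * \<xi> (u i)) * cnj (\<Sum>i<n. c i * \<xi> (u i))"
    by (simp add: d sum_product algebra_simps)
  then show "0 \<le> Re (\<Sum>i<n. \<Sum>j<n. c i * cnj (c j) * \<xi> (u i - u j))"
    by (simp only: complex_norm_square[symmetric] Re_complex_of_real zero_le_power2)
qed (rule character_minus[OF assms])

text \<open>Two translates of a character are exactly as far apart as two of its values, and the
  values form a totally bounded subset of the plane.\<close>

lemma almost_periodic_character: assumes "character \<xi>" shows "almost_periodic \<xi>"
  unfolding almost_periodic_def
proof (intro allI impI)
  fix e :: real assume "e > 0"
  have "bounded (range \<xi>)" using assms by (auto simp: character_def bounded_iff)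
  then have "compact (closure (range \<xi>))" by (simp add: compact_closure)
  moreover have "closure (range \<xi>) \<subseteq> (\<Union>s\<in>UNIV. ball (\<xi> s) e)"
    using \<open>e > 0\<close> by (auto simp: closure_approachable dist_commute)
  ultimately obtain N where N: "finite N" "closure (range \<xi>) \<subseteq> (\<Union>s\<in>N. ball (\<xi> s) e)"
    using compactE_image[of "closure (range \<xi>)" UNIV "\<lambda>s. ball (\<xi> s) e"] by auto
  have "\<exists>n\<in>N. \<forall>t. norm (\<xi> (t + s) - \<xi> (t + n)) \<le> e" for s
  proof -
    have "\<xi> s \<in> closure (range \<xi>)" by (simp add: closure_subset[THEN subsetD])
    then obtain n where n: "n \<in> N" "dist (\<xi> n) (\<xi> s) < e" using N(2) by auto
    have "norm (\<xi> (t + s) - \<xi> (t + n)) = norm (\<xi> s - \<xi> n)" for t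
    proof -
      have "\<xi> (t + s) - \<xi> (t + n) = \<xi> t * (\<xi> s - \<xi> n)"
        using assms by (simp add: character_def algebra_simps)
      then show ?thesis using assms by (simp add: norm_mult character_def)
    qed
    with n show ?thesis by (intro bexI[of _ n]) (auto simp: dist_norm norm_minus_commute)
  qed
  with N(1) show "\<exists>N. finite N \<and> (\<forall>s. \<exists>n\<in>N. \<forall>t. norm (\<xi> (t + s) - \<xi> (t + n)) \<le> e)" by blast
qed

section \<open>Convolution with respect to the mean\<close>

definition conv :: "('g::ab_group_add \<Rightarrow> complex) \<Rightarrow> ('g \<Rightarrow> complex) \<Rightarrow> 'g \<Rightarrow> complex" where
  "conv r q t = mean (\<lambda>s. r (t - s) * q s)"

lemma has_mean_conv:
  assumes "almost_periodic r" "almost_periodic q" shows "has_mean (\<lambda>s. r (t - s) * q s) (conv r q t)"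
  unfolding conv_def by (intro has_mean_mean almost_periodic_mult almost_periodic_reflect_translate assms)

text \<open>In this form \<open>t\<close> occurs only in the argument of \<open>q\<close>, so linear
  relations between translates of \<open>q\<close> pass to the convolution.\<close>

lemma has_mean_conv':
  assumes "almost_periodic r" "almost_periodic q" shows "has_mean (\<lambda>s. r (- s) * q (s + t)) (conv r q t)"
  using has_mean_translate[OF has_mean_conv[OF assms, of t], of t] by simp

text \<open>The almost periodicity of \<open>conv r q\<close> is governed by \<open>r\<close> and a
  bound on \<open>q\<close> alone. So convolution by \<open>r\<close> sends a bounded family to one
  with common nets, which is its compactness.\<close>

lemma conv_dist_le:
  assumes "almost_periodic r" "almost_periodic q" "\<And>s. norm (q s) \<le> B" "\<And>s. norm (r (t + s) - r (t' + s)) \<le> D"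
  shows "norm (conv r q t - conv r q t') \<le> D * B"
proof (rule has_mean_dist_le[OF has_mean_conv has_mean_conv])
  fix s
  have "norm (r (t - s) * q s - r (t' - s) * q s) = norm (r (t - s) - r (t' - s)) * norm (q s)"
    by (simp add: norm_mult flip: left_diff_distrib)
  also have "\<dots> \<le> D * B"
    using assms(4)[of "- s"] by (intro mult_mono assms(3) order_trans[OF norm_ge_zero assms(4)]) auto
  finally show "norm (r (t - s) * q s - r (t' - s) * q s) \<le> D * B" .
qed (fact assms)+

lemma almost_periodic_conv: assumes "almost_periodic r" "almost_periodic q" shows "almost_periodic (conv r q)"
  unfolding almost_periodic_def
proof (intro allI impI)
  fix e :: real assume "e > 0"
  obtain B where B: "\<And>t. norm (q t) \<le> B" using almost_periodic_bounded assms by blast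
  then have "B \<ge> 0" using norm_ge_zero order_trans by blast
  then have "e / (B + 1) > 0" using \<open>e > 0\<close> by simp
  then obtain N where N: "finite N" "\<And>s. \<exists>n\<in>N. \<forall>t. norm (r (t + s) - r (t + n)) \<le> e / (B + 1)"
    using assms(1) unfolding almost_periodic_def by meson
  have "\<exists>n\<in>N. \<forall>t. norm (conv r q (t + s) - conv r q (t + n)) \<le> e" for s
  proof -
    obtain n where n: "n \<in> N" "\<And>t. norm (r (t + s) - r (t + n)) \<le> e / (B + 1)" using N by blast
    have "norm (conv r q (t + s) - conv r q (t + n)) \<le> e / (B + 1) * B" for t
    proof (rule conv_dist_le[OF assms B])
      fix v show "norm (r (t + s + v) - r (t + n + v)) \<le> e / (B + 1)"
        using n(2)[of "t + v"] by (simp add: ac_simps)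
    qed
    moreover have "e / (B + 1) * B \<le> e" using \<open>B \<ge> 0\<close> \<open>e > 0\<close> by (simp add: field_simps)
    ultimately show ?thesis using n(1) by (meson order_trans)
  qed
  with N(1) show "\<exists>N. finite N \<and> (\<forall>s. \<exists>n\<in>N. \<forall>t. norm (conv r q (t + s) - conv r q (t + n)) \<le> e)" by blast
qed

lemma conv_minus:
  assumes "almost_periodic r" "almost_periodic q" "positive_definite r" "positive_definite q" shows "conv r q (- t) = cnj (conv r q t)"
proof -
  have "has_mean (\<lambda>s. cnj (r (t - s) * q s)) (cnj (conv r q t))"
    by (rule has_mean_bounded_linear[OF bounded_linear_cnj has_mean_conv[OF assms(1,2)]])
  then have "has_mean (\<lambda>s. r (- (t - s)) * q (- s)) (cnj (conv r q t))"
    by (simp only: complex_cnj_mult positive_definite_minus[OF assms(3), symmetric] positive_definite_minus[OF assms(4), symmetric])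
  from has_mean_reflect[OF this] have "has_mean (\<lambda>s. r (- t - s) * q s) (cnj (conv r q t))"
    by simp
  then show ?thesis using has_mean_unique has_mean_conv[OF assms(1,2)] by blast
qed

text \<open>Convolution by \<open>r\<close> commutes with translations, so the whole quadratic form
  becomes a single value at \<open>0\<close>. Bounds on values at \<open>0\<close> thereby apply to
  quadratic forms.\<close>

lemma conv_form_right:
  assumes "almost_periodic r" "almost_periodic q" "finite I"
  shows "(\<Sum>i\<in>I. \<Sum>j\<in>I. c i * cnj (c j) * conv r q (u i - u j)) =
     conv r (\<lambda>t. \<Sum>i\<in>I. \<Sum>j\<in>I. c i * cnj (c j) * q (t + (u i - u j))) 0" (is "?l = conv r ?Q 0")
proof -
  have "almost_periodic ?Q"
    by (intro almost_periodic_sum assms almost_periodic_mult almost_periodic_const almost_periodic_translate)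
  have "has_mean (\<lambda>s. \<Sum>i\<in>I. \<Sum>j\<in>I. c i * cnj (c j) * (r (- s) * q (s + (u i - u j)))) ?l"
    by (intro has_mean_sum assms has_mean_bounded_linear[OF bounded_linear_mult_right] has_mean_conv')
  moreover have "(\<lambda>s. \<Sum>i\<in>I. \<Sum>j\<in>I. c i * cnj (c j) * (r (- s) * q (s + (u i - u j)))) = (\<lambda>s. r (- s) * ?Q (s + 0))"
    by (simp add: sum_distrib_left algebra_simps)
  ultimately have "has_mean (\<lambda>s. r (- s) * ?Q (s + 0)) ?l" by simp
  then show ?thesis by (rule has_mean_unique[OF _ has_mean_conv'[OF assms(1) \<open>almost_periodic ?Q\<close>]])
qed

text \<open>The form of \<open>conv r q\<close> is the mean of \<open>?R (- s) * q s\<close> with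
  \<open>?R\<close> a twist of \<open>r\<close>, and both factors are largest at \<open>0\<close>.
  For a normalized eigenfunction \<open>q\<close> with eigenvalue \<mu> the lemma says that
  \<open>r\<close> dominates \<mu> times \<open>q\<close>.\<close>

lemma positive_definite_minus_conv:
  assumes "almost_periodic r" "almost_periodic q" "positive_definite r" "positive_definite q"
  shows "positive_definite (\<lambda>t. q 0 * r t - conv r q t)"
  unfolding positive_definite_def
proof (intro conjI allI)
  fix t show "q 0 * r (- t) - conv r q (- t) = cnj (q 0 * r t - conv r q t)"
    using positive_definite_zero(1)[OF assms(4)] by (simp add: conv_minus[OF assms] positive_definite_minus[OF assms(3)] complex_eq_iff)
next
  fix n :: nat and u and c :: "nat \<Rightarrow> complex"
  let ?R = "\<lambda>t. \<Sum>i<n. \<Sum>j<n. c i * cnj (c j) * r (t + (u i - u j))"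
  let ?l = "\<Sum>i<n. \<Sum>j<n. c i * cnj (c j) * conv r q (u i - u j)"
  have R: "positive_definite ?R" by (rule positive_definite_twist[OF assms(3)]) auto
  have "has_mean (\<lambda>s. \<Sum>i<n. \<Sum>j<n. c i * cnj (c j) * (r (u i - u j - s) * q s)) ?l"
    by (intro has_mean_sum has_mean_bounded_linear[OF bounded_linear_mult_right] has_mean_conv assms) auto
  moreover have "(\<lambda>s. \<Sum>i<n. \<Sum>j<n. c i * cnj (c j) * (r (u i - u j - s) * q s)) = (\<lambda>s. ?R (- s) * q s)"
    by (simp add: sum_distrib_left sum_distrib_right algebra_simps)
  ultimately have "has_mean (\<lambda>s. ?R (- s) * q s) ?l" by simp
  then have "norm ?l \<le> Re (?R 0) * Re (q 0)"
  proof (rule has_mean_norm_le)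
    fix s show "norm (?R (- s) * q s) \<le> Re (?R 0) * Re (q 0)"
      unfolding norm_mult by (intro mult_mono positive_definite_norm_le[OF R] positive_definite_norm_le[OF assms(4)] positive_definite_zero(2)[OF R] norm_ge_zero)
  qed
  then have "Re ?l \<le> Re (?R 0) * Re (q 0)" using complex_Re_le_cmod order_trans by blast
  moreover have "(\<Sum>i<n. \<Sum>j<n. c i * cnj (c j) * (q 0 * r (u i - u j) - conv r q (u i - u j))) = q 0 * ?R 0 - ?l"
    by (simp add: sum_distrib_left sum_subtractf algebra_simps)
  moreover have "Re (q 0 * ?R 0) = Re (?R 0) * Re (q 0)"
  proof -
    have "Im (q 0) = 0" using positive_definite_zero(1)[OF assms(4)] by (metis Im_complex_of_real)
    then show ?thesis by simp
  qed
  ultimately show "0 \<le> Re (\<Sum>i<n. \<Sum>j<n. c i * cnj (c j) * (q 0 * r (u i - u j) - conv r q (u i - u j)))"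
    by (simp only: minus_complex.sel diff_ge_0_iff_ge)
qed

lemma almost_periodic_uniform_limit_seq:
  assumes "\<And>k. almost_periodic (q k)" "uniform_limit UNIV q p sequentially"
  shows "almost_periodic p"
proof (rule almost_periodic_uniform_limit)
  fix e :: real assume "e > 0"
  then obtain k where "\<forall>t. dist (q k t) (p t) < e"
    using uniform_limitD[OF assms(2), of e] by (auto simp: eventually_sequentially)
  then show "\<exists>G. almost_periodic G \<and> (\<forall>t. norm (p t - G t) \<le> e)"
    using assms(1) by (intro exI[of _ "q k"]) (auto simp: dist_norm norm_minus_commute less_imp_le)
qed

lemma has_mean_uniform_limit:
  assumes "\<And>k. has_mean (F k) (c k)" "has_mean G d" "uniform_limit UNIV F G sequentially"
  shows "c \<longlonglongrightarrow> d"
proof (rule LIMSEQ_I)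
  fix e :: real assume "e > 0"
  then have "\<forall>\<^sub>F k in sequentially. \<forall>t\<in>UNIV. dist (F k t) (G t) < e / 2"
    using uniform_limitD[OF assms(3), of "e / 2"] by simp
  then obtain K where K: "\<And>k t. k \<ge> K \<Longrightarrow> dist (F k t) (G t) < e / 2"
    by (auto simp: eventually_sequentially)
  have "norm (c k - d) < e" if "k \<ge> K" for k
  proof -
    have "norm (c k - d) \<le> e / 2"
      by (rule has_mean_dist_le[OF assms(1,2)]) (use K[OF that] in \<open>auto simp: dist_norm less_imp_le\<close>)
    then show ?thesis using \<open>e > 0\<close> by simp
  qed
  then show "\<exists>K. \<forall>k\<ge>K. norm (c k - d) < e" by blast
qed

section \<open>Eigenfunctions of convolution by a positive definite function\<close>

definition normalized_pd :: "('g::ab_group_add \<Rightarrow> complex) \<Rightarrow> bool" where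
  "normalized_pd p \<longleftrightarrow> almost_periodic p \<and> positive_definite p \<and> p 0 = 1"

lemma normalized_pd_scale:
  assumes "almost_periodic Q" "positive_definite Q" "Q 0 = of_real a" "a > 0"
  shows "normalized_pd (\<lambda>t. of_real (1 / a) * Q t)"
  unfolding normalized_pd_def
  by (intro conjI almost_periodic_mult almost_periodic_const assms positive_definite_scale) (use assms in auto)

lemma normalized_pd_le_1: "normalized_pd p \<Longrightarrow> norm (p t) \<le> 1"
  using positive_definite_norm_le[of p t] by (simp add: normalized_pd_def)

text \<open>Some subsequence of \<open>conv r (p k)\<close> converges uniformly, and
  \<open>p k\<close> is close to \<open>conv r (p k)\<close> divided by \<mu>, so it converges as
  well. Errors \<open>d\<close> tending to \<open>0\<close> yield an eigenfunction from approximate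
  ones; constant \<open>d = 0\<close> gives compactness of the set of normalized
  eigenfunctions.\<close>

lemma conv_eigenfunction_compact:
  fixes r :: "'g::ab_group_add \<Rightarrow> complex"
  assumes r: "almost_periodic r" and "\<mu> > 0" and p: "\<And>k. normalized_pd (p k)"
    and d: "\<And>k t. norm (of_real \<mu> * p k t - conv r (p k) t) \<le> d k" "d \<longlonglongrightarrow> 0"
  shows "\<exists>\<phi> q. strict_mono (\<phi>::nat \<Rightarrow> nat) \<and> uniform_limit UNIV (\<lambda>k. p (\<phi> k)) q sequentially \<and>
     normalized_pd q \<and> (\<forall>t. conv r q t = of_real \<mu> * q t)"
proof -
  have ap: "almost_periodic (p k)" for k using p normalized_pd_def by blast
  obtain B where B: "\<And>t. norm (r t) \<le> B" using almost_periodic_bounded r by blast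
  then have "B \<ge> 0" using norm_ge_zero order_trans by blast
  have "\<exists>\<phi> w. strict_mono (\<phi>::nat \<Rightarrow> nat) \<and> uniform_limit UNIV (\<lambda>k. conv r (p (\<phi> k))) w sequentially"
  proof (rule uniform_subsequence)
    fix k t
    show "norm (conv r (p k) t) \<le> B * 1"
    proof (rule has_mean_norm_le[OF has_mean_conv[OF r ap]])
      fix s show "norm (r (t - s) * p k s) \<le> B * 1"
        unfolding norm_mult by (intro mult_mono B normalized_pd_le_1 p \<open>B \<ge> 0\<close>) auto
    qed
  next
    fix e :: real assume "e > 0"
    then obtain N where N: "finite N" "\<And>s. \<exists>n\<in>N. \<forall>t. norm (r (t + s) - r (t + n)) \<le> e"
      using r unfolding almost_periodic_def by meson
    have "\<exists>n\<in>N. \<forall>k. norm (conv r (p k) s - conv r (p k) n) \<le> e" for s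
    proof -
      obtain n where n: "n \<in> N" "\<And>t. norm (r (t + s) - r (t + n)) \<le> e" using N by blast
      have "norm (conv r (p k) s - conv r (p k) n) \<le> e * 1" for k
        using n(2) by (intro conv_dist_le r ap normalized_pd_le_1 p) (simp add: add.commute)
      with n(1) show ?thesis by auto
    qed
    with N(1) show "\<exists>N. finite N \<and> (\<forall>s. \<exists>n\<in>N. \<forall>k. norm (conv r (p k) s - conv r (p k) n) \<le> e)" by blast
  qed
  then obtain \<phi> w where \<phi>: "strict_mono (\<phi>::nat \<Rightarrow> nat)"
    and w: "uniform_limit UNIV (\<lambda>k. conv r (p (\<phi> k))) w sequentially" by blast
  define q where "q = (\<lambda>t. w t / of_real \<mu>)"
  have d\<phi>: "(\<lambda>k. d (\<phi> k)) \<longlonglongrightarrow> 0" using LIMSEQ_subseq_LIMSEQ[OF d(2) \<phi>] by (simp add: comp_def)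
  have lim: "uniform_limit UNIV (\<lambda>k. p (\<phi> k)) q sequentially"
  proof (rule uniform_limit_sequentially_leI)
    fix e :: real assume "e > 0"
    then have "e * \<mu> / 2 > 0" using \<open>\<mu> > 0\<close> by simp
    then have "\<forall>\<^sub>F k in sequentially. d (\<phi> k) < e * \<mu> / 2 \<and> (\<forall>t\<in>UNIV. dist (conv r (p (\<phi> k)) t) (w t) < e * \<mu> / 2)"
      by (intro eventually_conj order_tendstoD(2)[OF d\<phi>] uniform_limitD[OF w])
    then obtain K where K: "\<And>k. k \<ge> K \<Longrightarrow> d (\<phi> k) < e * \<mu> / 2"
      "\<And>k t. k \<ge> K \<Longrightarrow> dist (conv r (p (\<phi> k)) t) (w t) < e * \<mu> / 2"
      by (auto simp: eventually_sequentially)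
    have "dist (p (\<phi> k) t) (q t) \<le> e" if "k \<ge> K" for k t
    proof -
      have "norm (of_real \<mu> * p (\<phi> k) t - w t) \<le> e * \<mu>"
        using norm_triangle_ineq[of "of_real \<mu> * p (\<phi> k) t - conv r (p (\<phi> k)) t" "conv r (p (\<phi> k)) t - w t"]
          d(1)[of "\<phi> k" t] K(1)[OF that] K(2)[OF that, of t] by (simp add: dist_norm)
      moreover have "of_real \<mu> * p (\<phi> k) t - w t = of_real \<mu> * (p (\<phi> k) t - q t)"
        using \<open>\<mu> > 0\<close> by (simp add: q_def field_simps)
      ultimately have "\<mu> * norm (p (\<phi> k) t - q t) \<le> \<mu> * e"
        using \<open>\<mu> > 0\<close> by (simp add: norm_mult mult.commute)
      then show ?thesis using \<open>\<mu> > 0\<close> by (simp add: dist_norm)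
    qed
    then show "\<exists>K. \<forall>k\<ge>K. \<forall>t\<in>UNIV. dist (p (\<phi> k) t) (q t) \<le> e" by blast
  qed
  have ptw: "(\<lambda>k. p (\<phi> k) t) \<longlonglongrightarrow> q t" for t by (rule tendsto_uniform_limitI[OF lim]) simp
  have aq: "almost_periodic q" by (rule almost_periodic_uniform_limit_seq[OF ap lim])
  have "positive_definite q" by (rule positive_definite_limit[OF _ ptw]) (use p in \<open>auto simp: normalized_pd_def\<close>)
  moreover have "q 0 = 1"
    using ptw[of 0] p by (simp add: normalized_pd_def LIMSEQ_const_iff)
  moreover have "conv r q t = of_real \<mu> * q t" for t
  proof -
    have "(\<lambda>k. conv r (p (\<phi> k)) t) \<longlonglongrightarrow> conv r q t"
    proof (rule has_mean_uniform_limit[OF has_mean_conv[OF r ap] has_mean_conv[OF r aq]])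
      show "uniform_limit UNIV (\<lambda>k s. r (t - s) * p (\<phi> k) s) (\<lambda>s. r (t - s) * q s) sequentially"
      proof (rule uniform_limit_sequentially_leI)
        fix e :: real assume "e > 0"
        then have "e / (B + 1) > 0" using \<open>B \<ge> 0\<close> by simp
        then obtain K where K: "\<And>k s. k \<ge> K \<Longrightarrow> dist (p (\<phi> k) s) (q s) < e / (B + 1)"
          using uniform_limitD[OF lim] by (fastforce simp: eventually_sequentially)
        have "dist (r (t - s) * p (\<phi> k) s) (r (t - s) * q s) \<le> e" if "k \<ge> K" for k s
        proof -
          have "dist (r (t - s) * p (\<phi> k) s) (r (t - s) * q s) = norm (r (t - s)) * dist (p (\<phi> k) s) (q s)"
            by (simp add: dist_norm norm_mult flip: right_diff_distrib)
          also have "\<dots> \<le> (B + 1) * (e / (B + 1))"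
            using K[OF that, of s] B[of "t - s"] \<open>B \<ge> 0\<close> by (intro mult_mono) auto
          also have "\<dots> = e" using \<open>B \<ge> 0\<close> by simp
          finally show ?thesis .
        qed
        then show "\<exists>K. \<forall>k\<ge>K. \<forall>s\<in>UNIV. dist (r (t - s) * p (\<phi> k) s) (r (t - s) * q s) \<le> e" by blast
      qed
    qed
    moreover have "(\<lambda>k. conv r (p (\<phi> k)) t) \<longlonglongrightarrow> w t" by (rule tendsto_uniform_limitI[OF w]) simp
    ultimately have "conv r q t = w t" using LIMSEQ_unique by blast
    then show ?thesis using \<open>\<mu> > 0\<close> by (simp add: q_def)
  qed
  ultimately show ?thesis using \<phi> lim aq by (auto simp: normalized_pd_def)
qed

lemma almost_periodic_norm_sq: assumes "almost_periodic f" shows "almost_periodic (\<lambda>s. (norm (f s :: complex))\<^sup>2)"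
proof -
  have "almost_periodic (\<lambda>s. Re (f s * cnj (f s)))" by (intro almost_periodic_Re almost_periodic_mult almost_periodic_cnj assms)
  then show ?thesis by (simp only: complex_norm_square[symmetric] Re_complex_of_real)
qed

text \<open>A variational principle: \<mu> is the supremum of \<open>Re (conv r p 0)\<close>, and a
  maximizing sequence consists of approximate eigenfunctions.\<close>

lemma conv_eigenfunction_exists:
  fixes r :: "'g::ab_group_add \<Rightarrow> complex"
  assumes r: "almost_periodic r" "positive_definite r" "r 0 \<noteq> 0"
  shows "\<exists>\<mu> p. \<mu> > 0 \<and> normalized_pd p \<and> (\<forall>t. conv r p t = of_real \<mu> * p t)"
proof -
  define r0 where "r0 = Re (r 0)"
  have r0: "r 0 = of_real r0" "r0 > 0"
    using positive_definite_zero[OF r(2)] r(3) by (auto simp: r0_def complex_eq_iff)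
  define S where "S = {Re (conv r p 0) |p. normalized_pd p}"
  define \<mu> where "\<mu> = Sup S"
  have "Re (conv r p 0) \<le> r0" if p: "normalized_pd p" for p
  proof -
    have "norm (conv r p 0) \<le> r0 * 1"
    proof (rule has_mean_norm_le[OF has_mean_conv])
      fix s show "norm (r (0 - s) * p s) \<le> r0 * 1"
        unfolding norm_mult r0_def using r0 by (intro mult_mono positive_definite_norm_le normalized_pd_le_1 p r) (auto simp: r0_def)
    qed (use p r in \<open>auto simp: normalized_pd_def\<close>)
    then show ?thesis using complex_Re_le_cmod order_trans by fastforce
  qed
  then have bdd: "bdd_above S" unfolding S_def bdd_above_def by blast
  have le_mu: "Re (conv r p 0) \<le> \<mu>" if "normalized_pd p" for p
    unfolding \<mu>_def using that bdd by (intro cSup_upper) (auto simp: S_def)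
  define p0 where "p0 = (\<lambda>t. of_real (1 / r0) * r t)"
  have p0: "normalized_pd p0"
    unfolding p0_def by (rule normalized_pd_scale[OF r(1,2) r0])
  \<comment> \<open>The trial function is \<open>r\<close> itself, normalized; its value is the mean
    of \<open>(norm (r s))\<^sup>2 / r0\<close>.\<close>
  have "\<mu> > 0"
  proof -
    have "has_mean (\<lambda>s. Re (r (- s) * p0 (s + 0))) (Re (conv r p0 0))"
      using r p0 by (intro has_mean_bounded_linear[OF bounded_linear_Re] has_mean_conv') (auto simp: normalized_pd_def)
    moreover have "Re (r (- s) * p0 (s + 0)) = (norm (r s))\<^sup>2 / r0" for s
    proof -
      have "r (- s) * p0 (s + 0) = of_real ((norm (r s))\<^sup>2 / r0)"
        using r0 unfolding p0_def of_real_divide complex_norm_square by (simp add: positive_definite_minus[OF r(2)])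
      then show ?thesis by simp
    qed
    ultimately have "has_mean (\<lambda>s. (norm (r s))\<^sup>2 / r0) (Re (conv r p0 0))" by simp
    moreover have "almost_periodic (\<lambda>s. (norm (r s))\<^sup>2 / r0)"
      using almost_periodic_bounded_linear[OF bounded_linear_divide almost_periodic_norm_sq[OF r(1)]] .
    ultimately have "Re (conv r p0 0) > 0"
      using r0 by - (rule has_mean_pos[of "\<lambda>s. (norm (r s))\<^sup>2 / r0" _ 0], auto)
    then show ?thesis using le_mu[OF p0] by simp
  qed
  \<comment> \<open>The bound freed from the normalization, since the twists \<open>?Q\<close> below
    have no prescribed value at \<open>0\<close>. If that value is \<open>0\<close>, the function
    vanishes.\<close>
  have le_mu': "Re (conv r Q 0) \<le> \<mu> * Re (Q 0)" if Q: "almost_periodic Q" "positive_definite Q" for Q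
  proof (cases "Re (Q 0) = 0")
    case True
    then have "Q t = 0" for t using positive_definite_norm_le[OF Q(2), of t] by simp
    then have "has_mean (\<lambda>s. r (0 - s) * Q s) 0" by (simp add: has_mean_const)
    then have "conv r Q 0 = 0" using has_mean_unique has_mean_conv[OF r(1) Q(1)] by blast
    then show ?thesis using True by simp
  next
    case False
    define a where "a = Re (Q 0)"
    have a: "a > 0" "Q 0 = of_real a" using positive_definite_zero[OF Q(2)] False by (auto simp: a_def)
    have Q': "normalized_pd (\<lambda>t. of_real (1 / a) * Q t)" (is "normalized_pd ?Q")
      by (rule normalized_pd_scale[OF Q a(2,1)])
    have "has_mean (\<lambda>s. of_real (1 / a) * (r (0 - s) * Q s)) (of_real (1 / a) * conv r Q 0)"
      by (intro has_mean_bounded_linear[OF bounded_linear_mult_right] has_mean_conv r Q)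
    then have "has_mean (\<lambda>s. r (0 - s) * ?Q s) (of_real (1 / a) * conv r Q 0)"
      by (simp add: mult.left_commute)
    then have "conv r ?Q 0 = of_real (1 / a) * conv r Q 0"
      using has_mean_unique has_mean_conv[of r ?Q 0] r Q' unfolding normalized_pd_def by blast
    moreover have "Re (of_real (1 / a) * conv r Q 0) = Re (conv r Q 0) / a" by simp
    ultimately have "Re (conv r Q 0) / a \<le> \<mu>" using le_mu[OF Q'] by simp
    then show ?thesis using a by (simp add: field_simps)
  qed
  \<comment> \<open>Applying the defining bound of \<open>\<mu>\<close> to the quadratic forms of \<open>p\<close> turns it into an
     inequality between positive definite functions, hence into a uniform one.\<close>
  have gap: "positive_definite (\<lambda>t. of_real \<mu> * p t - conv r p t)" if p: "normalized_pd p" for p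
    unfolding positive_definite_def
  proof (intro conjI allI)
    have p': "almost_periodic p" "positive_definite p" using p by (auto simp: normalized_pd_def)
    fix t show "of_real \<mu> * p (- t) - conv r p (- t) = cnj (of_real \<mu> * p t - conv r p t)"
      by (simp add: conv_minus[OF r(1) p'(1) r(2) p'(2)] positive_definite_minus[OF p'(2)])
  next
    have p': "almost_periodic p" "positive_definite p" using p by (auto simp: normalized_pd_def)
    fix n :: nat and u and c :: "nat \<Rightarrow> complex"
    let ?Q = "\<lambda>t. \<Sum>i<n. \<Sum>j<n. c i * cnj (c j) * p (t + (u i - u j))"
    have "almost_periodic ?Q" by (intro almost_periodic_sum almost_periodic_mult almost_periodic_const almost_periodic_translate p') auto
    moreover have "positive_definite ?Q" by (rule positive_definite_twist[OF p'(2)]) auto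
    ultimately have "Re (conv r ?Q 0) \<le> \<mu> * Re (?Q 0)" by (rule le_mu')
    moreover have "(\<Sum>i<n. \<Sum>j<n. c i * cnj (c j) * (of_real \<mu> * p (u i - u j) - conv r p (u i - u j)))
        = of_real \<mu> * ?Q 0 - conv r ?Q 0"
      unfolding conv_form_right[OF r(1) p'(1) finite_lessThan, symmetric]
      by (simp add: sum_distrib_left sum_subtractf algebra_simps)
    moreover have "Re (of_real \<mu> * ?Q 0) = \<mu> * Re (?Q 0)" by (simp only: times_complex.sel) simp
    ultimately show "0 \<le> Re (\<Sum>i<n. \<Sum>j<n. c i * cnj (c j) * (of_real \<mu> * p (u i - u j) - conv r p (u i - u j)))"
      by (simp only: minus_complex.sel diff_ge_0_iff_ge)
  qed
  have "\<exists>p. normalized_pd p \<and> \<mu> - 1 / real (Suc k) < Re (conv r p 0)" for k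
  proof -
    have "\<exists>x\<in>S. \<mu> - 1 / real (Suc k) < x"
      unfolding \<mu>_def using p0 bdd by (intro less_cSup_iff[THEN iffD1]) (auto simp: S_def)
    then show ?thesis by (auto simp: S_def)
  qed
  then obtain p where p: "\<And>k. normalized_pd (p k)" "\<And>k. \<mu> - 1 / real (Suc k) < Re (conv r (p k) 0)"
    by metis
  \<comment> \<open>The gap is largest at \<open>0\<close>, where it is \<mu> minus
    \<open>Re (conv r (p k) 0)\<close> because \<open>p k 0 = 1\<close>.\<close>
  have "norm (of_real \<mu> * p k t - conv r (p k) t) \<le> 1 / real (Suc k)" for k t
    using positive_definite_norm_le[OF gap[OF p(1)], of k t] p(2)[of k] p(1)[of k] by (simp add: normalized_pd_def)
  from conv_eigenfunction_compact[OF r(1) \<open>\<mu> > 0\<close>, of p, OF p(1) this LIMSEQ_Suc[OF lim_1_over_n]]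
  show ?thesis using \<open>\<mu> > 0\<close> by blast
qed

lemma has_mean_norm_sq_scale:
  assumes "has_mean (\<lambda>s. (norm (f s :: complex))\<^sup>2) m"
  shows "has_mean (\<lambda>s. (norm (of_real b * f s))\<^sup>2) (b\<^sup>2 * m)"
proof -
  have "(norm (of_real b * f s))\<^sup>2 = b\<^sup>2 * (norm (f s))\<^sup>2" for s
    by (simp add: norm_mult power_mult_distrib)
  then show ?thesis
    using has_mean_bounded_linear[OF bounded_linear_mult_right assms, of "b\<^sup>2"] by (simp only:)
qed

text \<open>Half of the twist at the points \<open>0\<close> and \<open>s\<close> with coefficients
  \<open>1\<close> and \<open>c\<close>. The functions for \<open>c\<close> and for
  \<open>- c\<close> add up to \<open>2 * q\<close>.\<close>

lemma positive_definite_translates: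
  assumes "positive_definite q" "norm c = 1"
  shows "positive_definite (\<lambda>t. q t + (c * q (t + s) + cnj c * q (t - s)) / 2)"
proof -
  have "positive_definite (\<lambda>t. \<Sum>i\<in>{True, False}. \<Sum>j\<in>{True, False}. (if i then 1 else c) * cnj (if j then 1 else c)
      * q (t + ((if i then 0 else s) - (if j then 0 else s))))"
    by (rule positive_definite_twist[OF assms(1)]) auto
  from positive_definite_scale[OF this, of "1 / 2"]
  have "positive_definite (\<lambda>t. of_real (1 / 2) * (\<Sum>i\<in>{True, False}. \<Sum>j\<in>{True, False}. (if i then 1 else c) * cnj (if j then 1 else c)
      * q (t + ((if i then 0 else s) - (if j then 0 else s)))))" by simp
  moreover have cc: "c * (cnj c * z) = z" for z
    using assms(2) by (simp add: complex_norm_square[symmetric] flip: mult.assoc)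
  have "(\<lambda>t. of_real (1 / 2) * (\<Sum>i\<in>{True, False}. \<Sum>j\<in>{True, False}. (if i then 1 else c) * cnj (if j then 1 else c)
      * q (t + ((if i then 0 else s) - (if j then 0 else s))))) = (\<lambda>t. q t + (c * q (t + s) + cnj c * q (t - s)) / 2)"
    by (simp add: field_simps cc)
  ultimately show ?thesis by (simp only:)
qed

lemma conv_translates:
  assumes "almost_periodic r" "almost_periodic q" "\<And>t. conv r q t = of_real \<mu> * q t"
  shows "conv r (\<lambda>t. q t + (c * q (t + s) + cnj c * q (t - s)) / 2) t
    = of_real \<mu> * (q t + (c * q (t + s) + cnj c * q (t - s)) / 2)" (is "conv r ?Q t = _")
proof -
  have ap: "almost_periodic ?Q"
    using almost_periodic_translate[OF assms(2), of s] almost_periodic_translate[OF assms(2), of "- s"]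
    by (intro almost_periodic_add assms almost_periodic_bounded_linear[OF bounded_linear_divide] almost_periodic_mult almost_periodic_const) auto
  have "has_mean (\<lambda>v. r (- v) * q (v + t) + (c * (r (- v) * q (v + (t + s))) + cnj c * (r (- v) * q (v + (t - s)))) / 2)
    (conv r q t + (c * conv r q (t + s) + cnj c * conv r q (t - s)) / 2)"
    by (intro has_mean_add has_mean_bounded_linear[OF bounded_linear_divide]
        has_mean_bounded_linear[OF bounded_linear_mult_right] has_mean_conv' assms)
  moreover have "(\<lambda>v. r (- v) * q (v + t) + (c * (r (- v) * q (v + (t + s))) + cnj c * (r (- v) * q (v + (t - s)))) / 2)
    = (\<lambda>v. r (- v) * ?Q (v + t))" by (simp add: field_simps)
  ultimately have "has_mean (\<lambda>v. r (- v) * ?Q (v + t)) (conv r q t + (c * conv r q (t + s) + cnj c * conv r q (t - s)) / 2)"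
    by simp
  then have "conv r ?Q t = conv r q t + (c * conv r q (t + s) + cnj c * conv r q (t - s)) / 2"
    by (rule has_mean_unique[OF has_mean_conv'[OF assms(1) ap]])
  then show ?thesis by (simp add: assms(3) field_simps)
qed

text \<open>Strict convexity of the mean square makes a maximizer in the compact convex set of normalized
  eigenfunctions extreme; since the set is stable under the decomposition of \<open>q\<close> into
  \<open>q \<plusminus> (c * q (\<cdot> + s) + cnj c * q (\<cdot> - s)) / 2\<close>, such a maximizer is multiplicative.\<close>

lemma maximal_eigenfunction_character:
  fixes r :: "'g::ab_group_add \<Rightarrow> complex"
  assumes r: "almost_periodic r" and q: "normalized_pd q" "\<And>t. conv r q t = of_real \<mu> * q t"
    and m: "has_mean (\<lambda>s. (norm (q s))\<^sup>2) m"
    and max: "\<And>p m'. normalized_pd p \<Longrightarrow> (\<And>t. conv r p t = of_real \<mu> * p t) \<Longrightarrow>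
       has_mean (\<lambda>s. (norm (p s))\<^sup>2) m' \<Longrightarrow> m' \<le> m"
  shows "character q"
proof -
  have q': "almost_periodic q" "positive_definite q" "q 0 = 1" using q(1) by (auto simp: normalized_pd_def)
  \<comment> \<open>Maximality of \<open>m\<close>, rescaled to eigenfunctions with any value at
    \<open>0\<close>.\<close>
  have max': "m' \<le> (Re (v 0))\<^sup>2 * m"
    if v: "almost_periodic v" "positive_definite v" "\<And>t. conv r v t = of_real \<mu> * v t" "has_mean (\<lambda>s. (norm (v s))\<^sup>2) m'" for v m'
  proof (cases "Re (v 0) = 0")
    case True
    then have "v t = 0" for t using positive_definite_norm_le[OF v(2), of t] by simp
    then have "m' = 0" using has_mean_unique[OF v(4)] by (simp add: has_mean_const)
    then show ?thesis using True by simp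
  next
    case False
    define a where "a = Re (v 0)"
    have a: "a > 0" "v 0 = of_real a" using positive_definite_zero[OF v(2)] False by (auto simp: a_def)
    let ?v = "\<lambda>t. of_real (1 / a) * v t"
    have nv: "normalized_pd ?v" by (rule normalized_pd_scale[OF v(1,2) a(2,1)])
    have "conv r ?v t = of_real \<mu> * ?v t" for t
    proof -
      have "has_mean (\<lambda>s. of_real (1 / a) * (r (t - s) * v s)) (of_real (1 / a) * conv r v t)"
        by (intro has_mean_bounded_linear[OF bounded_linear_mult_right] has_mean_conv r v)
      then have "has_mean (\<lambda>s. r (t - s) * ?v s) (of_real (1 / a) * conv r v t)"
        by (simp add: mult.left_commute)
      then have "conv r ?v t = of_real (1 / a) * conv r v t"
        using has_mean_unique has_mean_conv[of r ?v t] r nv unfolding normalized_pd_def by blast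
      then show ?thesis using v(3) by simp
    qed
    from max[OF nv this has_mean_norm_sq_scale[OF v(4)]]
    show ?thesis using a(1) by (simp add: a_def[symmetric] field_simps power2_eq_square)
  qed
  have key: "(c * q (t + s) + cnj c * q (t - s)) / 2 = of_real (Re (c * q s)) * q t" if c: "norm c = 1" for c s t
  proof -
    define Q where "Q = (\<lambda>c t. q t + (c * q (t + s) + cnj c * q (t - s)) / 2)"
    define a where "a = Re (c * q s)"
    \<comment> \<open>The deviation of \<open>Q c\<close> from its share of \<open>q\<close>, where
      \<open>1 + a\<close> is \<open>Re (Q c 0)\<close>. As \<open>Q c\<close> and
      \<open>Q (- c)\<close> add up to \<open>2 * q\<close>, the other part deviates from
      \<open>(1 - a) * q\<close> by \<open>- d\<close>.\<close>
    define d where "d = (\<lambda>t. Q c t - of_real (1 + a) * q t)"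
    have apQ: "almost_periodic (Q b)" for b
      unfolding Q_def using almost_periodic_translate[OF q'(1), of s] almost_periodic_translate[OF q'(1), of "- s"]
      by (intro almost_periodic_add q' almost_periodic_bounded_linear[OF bounded_linear_divide] almost_periodic_mult almost_periodic_const) auto
    have apd: "almost_periodic d" unfolding d_def by (intro almost_periodic_diff apQ almost_periodic_mult almost_periodic_const q')
    have Qb: "positive_definite (Q b)" "\<And>t. conv r (Q b) t = of_real \<mu> * Q b t" if "norm b = 1" for b
      unfolding Q_def using positive_definite_translates[OF q'(2) that] conv_translates[OF r q'(1) q(2)] by auto
    have Q0: "Re (Q b 0) = 1 + Re (b * q s)" for b
      using positive_definite_minus[OF q'(2), of s] by (simp add: Q_def q'(3))
    have Q0c: "Re (Q c 0) = 1 + a" "Re (Q (- c) 0) = 1 - a" by (simp_all add: Q0 a_def)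
    have Qm: "Q (- c) t = of_real (1 - a) * q t - d t" for t
      by (simp add: d_def Q_def field_simps)
    have Qp: "Q c t = of_real (1 + a) * q t + d t" for t by (simp add: d_def)
    define N where "N = mean (\<lambda>s. (norm (d s))\<^sup>2)"
    define X where "X = mean (\<lambda>s. Re (q s * cnj (d s)))"
    have N: "has_mean (\<lambda>s. (norm (d s))\<^sup>2) N" unfolding N_def by (intro has_mean_mean almost_periodic_norm_sq apd)
    have X: "has_mean (\<lambda>s. Re (q s * cnj (d s))) X" unfolding X_def
      by (intro has_mean_mean almost_periodic_Re almost_periodic_mult almost_periodic_cnj apd q')
    have sq: "(norm (of_real b * z + w))\<^sup>2 = b\<^sup>2 * (norm z)\<^sup>2 + (2 * b) * Re (z * cnj w) + (norm w)\<^sup>2" for b z w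
      unfolding cmod_power2 by (simp add: power2_eq_square algebra_simps)
    have "has_mean (\<lambda>s. (norm (Q c s))\<^sup>2) ((1 + a)\<^sup>2 * m + (2 * (1 + a)) * X + N)"
      unfolding Qp sq by (intro has_mean_add N has_mean_bounded_linear[OF bounded_linear_mult_right] m X)
    from max'[OF apQ Qb[OF c] this] have 1: "2 * (1 + a) * X + N \<le> 0"
      by (simp add: Q0c)
    have "norm (- c) = 1" using c by simp
    have sq': "(norm (of_real b * z - w))\<^sup>2 = b\<^sup>2 * (norm z)\<^sup>2 + (- 2 * b) * Re (z * cnj w) + (norm w)\<^sup>2" for b z w
      unfolding cmod_power2 by (simp add: power2_eq_square algebra_simps)
    have "has_mean (\<lambda>s. (norm (Q (- c) s))\<^sup>2) ((1 - a)\<^sup>2 * m + (- 2 * (1 - a)) * X + N)"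
      unfolding Qm sq' by (intro has_mean_add N has_mean_bounded_linear[OF bounded_linear_mult_right] m X)
    from max'[OF apQ Qb[OF \<open>norm (- c) = 1\<close>] this] have 2: "- 2 * (1 - a) * X + N \<le> 0"
      by (simp add: Q0c)
    have "\<bar>a\<bar> \<le> 1"
      using abs_Re_le_cmod[of "c * q s"] c normalized_pd_le_1[OF q(1), of s] by (simp add: a_def norm_mult)
    \<comment> \<open>The weights \<open>1 - a\<close> and \<open>1 + a\<close> cancel the cross
      term \<open>X\<close> and leave \<open>2 * N\<close>.\<close>
    then have "(1 - a) * (2 * (1 + a) * X + N) + (1 + a) * (- 2 * (1 - a) * X + N) \<le> 0"
      by (intro add_nonpos_nonpos mult_nonneg_nonpos 1 2) auto
    then have "N \<le> 0" by (simp add: algebra_simps)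
    then have "(norm (d t))\<^sup>2 = 0"
      using has_mean_pos[OF almost_periodic_norm_sq[OF apd] N, of t] by fastforce
    then have "Q c t = of_real (1 + a) * q t" by (simp add: d_def)
    then show ?thesis by (simp add: Q_def a_def algebra_simps)
  qed
  \<comment> \<open>The choices \<open>c = 1\<close> and \<open>c = \<i>\<close> give half the sum
    and half the difference of \<open>q (t + s)\<close> and \<open>q (t - s)\<close> as multiples of
    \<open>q t\<close>.\<close>
  have mult: "q (t + s) = q s * q t" for s t
  proof -
    have "(1 * q (t + s) + cnj 1 * q (t - s)) / 2 = of_real (Re (1 * q s)) * q t" by (rule key) simp
    then have 1: "(q (t + s) + q (t - s)) / 2 = of_real (Re (q s)) * q t" by simp
    have "(\<i> * q (t + s) + cnj \<i> * q (t - s)) / 2 = of_real (Re (\<i> * q s)) * q t" by (rule key) simp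
    then have "\<i> * ((\<i> * q (t + s) + cnj \<i> * q (t - s)) / 2) = \<i> * (of_real (Re (\<i> * q s)) * q t)" by simp
    then have 2: "(q (t + s) - q (t - s)) / 2 = \<i> * of_real (Im (q s)) * q t"
      by (simp add: field_simps)
    have "q (t + s) = (q (t + s) + q (t - s)) / 2 + (q (t + s) - q (t - s)) / 2" by (simp add: field_simps)
    also have "\<dots> = (of_real (Re (q s)) + \<i> * of_real (Im (q s))) * q t"
      unfolding 1 2 by (simp add: algebra_simps)
    finally show ?thesis by (simp add: complex_eq[symmetric])
  qed
  have "norm (q t) = 1" for t
  proof -
    have "q (- t + t) = q t * cnj (q t)" using mult[of "- t" t] by (simp add: positive_definite_minus[OF q'(2)])
    then have "of_real ((norm (q t))\<^sup>2) = (1::complex)"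
      using q'(3) unfolding complex_norm_square by simp
    then have "(norm (q t))\<^sup>2 = 1" using of_real_eq_1_iff by blast
    then show ?thesis by (simp add: abs_square_eq_1)
  qed
  with mult show ?thesis by (simp add: character_def mult.commute)
qed

text \<open>By compactness the supremum of the mean square over the normalized eigenfunctions is
  attained. The maximizer is a character, and the constant \<open>c\<close> is the eigenvalue \<mu>,
  by \<open>positive_definite_minus_conv\<close>.\<close>

lemma positive_definite_dominates_character:
  fixes r :: "'g::ab_group_add \<Rightarrow> complex"
  assumes r: "almost_periodic r" "positive_definite r" "r 0 \<noteq> 0"
  shows "\<exists>\<xi> c. character \<xi> \<and> c > 0 \<and> positive_definite (\<lambda>t. r t - of_real c * \<xi> t)"
proof -
  obtain \<mu> p0 where \<mu>: "\<mu> > 0" and p0: "normalized_pd p0" "\<And>t. conv r p0 t = of_real \<mu> * p0 t"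
    using conv_eigenfunction_exists[OF r] by blast
  define E where "E = {p. normalized_pd p \<and> (\<forall>t. conv r p t = of_real \<mu> * p t)}"
  define msq where "msq = (\<lambda>p::'g \<Rightarrow> complex. mean (\<lambda>s. (norm (p s))\<^sup>2))"
  have hm: "has_mean (\<lambda>s. (norm (p s))\<^sup>2) (msq p)" if "p \<in> E" for p
    unfolding msq_def using that by (intro has_mean_mean almost_periodic_norm_sq) (auto simp: E_def normalized_pd_def)
  have msq1: "msq p \<le> 1" if "p \<in> E" for p
    using that normalized_pd_le_1[of p]
    by (intro has_mean_mono[OF hm[OF that] has_mean_const]) (auto simp: E_def power_le_one)
  have bdd: "bdd_above (msq ` E)" using msq1 by (auto simp: bdd_above_def)
  have ne: "p0 \<in> E" using p0 by (simp add: E_def)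
  define B where "B = Sup (msq ` E)"
  have "\<exists>p\<in>E. B - 1 / real (Suc k) < msq p" for k
  proof -
    have "\<exists>x\<in>msq ` E. B - 1 / real (Suc k) < x"
      unfolding B_def using ne bdd by (intro less_cSup_iff[THEN iffD1]) auto
    then show ?thesis by blast
  qed
  then obtain p where p: "\<And>k. p k \<in> E" "\<And>k. B - 1 / real (Suc k) < msq (p k)" by metis
  have "\<exists>\<phi> q. strict_mono (\<phi>::nat \<Rightarrow> nat) \<and> uniform_limit UNIV (\<lambda>k. p (\<phi> k)) q sequentially \<and>
     normalized_pd q \<and> (\<forall>t. conv r q t = of_real \<mu> * q t)"
    using p(1) by (intro conv_eigenfunction_compact[OF r(1) \<mu>, of p "\<lambda>_. 0"]) (auto simp: E_def)
  then obtain \<phi> q where \<phi>: "strict_mono (\<phi>::nat \<Rightarrow> nat)" and lim: "uniform_limit UNIV (\<lambda>k. p (\<phi> k)) q sequentially"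
    and q: "normalized_pd q" "\<And>t. conv r q t = of_real \<mu> * q t" by blast
  have qE: "q \<in> E" using q by (simp add: E_def)
  have "(\<lambda>k. msq (p (\<phi> k))) \<longlonglongrightarrow> msq q"
  proof (rule has_mean_uniform_limit[OF hm[OF p(1)] hm[OF qE]], rule uniform_limit_sequentially_leI)
    fix e :: real assume "e > 0"
    then obtain K where K: "\<And>k s. k \<ge> K \<Longrightarrow> dist (p (\<phi> k) s) (q s) < e / 2"
      using uniform_limitD[OF lim, of "e / 2"] by (auto simp: eventually_sequentially)
    have "dist ((norm (p (\<phi> k) s))\<^sup>2) ((norm (q s))\<^sup>2) \<le> e" if "k \<ge> K" for k s
    proof -
      have "(norm (p (\<phi> k) s))\<^sup>2 - (norm (q s))\<^sup>2 = (norm (p (\<phi> k) s) - norm (q s)) * (norm (p (\<phi> k) s) + norm (q s))"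
        by (simp add: power2_eq_square algebra_simps)
      then have "dist ((norm (p (\<phi> k) s))\<^sup>2) ((norm (q s))\<^sup>2)
          = \<bar>norm (p (\<phi> k) s) - norm (q s)\<bar> * (norm (p (\<phi> k) s) + norm (q s))"
        by (simp add: dist_norm abs_mult)
      also have "\<dots> \<le> (e / 2) * (1 + 1)"
        using K[OF that, of s] norm_triangle_ineq3[of "p (\<phi> k) s" "q s"] p(1)[of "\<phi> k"] q(1)
        by (intro mult_mono add_mono normalized_pd_le_1) (auto simp: dist_norm E_def)
      finally show ?thesis by simp
    qed
    then show "\<exists>K. \<forall>k\<ge>K. \<forall>s\<in>UNIV. dist ((norm (p (\<phi> k) s))\<^sup>2) ((norm (q s))\<^sup>2) \<le> e" by blast
  qed
  moreover have "(\<lambda>k. B - 1 / real (Suc (\<phi> k))) \<longlonglongrightarrow> B - 0"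
    using LIMSEQ_subseq_LIMSEQ[OF LIMSEQ_Suc[OF lim_1_over_n] \<phi>]
    by (intro tendsto_intros) (simp add: comp_def)
  ultimately have "B \<le> msq q"
    using p(2) by (intro LIMSEQ_le[of "\<lambda>k. B - 1 / real (Suc (\<phi> k))" B]) (auto intro: less_imp_le)
  moreover have "msq p \<le> B" if "p \<in> E" for p unfolding B_def using that bdd by (auto intro: cSup_upper)
  ultimately have "character q"
    using hm has_mean_unique
    by (intro maximal_eigenfunction_character[OF r(1) q hm[OF qE]]) (fastforce simp: E_def)
  moreover have "positive_definite (\<lambda>t. r t - of_real \<mu> * q t)"
    using positive_definite_minus_conv[OF r(1) _ r(2), of q] q by (simp add: normalized_pd_def)
  ultimately show ?thesis using \<mu> by blast
qed

text \<open>Characters are split off greedily. The remainders decrease in the positive definite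
  order, so convergence of the numbers \<open>p n 0\<close> forces uniform convergence of
  \<open>p n\<close> to an almost periodic positive definite \<open>r\<close>. If \<open>r\<close>
  dominated a multiple \<open>b > 0\<close> of a character, that multiple could have been removed at
  every step, whereas the removed coefficients tend to \<open>0\<close>.\<close>

lemma trigonometric_approximation:
  fixes h :: "'g::ab_group_add \<Rightarrow> complex"
  assumes h: "almost_periodic h" "positive_definite h" and "e > 0"
  shows "\<exists>(n::nat) c \<xi>. (\<forall>i<n. character (\<xi> i)) \<and> (\<forall>t. norm (h t - (\<Sum>i<n. c i * \<xi> i t)) \<le> e)"
proof -
  \<comment> \<open>The supremum of the removable coefficients might not be attained; the factor
    \<open>2\<close> asks \<open>c\<close> to reach only half of it.\<close>
  define good where "good = (\<lambda>p (c::real) (\<xi>::'g \<Rightarrow> complex). character \<xi> \<and> c \<ge> 0 \<and> positive_definite (\<lambda>t. p t - of_real c * \<xi> t) \<and>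
    (\<forall>c' \<xi>'. character \<xi>' \<longrightarrow> positive_definite (\<lambda>t. p t - of_real c' * \<xi>' t) \<longrightarrow> c' \<le> 2 * c))"
  have greedy: "\<exists>c \<xi>. good p c \<xi>" if "positive_definite p" for p :: "'g \<Rightarrow> complex"
  proof -
    define S where "S = {c. \<exists>\<xi>. character \<xi> \<and> positive_definite (\<lambda>t. p t - complex_of_real c * \<xi> t)}"
    have "c \<le> Re (p 0)" if "c \<in> S" for c
    proof -
      obtain \<xi> where "character \<xi>" "positive_definite (\<lambda>t. p t - complex_of_real c * \<xi> t)" using \<open>c \<in> S\<close> by (auto simp: S_def)
      then show ?thesis using positive_definite_zero(2)[of "\<lambda>t. p t - complex_of_real c * \<xi> t"] character_zero by fastforce
    qed
    then have bdd: "bdd_above S" by (auto simp: bdd_above_def)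
    have "0 \<in> S" unfolding S_def using character_const_1 \<open>positive_definite p\<close> by auto
    have "\<exists>c\<in>S. c \<ge> 0 \<and> Sup S \<le> 2 * c"
    proof (cases "Sup S \<le> 0")
      case True then show ?thesis using \<open>0 \<in> S\<close> by (intro bexI[of _ 0]) auto
    next
      case False
      then have "Sup S / 2 < Sup S" by simp
      then obtain c where "c \<in> S" "Sup S / 2 < c" using \<open>0 \<in> S\<close> bdd less_cSup_iff[of S] by blast
      then show ?thesis using False by (intro bexI[of _ c]) auto
    qed
    then obtain c where c: "c \<in> S" "c \<ge> 0" "Sup S \<le> 2 * c" by blast
    moreover have "c' \<le> 2 * c" if "c' \<in> S" for c'
      using cSup_upper[OF that bdd] c(3) by simp
    ultimately show ?thesis unfolding good_def S_def by auto
  qed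
  have "\<exists>p. p 0 = h \<and> (\<forall>n. positive_definite (p n) \<and> (\<exists>c \<xi>. good (p n) c \<xi> \<and> p (Suc n) = (\<lambda>t. p n t - of_real c * \<xi> t)))"
  proof -
    have "\<exists>p. \<forall>n. (positive_definite (p n) \<and> (n = 0 \<longrightarrow> p n = h)) \<and>
       (\<exists>c \<xi>. good (p n) c \<xi> \<and> p (Suc n) = (\<lambda>t. p n t - of_real c * \<xi> t))"
    proof (rule dependent_nat_choice[where P = "\<lambda>n p. positive_definite p \<and> (n = 0 \<longrightarrow> p = h)"
        and Q = "\<lambda>n x y. \<exists>c \<xi>. good x c \<xi> \<and> y = (\<lambda>t. x t - of_real c * \<xi> t)"])
      show "\<exists>x. positive_definite x \<and> ((0::nat) = 0 \<longrightarrow> x = h)" using h by blast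
      fix x and n :: nat assume x: "positive_definite x \<and> (n = 0 \<longrightarrow> x = h)"
      then obtain c \<xi> where g: "good x c \<xi>" using greedy by blast
      show "\<exists>y. (positive_definite y \<and> (Suc n = 0 \<longrightarrow> y = h)) \<and> (\<exists>c \<xi>. good x c \<xi> \<and> y = (\<lambda>t. x t - of_real c * \<xi> t))"
      proof (intro exI conjI)
        show "positive_definite (\<lambda>t. x t - of_real c * \<xi> t)" using g by (simp add: good_def)
      qed (use g in auto)
    qed
    then show ?thesis by blast
  qed
  then obtain p where p: "p 0 = h" "\<And>n. positive_definite (p n)"
    "\<And>n. \<exists>c \<xi>. good (p n) c \<xi> \<and> p (Suc n) = (\<lambda>t. p n t - of_real c * \<xi> t)" by blast
  then obtain c \<xi> where c: "\<And>n. good (p n) (c n) (\<xi> n)"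
    "\<And>n t. p (Suc n) t = p n t - of_real (c n) * \<xi> n t" by metis
  have ch: "character (\<xi> n)" "c n \<ge> 0" for n using c(1)[of n] by (auto simp: good_def)
  have psum: "p n t = h t - (\<Sum>i<n. of_real (c i) * \<xi> i t)" for n t
    by (induction n) (auto simp: p(1) c(2))
  define a where "a = (\<lambda>n. Re (p n 0))"
  have a_Suc: "a (Suc n) = a n - c n" for n using c(2)[of n 0] character_zero[OF ch(1)] by (simp add: a_def)
  have a_nonneg: "a n \<ge> 0" for n using positive_definite_zero(2)[OF p(2)] by (simp add: a_def)
  have "decseq a" using a_Suc ch(2) by (intro decseq_SucI) simp
  then obtain l where l: "a \<longlonglongrightarrow> l" "\<And>n. l \<le> a n"
    using decseq_convergent[of a 0] a_nonneg by blast
  have tail: "positive_definite (\<lambda>t. p n t - p (n + k) t)" for n k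
  proof (induction k)
    case 0
    show ?case using positive_definite_scale[OF positive_definite_character[OF character_const_1], of 0] by simp
  next
    case (Suc k)
    have "positive_definite (\<lambda>t. (p n t - p (n + k) t) + of_real (c (n + k)) * \<xi> (n + k) t)"
      by (intro positive_definite_add Suc positive_definite_scale positive_definite_character ch)
    moreover have "(\<lambda>t. (p n t - p (n + k) t) + of_real (c (n + k)) * \<xi> (n + k) t) = (\<lambda>t. p n t - p (n + Suc k) t)"
      by (simp add: c(2) algebra_simps)
    ultimately show ?case by (simp only:)
  qed
  have bound: "norm (p n t - p (n + k) t) \<le> a n - l" for n k t
    using positive_definite_norm_le[OF tail[of n k], of t] l(2)[of "n + k"] by (simp add: a_def)
  have al: "\<exists>K. \<forall>n\<ge>K. a n - l < e" if "e > 0" for e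
  proof -
    have "(\<lambda>n. a n - l) \<longlonglongrightarrow> l - l" by (intro tendsto_intros l)
    then show ?thesis using order_tendstoD(2)[of "\<lambda>n. a n - l" 0 sequentially e] that
      by (auto simp: eventually_sequentially)
  qed
  have "Cauchy (\<lambda>n. p n t)" for t
  proof (rule metric_CauchyI)
    fix e :: real assume "e > 0"
    then obtain K where K: "\<And>n. n \<ge> K \<Longrightarrow> a n - l < e" using al by blast
    have lt: "dist (p m t) (p n t) < e" if "m \<ge> K" "n \<ge> m" for m n
      using bound[of m t "n - m"] K[OF that(1)] that(2) by (simp add: dist_norm)
    show "\<exists>M. \<forall>m\<ge>M. \<forall>n\<ge>M. dist (p m t) (p n t) < e"
    proof (intro exI[of _ K] allI impI)
      fix m n assume "m \<ge> K" "n \<ge> K"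
      then show "dist (p m t) (p n t) < e"
        using lt[of m n] lt[of n m] by (cases "m \<le> n") (auto simp: dist_commute)
    qed
  qed
  then have "\<forall>t. \<exists>x. (\<lambda>n. p n t) \<longlonglongrightarrow> x"
    by (simp add: Cauchy_convergent_iff convergent_def)
  then obtain r where r: "\<And>t. (\<lambda>n. p n t) \<longlonglongrightarrow> r t" by metis
  have pr: "norm (p n t - r t) \<le> a n - l" for n t
  proof (rule Lim_norm_ubound[OF trivial_limit_sequentially])
    show "(\<lambda>k. p n t - p (k + n) t) \<longlonglongrightarrow> p n t - r t"
      by (rule tendsto_diff[OF tendsto_const LIMSEQ_ignore_initial_segment[OF r]])
    show "\<forall>\<^sub>F k in sequentially. norm (p n t - p (k + n) t) \<le> a n - l"
      using bound[of n t] by (simp add: add.commute)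
  qed
  have "almost_periodic (p n)" for n
    unfolding psum[abs_def] by (intro almost_periodic_diff h almost_periodic_sum almost_periodic_mult almost_periodic_const almost_periodic_character ch) auto
  moreover have "uniform_limit UNIV p r sequentially"
  proof (rule uniform_limit_sequentially_leI)
    fix e :: real assume "e > 0"
    then obtain K where K: "\<And>n. n \<ge> K \<Longrightarrow> a n - l < e" using al by blast
    have "dist (p n t) (r t) \<le> e" if "n \<ge> K" for n t
      using pr[of n t] K[OF that] by (simp add: dist_norm)
    then show "\<exists>K. \<forall>n\<ge>K. \<forall>t\<in>UNIV. dist (p n t) (r t) \<le> e" by blast
  qed
  ultimately have apr: "almost_periodic r" by (rule almost_periodic_uniform_limit_seq)
  have pdr: "positive_definite r" by (rule positive_definite_limit[OF p(2) r])
  have "r 0 = 0"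
  proof (rule ccontr)
    assume "r 0 \<noteq> 0"
    then obtain \<eta> b where b: "character \<eta>" "b > 0" "positive_definite (\<lambda>t. r t - of_real b * \<eta> t)"
      using positive_definite_dominates_character[OF apr pdr] by blast
    \<comment> \<open>Each \<open>p n\<close> dominates \<open>r\<close>, hence also
      \<open>b\<close> times the character \<eta>, and the choice of \<open>c n\<close>
      applies.\<close>
    have "b \<le> 2 * c n" for n
    proof -
      have "positive_definite (\<lambda>t. p n t - r t)"
      proof (rule positive_definite_limit[OF tail])
        fix t show "(\<lambda>k. p n t - p (n + k) t) \<longlonglongrightarrow> p n t - r t"
          using tendsto_diff[OF tendsto_const LIMSEQ_ignore_initial_segment[OF r[of t], of n]] by (simp add: add.commute)
      qed
      from positive_definite_add[OF this b(3)] have "positive_definite (\<lambda>t. p n t - of_real b * \<eta> t)" by simp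
      then show ?thesis using c(1)[of n] b(1) unfolding good_def by blast
    qed
    moreover have "c \<longlonglongrightarrow> l - l"
    proof -
      have "(\<lambda>n. a n - a (Suc n)) \<longlonglongrightarrow> l - l" by (rule tendsto_diff[OF l(1) LIMSEQ_Suc[OF l(1)]])
      then show ?thesis by (simp add: a_Suc)
    qed
    ultimately have "b \<le> 2 * (l - l)"
      by (intro LIMSEQ_le_const[OF tendsto_mult_left[of c]]) auto
    then show False using b(2) by simp
  qed
  then have "r t = 0" for t using positive_definite_norm_le[OF pdr, of t] by simp
  moreover obtain n where "a n - l < e" using al[OF \<open>e > 0\<close>] by blast
  ultimately have "norm (p n t) \<le> e" for t using pr[of n t] by simp
  then show ?thesis using ch psum by (intro exI[of _ n] exI[of _ "\<lambda>i. of_real (c i)"] exI[of _ \<xi>]) auto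
qed

subsection \<open>The closure of the sun-dual semigroup\<close>

text \<open>Brings pointwise convergence into the basic-neighbourhood form in which
  \<open>wstar_closure\<close> and \<open>weak_star_closure_sun\<close> are written.\<close>

lemma fun_closure_iff:
  fixes g :: "'i \<Rightarrow> 'b::metric_space"
  shows "g \<in> closure A \<longleftrightarrow> (\<forall>I e. finite I \<longrightarrow> e > 0 \<longrightarrow> (\<exists>a\<in>A. \<forall>i\<in>I. dist (a i) (g i) < e))"
proof safe
  fix I :: "'i set" and e :: real assume g: "g \<in> closure A" and "finite I" "e > 0"
  let ?O = "{f. \<forall>i\<in>I. f (id i) \<in> ball (g (id i)) e}"
  have "open ?O" by (rule product_topology_basis') (use \<open>finite I\<close> in auto)
  moreover have "g \<in> ?O" using \<open>e > 0\<close> by simp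
  ultimately have "A \<inter> ?O \<noteq> {}" using g open_Int_closure_eq_empty[of ?O A] by blast
  then show "\<exists>a\<in>A. \<forall>i\<in>I. dist (a i) (g i) < e" by (auto simp: dist_commute)
next
  assume *: "\<forall>I e. finite I \<longrightarrow> e > 0 \<longrightarrow> (\<exists>a\<in>A. \<forall>i\<in>I. dist (a i) (g i) < e)"
  show "g \<in> closure A"
  proof (rule ccontr)
    assume "g \<notin> closure A"
    then have "openin (product_topology (\<lambda>_. euclidean) UNIV) (- closure A)" "g \<in> - closure A"
      by (auto simp flip: open_fun_def)
    from product_topology_open_contains_basis[OF this] obtain X where
      X: "g \<in> (\<Pi>\<^sub>E i\<in>UNIV. X i)" "\<And>i. open (X i)" "finite {i. X i \<noteq> UNIV}" "(\<Pi>\<^sub>E i\<in>UNIV. X i) \<subseteq> - closure A"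
      by auto
    define I where "I = {i. X i \<noteq> UNIV}"
    have "\<forall>i. \<exists>e>0. ball (g i) e \<subseteq> X i" using X(1,2) by (meson PiE_E UNIV_I open_contains_ball)
    then obtain e where e: "\<And>i. e i > 0" "\<And>i. ball (g i) (e i) \<subseteq> X i" by metis
    define d where "d = Min (insert 1 (e ` I))"
    have fin: "finite (insert 1 (e ` I))" using X(3) by (simp add: I_def)
    then have "d > 0" unfolding d_def using e(1) by (subst Min_gr_iff) auto
    then obtain a where a: "a \<in> A" "\<And>i. i \<in> I \<Longrightarrow> dist (a i) (g i) < d"
      using * X(3) I_def by metis
    have "a i \<in> X i" for i
    proof (cases "i \<in> I")
      case True
      then have "d \<le> e i" unfolding d_def using fin by (intro Min_le) auto
      then have "a i \<in> ball (g i) (e i)" using a(2)[OF True] by (simp add: dist_commute)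
      then show ?thesis using e(2) by blast
    qed (simp add: I_def)
    then have "a \<in> - closure A" using X(4) by (auto simp: PiE_iff)
    then show False using a(1) closure_subset by blast
  qed
qed

lemma compact_imp_closed_fun:
  fixes A :: "('i \<Rightarrow> 'b::metric_space) set"
  assumes "compact A" shows "closed A"
proof -
  have "Hausdorff_space (product_topology (\<lambda>_::'i. euclidean :: 'b topology) UNIV)"
    by (simp add: Hausdorff_space_product_topology)
  then have "Hausdorff_space (euclidean :: ('i \<Rightarrow> 'b) topology)"
    by (simp only: euclidean_product_topology)
  then have "closedin euclidean A" using assms by (intro compactin_imp_closedin) auto
  then show ?thesis by simp
qed

lemma compact_box:
  fixes B :: "'i \<Rightarrow> real"
  shows "compact {g :: 'i \<Rightarrow> complex. \<forall>i. norm (g i) \<le> B i}"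
proof -
  have "compactin (product_topology (\<lambda>_. euclidean) UNIV) (\<Pi>\<^sub>E i\<in>UNIV. cball (0::complex) (B i))"
    by (simp add: compactin_PiE)
  moreover have "(\<Pi>\<^sub>E i\<in>UNIV. cball (0::complex) (B i)) = {g. \<forall>i. norm (g i) \<le> B i}"
    by (auto simp: PiE_iff)
  ultimately show ?thesis by (simp add: euclidean_product_topology)
qed

lemma cscale_apply [simp]: "blinfun_apply (cscale c f) v = c * blinfun_apply f v"
  by (simp add: cscale_def blinfun_mult_left.rep_eq)

lemma norm_cscale_le: "norm (cscale c f) \<le> norm c * norm f"
  by (rule norm_blinfun_bound) (auto simp: norm_mult mult.assoc intro!: mult_left_mono norm_blinfun)

lemma bounded_bilinear_cscale: "bounded_bilinear cscale"
proof
  fix a a' r and b b' :: "'a \<Rightarrow>\<^sub>L complex"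
  show "cscale (a + a') b = cscale a b + cscale a' b" by (rule blinfun_eqI) (simp add: algebra_simps blinfun.add_left)
  show "cscale a (b + b') = cscale a b + cscale a b'" by (rule blinfun_eqI) (simp add: algebra_simps blinfun.add_left)
  show "cscale (r *\<^sub>R a) b = r *\<^sub>R cscale a b" by (rule blinfun_eqI) (simp add: blinfun.scaleR_left)
  show "cscale a (r *\<^sub>R b) = r *\<^sub>R cscale a b" by (rule blinfun_eqI) (simp add: blinfun.scaleR_left)
  show "\<exists>K. \<forall>a (b :: 'a \<Rightarrow>\<^sub>L complex). norm (cscale a b) \<le> norm a * norm b * K"
    by (rule exI[of _ 1]) (simp add: norm_cscale_le)
qed

lemma cscale_cscale: "cscale a (cscale b f) = cscale (a * b) f"
  by (rule blinfun_eqI) simp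

lemma cscale_of_real: "cscale (of_real r) f = r *\<^sub>R f"
  by (rule blinfun_eqI) (simp add: blinfun.scaleR_left scaleR_conv_of_real)

section \<open>The sun dual and the operators in the closure\<close>

locale sun_semigroup =
  fixes cs :: "complex \<Rightarrow> 'a::banach \<Rightarrow> 'a" and T :: "real \<Rightarrow> 'a \<Rightarrow>\<^sub>L 'a"
  assumes cplx: "cplx_struct cs" and C0: "bounded_C0_semigroup cs T"
begin

abbreviation "Xs \<equiv> sun_dual cs T"
abbreviation "Cl \<equiv> wstar_closure cs T"
abbreviation "S \<equiv> sun_op cs T"

text \<open>A bound of at least \<open>1\<close> can be divided by, and it absorbs terms that come
  without a factor, as in \<open>norm (f - g) \<le> M * norm (f - g)\<close>.\<close>

definition M :: real where "M = (SOME M. M \<ge> 1 \<and> (\<forall>t\<ge>0. norm (T t) \<le> M))"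

lemma M: "M \<ge> 1" "t \<ge> 0 \<Longrightarrow> norm (T t) \<le> M"
proof -
  obtain K where "\<forall>t\<ge>0. norm (T t) \<le> K" using C0 unfolding bounded_C0_semigroup_def by blast
  then have "\<exists>M. M \<ge> 1 \<and> (\<forall>t\<ge>0. norm (T t) \<le> M)" by (intro exI[of _ "max K 1"]) force
  then have "M \<ge> 1 \<and> (\<forall>t\<ge>0. norm (T t) \<le> M)" unfolding M_def by (rule someI_ex)
  then show "M \<ge> 1" "t \<ge> 0 \<Longrightarrow> norm (T t) \<le> M" by auto
qed

lemma M_nonneg: "M \<ge> 0" using M(1) by simp

lemma T0: "T 0 = id_blinfun" and Tadd: "s \<ge> 0 \<Longrightarrow> t \<ge> 0 \<Longrightarrow> T (s + t) = T s o\<^sub>L T t"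
  and Tcs: "t \<ge> 0 \<Longrightarrow> blinfun_apply (T t) (cs c v) = cs c (blinfun_apply (T t) v)"
  using C0 unfolding bounded_C0_semigroup_def by auto

lemma T_commute: "s \<ge> 0 \<Longrightarrow> t \<ge> 0 \<Longrightarrow> T s o\<^sub>L T t = T t o\<^sub>L T s"
  by (metis Tadd add.commute)

lemma norm_compose_T: "t \<ge> 0 \<Longrightarrow> norm (f o\<^sub>L T t) \<le> M * norm f"
  using norm_blinfun_compose[of f "T t"] mult_left_mono[OF M(2)[of t], of "norm f"]
  by (simp add: mult.commute)

lemma cdual_iff: "f \<in> cdual cs \<longleftrightarrow> (\<forall>c v. blinfun_apply f (cs c v) = c * blinfun_apply f v)"
  by (simp add: cdual_def)

lemma sun_iff: "f \<in> Xs \<longleftrightarrow> f \<in> cdual cs \<and> ((\<lambda>t. f o\<^sub>L T t) \<longlongrightarrow> f) (at_right 0)"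
  by (simp add: sun_dual_def)

lemma compose_add_left: "(f + g) o\<^sub>L h = (f o\<^sub>L h) + (g o\<^sub>L h)"
  and compose_diff_left: "(f - g) o\<^sub>L h = (f o\<^sub>L h) - (g o\<^sub>L h)"
  and compose_zero_left: "0 o\<^sub>L h = 0"
  by (rule blinfun_eqI; simp add: blinfun.add_left blinfun.diff_left)+

lemma cscale_compose: "cscale c f o\<^sub>L h = cscale c (f o\<^sub>L h)"
  by (rule blinfun_eqI) simp

lemma sun_0: "0 \<in> Xs"
  by (simp add: sun_iff cdual_iff compose_zero_left)

lemma sun_add: assumes "f \<in> Xs" "g \<in> Xs" shows "f + g \<in> Xs"
  using assms unfolding sun_iff cdual_iff compose_add_left
  by (auto simp: blinfun.add_left algebra_simps intro!: tendsto_add)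

lemma sun_cscale: assumes "f \<in> Xs" shows "cscale c f \<in> Xs"
  using assms unfolding sun_iff cdual_iff cscale_compose
  by (auto intro!: bounded_bilinear.tendsto[OF bounded_bilinear_cscale])

lemma sun_diff: assumes "f \<in> Xs" "g \<in> Xs" shows "f - g \<in> Xs"
  using assms unfolding sun_iff cdual_iff compose_diff_left
  by (auto simp: blinfun.diff_left algebra_simps intro!: tendsto_diff)

lemma sun_sum: "finite I \<Longrightarrow> (\<And>i. i \<in> I \<Longrightarrow> f i \<in> Xs) \<Longrightarrow> (\<Sum>i\<in>I. f i) \<in> Xs"
  by (induction I rule: finite_induct) (auto intro: sun_0 sun_add)

lemma sun_compose: assumes "f \<in> Xs" "s \<ge> 0" shows "f o\<^sub>L T s \<in> Xs"
proof -
  have "((\<lambda>t. (f o\<^sub>L T t) o\<^sub>L T s) \<longlongrightarrow> f o\<^sub>L T s) (at_right 0)"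
    using assms by (intro bounded_bilinear.tendsto[OF bounded_bilinear_blinfun_compose] tendsto_const) (auto simp: sun_iff)
  moreover have "\<forall>\<^sub>F t in at_right 0. (f o\<^sub>L T t) o\<^sub>L T s = (f o\<^sub>L T s) o\<^sub>L T t"
  proof (rule eventually_at_rightI[of 0 1])
    fix t :: real assume "t \<in> {0<..<1}"
    then have "T t o\<^sub>L T s = T s o\<^sub>L T t" using assms by (intro T_commute) auto
    then have "blinfun_apply (T t) (blinfun_apply (T s) v) = blinfun_apply (T s) (blinfun_apply (T t) v)" for v
      by (metis blinfun_apply_blinfun_compose)
    then show "(f o\<^sub>L T t) o\<^sub>L T s = (f o\<^sub>L T s) o\<^sub>L T t" by (intro blinfun_eqI) simp
  qed simp
  ultimately have "((\<lambda>t. (f o\<^sub>L T s) o\<^sub>L T t) \<longlongrightarrow> f o\<^sub>L T s) (at_right 0)"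
    by (rule Lim_transform_eventually)
  then show ?thesis using assms by (auto simp: sun_iff cdual_iff Tcs)
qed

lemma sun_closed: "closed Xs"
proof -
  have "f \<in> Xs" if f: "f \<in> closure Xs" for f
    unfolding sun_iff cdual_iff
  proof (intro conjI allI)
    obtain g where g: "\<And>n. g n \<in> Xs" "g \<longlonglongrightarrow> f" using f by (auto simp: closure_sequential)
    fix c v
    have "(\<lambda>n. blinfun_apply (g n) w) \<longlonglongrightarrow> blinfun_apply f w" for w by (intro tendsto_intros g)
    then have "(\<lambda>n. blinfun_apply (g n) (cs c v)) \<longlonglongrightarrow> blinfun_apply f (cs c v)"
      "(\<lambda>n. c * blinfun_apply (g n) v) \<longlonglongrightarrow> c * blinfun_apply f v" by (auto intro: tendsto_mult_left)
    then show "blinfun_apply f (cs c v) = c * blinfun_apply f v"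
      using g(1) LIMSEQ_unique by (auto simp: sun_iff cdual_iff)
  next
    show "((\<lambda>t. f o\<^sub>L T t) \<longlongrightarrow> f) (at_right 0)"
    proof (rule tendstoI)
      fix e :: real assume "e > 0"
      then have "e / (3 * M) > 0" using M(1) by simp
      then obtain g where g: "g \<in> Xs" "dist g f < e / (3 * M)"
        using f by (meson closure_approachable)
      have "\<forall>\<^sub>F t in at_right 0. dist (g o\<^sub>L T t) g < e / 3"
        using g(1) \<open>e > 0\<close> by (intro tendstoD) (auto simp: sun_iff)
      moreover have "\<forall>\<^sub>F t::real in at_right 0. t > 0" by (simp add: eventually_at_right_less)
      ultimately show "\<forall>\<^sub>F t in at_right 0. dist (f o\<^sub>L T t) f < e"
      proof eventually_elim
        case (elim t)
        have "M * norm (f - g) < e / 3"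
          using g(2) M(1) by (simp add: dist_norm norm_minus_commute field_simps)
        moreover have "norm (f - g) \<le> M * norm (f - g)" using M(1) by (simp add: mult_right_mono mult_le_cancel_right1)
        moreover have "norm ((f - g) o\<^sub>L T t) \<le> M * norm (f - g)" using elim by (intro norm_compose_T) auto
        moreover have "norm ((f o\<^sub>L T t) - f) \<le> norm ((f - g) o\<^sub>L T t) + norm (((g o\<^sub>L T t) - g) - (f - g))"
          using norm_triangle_ineq[of "(f - g) o\<^sub>L T t" "((g o\<^sub>L T t) - g) - (f - g)"] by (simp add: compose_diff_left)
        moreover have "norm (((g o\<^sub>L T t) - g) - (f - g)) \<le> norm ((g o\<^sub>L T t) - g) + norm (f - g)"
          by (rule norm_triangle_ineq4)
        ultimately show ?case using elim by (simp add: dist_norm)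
      qed
    qed
  qed
  then show ?thesis using closure_subset_eq by blast
qed

lemma S_apply: "f \<in> Xs \<Longrightarrow> S t f = f o\<^sub>L T t"
  by (simp add: sun_op_def)

lemma bounded_op_S: assumes "t \<ge> 0" shows "bounded_op_sun cs T (S t)"
  unfolding bounded_op_sun_def
proof (intro conjI ballI allI)
  show "\<exists>K. \<forall>f\<in>Xs. norm (S t f) \<le> K * norm f"
    using norm_compose_T[OF assms] by (intro exI[of _ M]) (auto simp: S_apply)
qed (use assms in \<open>auto simp: S_apply sun_compose sun_add sun_cscale compose_add_left cscale_compose sun_op_def\<close>)

lemma S_in_Cl: "t \<ge> 0 \<Longrightarrow> S t \<in> Cl"
  unfolding wstar_closure_def by (auto simp: bounded_op_S intro!: exI[of _ t])

lemma Cl_outside: "U \<in> Cl \<Longrightarrow> f \<notin> Xs \<Longrightarrow> U f = 0"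
  and Cl_in: "U \<in> Cl \<Longrightarrow> f \<in> Xs \<Longrightarrow> U f \<in> Xs"
  and Cl_add: "U \<in> Cl \<Longrightarrow> f \<in> Xs \<Longrightarrow> g \<in> Xs \<Longrightarrow> U (f + g) = U f + U g"
  and Cl_cscale: "U \<in> Cl \<Longrightarrow> f \<in> Xs \<Longrightarrow> U (cscale c f) = cscale c (U f)"
  unfolding wstar_closure_def bounded_op_sun_def by auto

lemma Cl_diff: assumes "U \<in> Cl" "f \<in> Xs" "g \<in> Xs" shows "U (f - g) = U f - U g"
proof -
  have "U (f - g) + U g = U f" using Cl_add[OF assms(1) sun_diff[OF assms(2,3)] assms(3)] by simp
  then show ?thesis by (simp add: algebra_simps)
qed

lemma Cl_approx:
  assumes "U \<in> Cl" "finite F" "finite G" "G \<subseteq> Xs" "e > 0"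
  shows "\<exists>t\<ge>0. \<forall>v\<in>F. \<forall>y\<in>G. norm (blinfun_apply (U y) v - blinfun_apply (y o\<^sub>L T t) v) < e"
proof -
  have "\<exists>t\<ge>0. \<forall>v\<in>F. \<forall>y\<in>G. cmod (blinfun_apply (U y) v - blinfun_apply (S t y) v) < e"
    using assms unfolding wstar_closure_def by blast
  then show ?thesis using assms(4) S_apply by (metis subsetD)
qed

text \<open>An operator as a point in a product of copies of \<open>complex\<close>, indexed by
  functionals and vectors. The operator topology of the closure becomes the product topology, where
  Tychonoff's theorem is available.\<close>

definition pairing :: "(('a \<Rightarrow>\<^sub>L complex) \<Rightarrow> ('a \<Rightarrow>\<^sub>L complex)) \<Rightarrow> ('a \<Rightarrow>\<^sub>L complex) \<times> 'a \<Rightarrow> complex" where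
  "pairing U = (\<lambda>(y, v). blinfun_apply (U y) v)"

lemma Cl_iff_closure:
  "U \<in> Cl \<longleftrightarrow> bounded_op_sun cs T U \<and> pairing U \<in> closure (pairing ` S ` {0..})"
proof safe
  assume U: "U \<in> Cl"
  then show bo: "bounded_op_sun cs T U" by (simp add: wstar_closure_def)
  show "pairing U \<in> closure (pairing ` S ` {0..})"
    unfolding fun_closure_iff
  proof (intro allI impI)
    fix I :: "(('a \<Rightarrow>\<^sub>L complex) \<times> 'a) set" and e :: real assume "finite I" "e > 0"
    then obtain t where t: "t \<ge> 0" "\<And>v y. v \<in> snd ` I \<Longrightarrow> y \<in> fst ` I \<inter> Xs \<Longrightarrow> norm (blinfun_apply (U y) v - blinfun_apply (y o\<^sub>L T t) v) < e"
      using Cl_approx[OF U, of "snd ` I" "fst ` I \<inter> Xs" e] by (metis finite_Int finite_imageI inf_le2)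
    have "dist (pairing (S t) (y, v)) (pairing U (y, v)) < e" if "(y, v) \<in> I" for y v
    proof (cases "y \<in> Xs")
      case True
      then show ?thesis using t(2)[of v y] that by (force simp: pairing_def S_apply dist_norm norm_minus_commute)
    next
      case False
      then show ?thesis using Cl_outside[OF U False] \<open>e > 0\<close> by (simp add: pairing_def sun_op_def)
    qed
    then show "\<exists>a\<in>pairing ` S ` {0..}. \<forall>i\<in>I. dist (a i) (pairing U i) < e"
      using t(1) by (intro bexI[of _ "pairing (S t)"]) auto
  qed
next
  assume bo: "bounded_op_sun cs T U" and cl: "pairing U \<in> closure (pairing ` S ` {0..})"
  show "U \<in> Cl"
    unfolding wstar_closure_def
  proof (safe intro!: bo)
    fix F :: "'a set" and G :: "('a \<Rightarrow>\<^sub>L complex) set" and e :: real assume "finite F" "finite G" "e > 0"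
    then obtain a where "a \<in> pairing ` S ` {0..}" "\<forall>i\<in>G \<times> F. dist (a i) (pairing U i) < e"
      using cl unfolding fun_closure_iff by (metis finite_cartesian_product)
    then show "\<exists>t\<ge>0. \<forall>x\<in>F. \<forall>y\<in>G. cmod (blinfun_apply (U y) x - blinfun_apply (S t y) x) < e"
      by (auto simp: pairing_def dist_norm norm_minus_commute)
  qed
qed

text \<open>A pointwise limit of the pairings of \<open>S t\<close> has to come from an operator on
  the sun dual; this is what makes the image of \<open>Cl\<close> closed in the product, and so
  compact. The set \<Gamma> collects properties that survive pointwise limits and suffice to
  reconstruct the operator.\<close>

lemma pairing_closure_eq: "pairing ` Cl = closure (pairing ` S ` {0..})"
proof
  show "pairing ` Cl \<subseteq> closure (pairing ` S ` {0..})" using Cl_iff_closure by blast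
  \<comment> \<open>The last condition keeps limits inside the sun dual: it says that composing
    \<open>U y\<close> with \<open>T s\<close> changes it by at most \<open>M\<close> times as much
    as composing \<open>y\<close> with \<open>T s\<close> changes \<open>y\<close>. For
    \<open>U = S t\<close> it holds because \<open>T s\<close> and \<open>T t\<close>
    commute.\<close>
  define \<Gamma> where "\<Gamma> = {g :: ('a \<Rightarrow>\<^sub>L complex) \<times> 'a \<Rightarrow> complex.
     (\<forall>y v. y \<notin> Xs \<longrightarrow> g (y, v) = 0) \<and>
     (\<forall>y v. norm (g (y, v)) \<le> M * norm y * norm v) \<and>
     (\<forall>y v w. g (y, v + w) = g (y, v) + g (y, w)) \<and>
     (\<forall>y c v. g (y, cs c v) = c * g (y, v)) \<and>
     (\<forall>y z v. y \<in> Xs \<longrightarrow> z \<in> Xs \<longrightarrow> g (y + z, v) = g (y, v) + g (z, v)) \<and>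
     (\<forall>y c v. y \<in> Xs \<longrightarrow> g (cscale c y, v) = c * g (y, v)) \<and>
     (\<forall>y s v. y \<in> Xs \<longrightarrow> s \<ge> 0 \<longrightarrow> norm (g (y, blinfun_apply (T s) v) - g (y, v)) \<le> M * norm ((y o\<^sub>L T s) - y) * norm v)}"
  have "closed \<Gamma>"
    unfolding \<Gamma>_def
    by (intro closed_Collect_conj closed_Collect_all closed_Collect_imp open_Collect_const
        closed_Collect_eq closed_Collect_le continuous_intros continuous_on_product_coordinates)
  have csr: "cs (of_real r) v = r *\<^sub>R v" for r v using cplx by (simp add: cplx_struct_def)
  have "pairing (S t) \<in> \<Gamma>" if "t \<ge> 0" for t
  proof -
    have n: "norm (blinfun_apply f (blinfun_apply (T t) v)) \<le> M * norm f * norm v" for f :: "'a \<Rightarrow>\<^sub>L complex" and v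
      using norm_blinfun[of "f o\<^sub>L T t" v] mult_right_mono[OF norm_compose_T[OF that, of f], of "norm v"] by simp
    have "norm (blinfun_apply y (blinfun_apply (T t) (blinfun_apply (T s) v)) - blinfun_apply y (blinfun_apply (T t) v))
       \<le> M * norm ((y o\<^sub>L T s) - y) * norm v" if "s \<ge> 0" for y :: "'a \<Rightarrow>\<^sub>L complex" and s v
    proof -
      have "blinfun_apply (T t) (blinfun_apply (T s) v) = blinfun_apply (T s) (blinfun_apply (T t) v)"
        using arg_cong[OF T_commute[OF \<open>t \<ge> 0\<close> that], of "\<lambda>h. blinfun_apply h v"] by simp
      then show ?thesis using n[of "(y o\<^sub>L T s) - y" v] by (simp add: blinfun.diff_left)
    qed
    moreover have "norm (blinfun_apply (S t y) v) \<le> M * norm y * norm v" for y v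
      using n[of y v] M_nonneg by (cases "y \<in> Xs") (auto simp: S_apply sun_op_def)
    moreover have "blinfun_apply (S t y) (cs c v) = c * blinfun_apply (S t y) v" for y c v
      by (cases "y \<in> Xs") (auto simp: S_apply sun_op_def Tcs[OF \<open>t \<ge> 0\<close>] sun_iff cdual_iff)
    ultimately show ?thesis
      unfolding \<Gamma>_def pairing_def
      by (auto simp: S_apply sun_add sun_cscale blinfun.add_right blinfun.add_left) (auto simp: sun_op_def)
  qed
  then have "closure (pairing ` S ` {0..}) \<subseteq> \<Gamma>" using \<open>closed \<Gamma>\<close> by (intro closure_minimal) auto
  show "closure (pairing ` S ` {0..}) \<subseteq> pairing ` Cl"
  proof
    fix g assume g: "g \<in> closure (pairing ` S ` {0..})"
    then have "g \<in> \<Gamma>" using \<open>closure (pairing ` S ` {0..}) \<subseteq> \<Gamma>\<close> by blast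
    then have G: "\<And>y v. y \<notin> Xs \<Longrightarrow> g (y, v) = 0" "\<And>y v. norm (g (y, v)) \<le> M * norm y * norm v"
      "\<And>y v w. g (y, v + w) = g (y, v) + g (y, w)" "\<And>y c v. g (y, cs c v) = c * g (y, v)"
      "\<And>y z v. y \<in> Xs \<Longrightarrow> z \<in> Xs \<Longrightarrow> g (y + z, v) = g (y, v) + g (z, v)"
      "\<And>y c v. y \<in> Xs \<Longrightarrow> g (cscale c y, v) = c * g (y, v)"
      "\<And>y s v. y \<in> Xs \<Longrightarrow> s \<ge> 0 \<Longrightarrow> norm (g (y, blinfun_apply (T s) v) - g (y, v)) \<le> M * norm ((y o\<^sub>L T s) - y) * norm v"
      unfolding \<Gamma>_def by auto
    have bl: "bounded_linear (\<lambda>v. g (y, v))" for y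
    proof (rule bounded_linear_intro)
      fix r v show "g (y, r *\<^sub>R v) = r *\<^sub>R g (y, v)"
        using G(4)[of y "of_real r" v] by (simp add: csr scaleR_conv_of_real)
      show "norm (g (y, v)) \<le> norm v * (M * norm y)" using G(2)[of y v] by (simp add: mult.commute)
    qed (rule G)
    define U where "U = (\<lambda>y. Blinfun (\<lambda>v. g (y, v)))"
    have U: "blinfun_apply (U y) v = g (y, v)" for y v
      unfolding U_def by (simp add: bounded_linear_Blinfun_apply[OF bl])
    have pU: "pairing U = g" by (auto simp: pairing_def U)
    have "bounded_op_sun cs T U"
      unfolding bounded_op_sun_def
    proof (intro conjI ballI allI impI)
      fix f assume "f \<notin> Xs" then show "U f = 0" by (intro blinfun_eqI) (simp add: U G)
    next
      fix y assume y: "y \<in> Xs"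
      show "U y \<in> Xs"
        unfolding sun_iff cdual_iff
      proof (intro conjI allI)
        fix c v show "blinfun_apply (U y) (cs c v) = c * blinfun_apply (U y) v" by (simp add: U G)
      next
        have le: "norm ((U y o\<^sub>L T s) - U y) \<le> M * norm ((y o\<^sub>L T s) - y)" if "s \<ge> 0" for s
          using G(7)[OF y that] M_nonneg by (intro norm_blinfun_bound) (auto simp: blinfun.diff_left U)
        have ev: "\<forall>\<^sub>F s in at_right 0. norm ((U y o\<^sub>L T s) - U y) \<le> M * norm ((y o\<^sub>L T s) - y)"
          by (rule eventually_at_rightI[of 0 1]) (auto intro: le)
        have "((\<lambda>s. M * norm ((y o\<^sub>L T s) - y)) \<longlongrightarrow> M * norm (y - y)) (at_right 0)"
          using y by (intro tendsto_intros) (simp add: sun_iff)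
        then have "((\<lambda>s. (U y o\<^sub>L T s) - U y) \<longlongrightarrow> 0) (at_right 0)"
          using ev by - (rule Lim_null_comparison[of _ "\<lambda>s. M * norm ((y o\<^sub>L T s) - y)"], auto)
        then show "((\<lambda>s. U y o\<^sub>L T s) \<longlongrightarrow> U y) (at_right 0)" by (rule LIM_zero_cancel)
      qed
    next
      fix f h assume "f \<in> Xs" "h \<in> Xs"
      then show "U (f + h) = U f + U h" by (intro blinfun_eqI) (simp add: U G blinfun.add_left)
    next
      fix c f assume "f \<in> Xs"
      then show "U (cscale c f) = cscale c (U f)" by (intro blinfun_eqI) (simp add: U G)
    next
      show "\<exists>K. \<forall>f\<in>Xs. norm (U f) \<le> K * norm f"
        using G(2) M_nonneg by (intro exI[of _ M] ballI norm_blinfun_bound) (auto simp: U)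
    qed
    then show "g \<in> pairing ` Cl" using g pU Cl_iff_closure by blast
  qed
qed

lemma Cl_norm_le: assumes "U \<in> Cl" "y \<in> Xs" shows "norm (U y) \<le> M * norm y"
proof (rule norm_blinfun_bound)
  show "0 \<le> M * norm y" using M_nonneg by simp
  fix v show "norm (blinfun_apply (U y) v) \<le> M * norm y * norm v"
  proof (rule field_le_epsilon)
    fix e :: real assume "e > 0"
    then obtain t where t: "t \<ge> 0" "norm (blinfun_apply (U y) v - blinfun_apply (y o\<^sub>L T t) v) < e"
      using Cl_approx[OF assms(1), of "{v}" "{y}" e] assms by auto
    have "norm (blinfun_apply (y o\<^sub>L T t) v) \<le> norm (y o\<^sub>L T t) * norm v" by (rule norm_blinfun)
    also have "\<dots> \<le> M * norm y * norm v" by (intro mult_right_mono norm_compose_T t) auto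
    finally show "norm (blinfun_apply (U y) v) \<le> M * norm y * norm v + e"
      using t(2) norm_triangle_sub[of "blinfun_apply (U y) v" "blinfun_apply (y o\<^sub>L T t) v"] by linarith
  qed
qed

lemma compact_pairing_Cl: "compact (pairing ` Cl)"
proof -
  let ?B = "{g :: ('a \<Rightarrow>\<^sub>L complex) \<times> 'a \<Rightarrow> complex. \<forall>i. norm (g i) \<le> (case i of (y, v) \<Rightarrow> M * norm y * norm v)}"
  have "pairing U \<in> ?B" if U: "U \<in> Cl" for U
  proof -
    have "norm (blinfun_apply (U y) v) \<le> M * norm y * norm v" for y v
    proof (cases "y \<in> Xs")
      case True
      then show ?thesis
        using norm_blinfun[of "U y" v] mult_right_mono[OF Cl_norm_le[OF U True], of "norm v"] by simp
    next
      case False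
      then show ?thesis using Cl_outside[OF U False] M_nonneg by simp
    qed
    then show ?thesis by (simp add: pairing_def split_beta)
  qed
  then have "pairing ` Cl = ?B \<inter> closure (pairing ` S ` {0..})" unfolding pairing_closure_eq[symmetric] by blast
  moreover have "compact (?B \<inter> closure (pairing ` S ` {0..}))"
    by (intro compact_Int_closed compact_box closed_closure)
  ultimately show ?thesis by simp
qed

lemma pairing_inj: "pairing U = pairing V \<Longrightarrow> U = V"
proof -
  assume h: "pairing U = pairing V"
  have "blinfun_apply (U y) v = blinfun_apply (V y) v" for y v
    using fun_cong[OF h, of "(y, v)"] by (simp add: pairing_def)
  then show "U = V" by (intro ext blinfun_eqI)
qed

lemma Cl_compose: assumes "U \<in> Cl" "V \<in> Cl" shows "U \<circ> V \<in> Cl"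
proof -
  have "U 0 = 0" using Cl_cscale[OF assms(1) sun_0, of 0] by (metis cscale_of_real of_real_0 scaleR_zero_left)
  have "bounded_op_sun cs T (U \<circ> V)"
    unfolding bounded_op_sun_def
  proof (intro conjI ballI allI impI)
    show "\<exists>K. \<forall>f\<in>Xs. norm ((U \<circ> V) f) \<le> K * norm f"
    proof (intro exI ballI)
      fix f assume "f \<in> Xs"
      then have "norm (U (V f)) \<le> M * norm (V f)" "norm (V f) \<le> M * norm f"
        using Cl_norm_le[OF assms(1) Cl_in[OF assms(2)]] Cl_norm_le[OF assms(2)] by auto
      then show "norm ((U \<circ> V) f) \<le> (M * M) * norm f"
        using mult_left_mono[of "norm (V f)" "M * norm f" M] M_nonneg by simp
    qed
  qed (use assms \<open>U 0 = 0\<close> in \<open>auto simp: Cl_in Cl_add Cl_cscale Cl_outside\<close>)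
  moreover have "\<exists>t\<ge>0. \<forall>v\<in>F. \<forall>y\<in>G. cmod (blinfun_apply ((U \<circ> V) y) v - blinfun_apply (S t y) v) < e"
    if h: "finite F" "finite G" "G \<subseteq> Xs" "e > 0" for F G e
  proof -
    have "V ` G \<subseteq> Xs" using h(3) Cl_in[OF assms(2)] by blast
    then have "\<exists>t\<ge>0. \<forall>v\<in>F. \<forall>y\<in>V ` G. norm (blinfun_apply (U y) v - blinfun_apply (y o\<^sub>L T t) v) < e / 2"
      using h by (intro Cl_approx[OF assms(1)]) auto
    then obtain t where t: "t \<ge> 0" "\<And>v y. v \<in> F \<Longrightarrow> y \<in> V ` G \<Longrightarrow> norm (blinfun_apply (U y) v - blinfun_apply (y o\<^sub>L T t) v) < e / 2"
      by blast
    \<comment> \<open>The order of the choices matters: composition with \<open>T t\<close> moves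
      the test vectors, so \<open>t\<close> is fixed first, for \<open>U\<close>, and
      \<open>V\<close> is approximated on the image of \<open>F\<close> under
      \<open>T t\<close>.\<close>
    obtain s where s: "s \<ge> 0" "\<And>v y. v \<in> blinfun_apply (T t) ` F \<Longrightarrow> y \<in> G \<Longrightarrow> norm (blinfun_apply (V y) v - blinfun_apply (y o\<^sub>L T s) v) < e / 2"
      using Cl_approx[OF assms(2), of "blinfun_apply (T t) ` F" G "e / 2"] h
      by (metis finite_imageI half_gt_zero)
    have "cmod (blinfun_apply ((U \<circ> V) y) v - blinfun_apply (S (s + t) y) v) < e" if "v \<in> F" "y \<in> G" for v y
    proof -
      have "norm (blinfun_apply (U (V y)) v - blinfun_apply (V y o\<^sub>L T t) v) < e / 2" using t that by blast
      moreover have "norm (blinfun_apply (V y) (blinfun_apply (T t) v) - blinfun_apply (y o\<^sub>L T s) (blinfun_apply (T t) v)) < e / 2"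
        using s that by blast
      moreover have "S (s + t) y = y o\<^sub>L (T s o\<^sub>L T t)" using that \<open>G \<subseteq> Xs\<close> s t by (auto simp: S_apply Tadd)
      ultimately show ?thesis
        using norm_triangle_ineq[of "blinfun_apply (U (V y)) v - blinfun_apply (V y) (blinfun_apply (T t) v)"
          "blinfun_apply (V y) (blinfun_apply (T t) v) - blinfun_apply y (blinfun_apply (T s) (blinfun_apply (T t) v))"] by simp
    qed
    with s t show ?thesis by (intro exI[of _ "s + t"]) auto
  qed
  ultimately show ?thesis unfolding wstar_closure_def by blast
qed

end

section \<open>Norm compactness, separability and total boundedness\<close>

lemma compact_imp_norm_separable:
  fixes A :: "'b::metric_space set"
  assumes "compact A" shows "norm_separable A"
proof -
  have "\<forall>e>0. \<exists>k. finite k \<and> k \<subseteq> A \<and> A \<subseteq> (\<Union>x\<in>k. ball x e)"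
    using seq_compact_imp_totally_bounded[OF compact_imp_seq_compact[OF assms]] by blast
  then obtain k where k: "\<And>e. e > 0 \<Longrightarrow> finite (k e) \<and> k e \<subseteq> A \<and> A \<subseteq> (\<Union>x\<in>k e. ball x e)" by metis
  let ?D = "\<Union>n. k (1 / real (Suc n))"
  have "A \<subseteq> closure ?D"
  proof
    fix x assume "x \<in> A"
    show "x \<in> closure ?D"
      unfolding closure_approachable
    proof (intro allI impI)
      fix e :: real assume "e > 0"
      then obtain n where n: "1 / real (Suc n) < e" by (rule nat_approx_posE)
      have "A \<subseteq> (\<Union>y\<in>k (1 / real (Suc n)). ball y (1 / real (Suc n)))"
        using k[of "1 / real (Suc n)"] by simp
      then obtain y where "y \<in> k (1 / real (Suc n))" "dist y x < 1 / real (Suc n)"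
        using \<open>x \<in> A\<close> by auto
      then show "\<exists>y\<in>?D. dist y x < e" using n by (meson UNIV_I UN_I less_trans)
    qed
  qed
  moreover have "countable ?D" using k by (intro countable_UN) (auto intro: countable_finite)
  moreover have "?D \<subseteq> A" using k by (intro UN_least) simp
  ultimately show ?thesis unfolding norm_separable_def by blast
qed

lemma compact_closure_totally_bounded:
  fixes A :: "'b::complete_space set"
  assumes "\<And>e. e > 0 \<Longrightarrow> \<exists>k. finite k \<and> A \<subseteq> (\<Union>x\<in>k. ball x e)"
  shows "compact (closure A)"
  unfolding compact_eq_totally_bounded
proof (intro conjI allI impI)
  show "complete (closure A)" by (simp add: complete_eq_closed)
  fix e :: real assume "e > 0"
  then obtain k where k: "finite k" "A \<subseteq> (\<Union>x\<in>k. ball x (e / 2))" using assms[of "e / 2"] by auto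
  have "A \<subseteq> (\<Union>x\<in>k. cball x (e / 2))" using k(2) by (meson UN_mono ball_subset_cball order_trans order_refl)
  then have "closure A \<subseteq> (\<Union>x\<in>k. cball x (e / 2))"
    using k(1) by (intro closure_minimal closed_UN) auto
  also have "\<dots> \<subseteq> (\<Union>x\<in>k. ball x e)" using \<open>e > 0\<close> by (intro UN_mono) auto
  finally show "\<exists>k. finite k \<and> closure A \<subseteq> (\<Union>x\<in>k. ball x e)" using k(1) by blast
qed

lemma continuous_on_blinfun_apply_fun: "continuous_on A (blinfun_apply :: ('a::real_normed_vector \<Rightarrow>\<^sub>L complex) \<Rightarrow> _)"
  by (intro continuous_on_coordinatewise_then_product continuous_intros)

context sun_semigroup
begin

section \<open>Orbits, their weak* closures and combinations of eigenvectors\<close>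

definition compact_orbit :: "('a \<Rightarrow>\<^sub>L complex) \<Rightarrow> bool" where
  "compact_orbit y \<longleftrightarrow> compact (closure (sun_orbit cs T y))"

lemma sun_orbit_eq: "sun_orbit cs T y = (\<lambda>t. S t y) ` {0..}"
  by (auto simp: sun_orbit_def)

lemma orbit_subset: "y \<in> Xs \<Longrightarrow> sun_orbit cs T y \<subseteq> Xs"
  using S_in_Cl Cl_in by (auto simp: sun_orbit_eq)

lemma weak_star_closure_iff:
  "y \<in> weak_star_closure_sun cs T A \<longleftrightarrow> y \<in> Xs \<and> blinfun_apply y \<in> closure (blinfun_apply ` A)"
  unfolding weak_star_closure_sun_def fun_closure_iff by (auto simp: dist_norm)

text \<open>Evaluation at \<open>x\<close> maps the compact closure continuously to functions with
  pointwise convergence, so its image is closed, and it contains the orbit.\<close>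

lemma weak_star_closure_orbit:
  assumes "x \<in> Xs"
  shows "weak_star_closure_sun cs T (sun_orbit cs T x) = (\<lambda>U. U x) ` Cl"
proof -
  define E where "E = (\<lambda>g (v::'a). g (x, v) :: complex)"
  have E: "E (pairing U) = blinfun_apply (U x)" for U by (auto simp: E_def pairing_def)
  have contE: "continuous_on UNIV E" unfolding E_def
    by (intro continuous_on_coordinatewise_then_product continuous_on_product_coordinates)
  have "closed (E ` pairing ` Cl)"
    by (intro compact_imp_closed_fun compact_continuous_image compact_pairing_Cl continuous_on_subset[OF contE]) auto
  moreover have "blinfun_apply ` sun_orbit cs T x \<subseteq> E ` pairing ` Cl"
    by (auto simp: sun_orbit_eq E image_image intro!: image_eqI[OF _ S_in_Cl])
  ultimately have sub: "closure (blinfun_apply ` sun_orbit cs T x) \<subseteq> E ` pairing ` Cl"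
    by (rule closure_minimal[rotated])
  show ?thesis
  proof safe
    fix y assume "y \<in> weak_star_closure_sun cs T (sun_orbit cs T x)"
    then have "blinfun_apply y \<in> E ` pairing ` Cl" using sub unfolding weak_star_closure_iff by blast
    then show "y \<in> (\<lambda>U. U x) ` Cl" by (auto simp: E blinfun_apply_inject)
  next
    fix U assume U: "U \<in> Cl"
    show "U x \<in> weak_star_closure_sun cs T (sun_orbit cs T x)"
      unfolding weak_star_closure_iff fun_closure_iff
    proof (intro conjI allI impI Cl_in[OF U assms])
      fix I :: "'a set" and e :: real assume "finite I" "e > 0"
      then obtain t where "t \<ge> 0" "\<forall>v\<in>I. norm (blinfun_apply (U x) v - blinfun_apply (x o\<^sub>L T t) v) < e"
        using Cl_approx[OF U, of I "{x}" e] assms by auto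
      then show "\<exists>a\<in>blinfun_apply ` sun_orbit cs T x. \<forall>i\<in>I. dist (a i) (blinfun_apply (U x) i) < e"
        using assms by (intro bexI[of _ "blinfun_apply (S t x)"])
          (auto simp: sun_orbit_eq S_apply dist_norm norm_minus_commute)
    qed
  qed
qed

text \<open>A norm compact set is compact, hence closed, for pointwise convergence too.\<close>

lemma weak_star_closure_eq_closure:
  assumes "x \<in> Xs" "compact_orbit x"
  shows "weak_star_closure_sun cs T (sun_orbit cs T x) = closure (sun_orbit cs T x)"
proof safe
  fix y assume y: "y \<in> weak_star_closure_sun cs T (sun_orbit cs T x)"
  have "closed (blinfun_apply ` closure (sun_orbit cs T x))"
    using assms(2) unfolding compact_orbit_def
    by (intro compact_imp_closed_fun compact_continuous_image continuous_on_blinfun_apply_fun)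
  then have "closure (blinfun_apply ` sun_orbit cs T x) \<subseteq> blinfun_apply ` closure (sun_orbit cs T x)"
    by (intro closure_minimal image_mono closure_subset)
  then show "y \<in> closure (sun_orbit cs T x)"
    using y unfolding weak_star_closure_iff by (auto simp: blinfun_apply_inject)
next
  fix y assume y: "y \<in> closure (sun_orbit cs T x)"
  have "y \<in> Xs" using y closure_minimal[OF orbit_subset[OF assms(1)] sun_closed] by blast
  moreover have "blinfun_apply y \<in> closure (blinfun_apply ` sun_orbit cs T x)"
    using y image_closure_subset[OF continuous_on_blinfun_apply_fun closed_closure closure_subset] by blast
  ultimately show "y \<in> weak_star_closure_sun cs T (sun_orbit cs T x)" by (simp add: weak_star_closure_iff)
qed

lemma compact_orbit_imp_separable:
  assumes "x \<in> Xs" "compact_orbit x"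
  shows "norm_separable (weak_star_closure_sun cs T (sun_orbit cs T x))"
  using assms compact_imp_norm_separable unfolding weak_star_closure_eq_closure[OF assms] compact_orbit_def by blast

lemma eig_sun: "y \<in> unimodular_eigvecs cs T \<Longrightarrow> y \<in> Xs"
  by (simp add: unimodular_eigvecs_def)

lemma cspan_sun: "z \<in> cspan (unimodular_eigvecs cs T) \<Longrightarrow> z \<in> Xs"
  unfolding cspan_def using eig_sun by (auto intro!: sun_sum sun_cscale)

lemma compact_cscale_sphere: "compact ((\<lambda>c. cscale c y) ` sphere 0 1)"
  by (intro compact_continuous_image bounded_bilinear.continuous_on[OF bounded_bilinear_cscale]
      continuous_intros) auto

text \<open>An eigenvector moves on the norm compact circle of its unimodular multiples, and sums of
  compact sets are compact.\<close>

lemma eig_orbit_compact: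
  assumes "finite I" "\<And>i. i \<in> I \<Longrightarrow> v i \<in> unimodular_eigvecs cs T"
  shows "\<exists>K. compact K \<and> (\<forall>t\<ge>0. S t (\<Sum>i\<in>I. cscale (c i) (v i)) \<in> K)"
  using assms
proof (induction I rule: finite_induct)
  case empty
  show ?case using S_apply[OF sun_0] compose_zero_left by (intro exI[of _ "{0}"]) auto
next
  case (insert i I)
  then obtain K where K: "compact K" "\<And>t. t \<ge> 0 \<Longrightarrow> S t (\<Sum>i\<in>I. cscale (c i) (v i)) \<in> K" by auto
  let ?K = "(\<lambda>a. cscale a (cscale (c i) (v i))) ` sphere 0 1"
  have vi: "v i \<in> Xs" "\<And>i. i \<in> I \<Longrightarrow> v i \<in> Xs" using insert eig_sun by auto
  obtain lam where lam: "\<And>U. U \<in> Cl \<Longrightarrow> cmod (lam U) = 1 \<and> U (v i) = cscale (lam U) (v i)"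
    using insert.prems[of i] unfolding unimodular_eigvecs_def by auto
  have "S t (\<Sum>j\<in>insert i I. cscale (c j) (v j)) \<in> {a + b |a b. a \<in> ?K \<and> b \<in> K}" if "t \<ge> 0" for t
  proof -
    have "S t (\<Sum>j\<in>insert i I. cscale (c j) (v j)) = S t (cscale (c i) (v i)) + S t (\<Sum>j\<in>I. cscale (c j) (v j))"
      using insert vi by (simp add: Cl_add[OF S_in_Cl[OF that]] sun_cscale sun_sum)
    moreover have "S t (cscale (c i) (v i)) = cscale (lam (S t)) (cscale (c i) (v i))"
      using lam[OF S_in_Cl[OF that]] vi by (simp add: Cl_cscale[OF S_in_Cl[OF that]] cscale_cscale mult.commute)
    moreover have "lam (S t) \<in> sphere 0 1" using lam[OF S_in_Cl[OF that]] by simp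
    ultimately show ?thesis using K(2)[OF that] by blast
  qed
  moreover have "compact {a + b |a b. a \<in> ?K \<and> b \<in> K}"
    by (intro compact_sums compact_cscale_sphere K)
  ultimately show ?case by blast
qed

lemma uds_imp_compact_orbit:
  assumes "x \<in> Xs" "x \<in> X_uds cs T"
  shows "compact_orbit x"
  unfolding compact_orbit_def
proof (rule compact_closure_totally_bounded)
  fix e :: real assume "e > 0"
  then have "e / (2 * M) > 0" using M(1) by simp
  then obtain z where z: "z \<in> cspan (unimodular_eigvecs cs T)" "dist z x < e / (2 * M)"
    using assms(2) unfolding X_uds_def by (meson closure_approachable)
  obtain K where K: "compact K" "\<And>t. t \<ge> 0 \<Longrightarrow> S t z \<in> K"
  proof -
    obtain I :: "nat set" and c v where "finite I" "\<And>i. i \<in> I \<Longrightarrow> v i \<in> unimodular_eigvecs cs T"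
      "z = (\<Sum>i\<in>I. cscale (c i) (v i))" using z(1) unfolding cspan_def by blast
    then show ?thesis using eig_orbit_compact[of I v c] that by blast
  qed
  obtain k where k: "finite k" "K \<subseteq> (\<Union>y\<in>k. ball y (e / 2))"
    using K(1) half_gt_zero[OF \<open>e > 0\<close>] unfolding compact_eq_totally_bounded by blast
  have "S t x \<in> (\<Union>y\<in>k. ball y e)" if "t \<ge> 0" for t
  proof -
    obtain y where y: "y \<in> k" "dist y (S t z) < e / 2" using K(2)[OF \<open>t \<ge> 0\<close>] k(2) by auto
    have "norm (S t (z - x)) \<le> M * norm (z - x)"
      using assms cspan_sun[OF z(1)] by (intro Cl_norm_le S_in_Cl that sun_diff)
    also have "\<dots> < e / 2" using z(2) M(1) by (simp add: dist_norm field_simps)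
    finally have "dist (S t z) (S t x) < e / 2"
      using Cl_diff[OF S_in_Cl[OF that] cspan_sun[OF z(1)] assms(1)] by (simp add: dist_norm)
    then have "dist y (S t x) < e" using y dist_triangle[of y "S t x" "S t z"] by simp
    then show ?thesis using y(1) by auto
  qed
  then show "\<exists>k. finite k \<and> sun_orbit cs T x \<subseteq> (\<Union>y\<in>k. ball y e)"
    using k(1) by (auto simp: sun_orbit_eq)
qed

end

subsection \<open>Abelian closure\<close>

locale abelian_sun_semigroup = sun_semigroup cs T
  for cs :: "complex \<Rightarrow> 'a::banach \<Rightarrow> 'a" and T +
  fixes P :: "('a \<Rightarrow>\<^sub>L complex) \<Rightarrow> ('a \<Rightarrow>\<^sub>L complex)"
  assumes commute: "\<And>U V. U \<in> Cl \<Longrightarrow> V \<in> Cl \<Longrightarrow> U \<circ> V = V \<circ> U"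
    and minimal: "minimal_idempotent cs T P"
begin

lemma P: "P \<in> Cl" "P \<circ> P = P"
  and P_minimal: "Q \<in> Cl \<Longrightarrow> Q \<circ> Q = Q \<Longrightarrow> P \<circ> Q = Q \<Longrightarrow> Q \<circ> P = P"
  using minimal unfolding minimal_idempotent_def by auto

text \<open>Right composition with \<open>U\<close> merely reindexes the coordinates of
  \<open>pairing\<close>, so it is continuous and maps \<open>Cl\<close> to a compact set. Finitely
  many operators have their composite as a common multiple, by commutativity; the finite
  intersection property gives one for all.\<close>

lemma common_multiple: "\<exists>k\<in>Cl. \<forall>U\<in>Cl. \<exists>W\<in>Cl. k = W \<circ> U"
proof -
  define \<psi> where "\<psi> = (\<lambda>U g. \<lambda>(y :: 'a \<Rightarrow>\<^sub>L complex, v). g (U y :: 'a \<Rightarrow>\<^sub>L complex, v :: 'a) :: complex)"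
  have \<psi>: "\<psi> U (pairing W) = pairing (W \<circ> U)" for U W by (auto simp: \<psi>_def pairing_def)
  have cont: "continuous_on UNIV (\<psi> U)" for U
    unfolding \<psi>_def by (intro continuous_on_coordinatewise_then_product) (auto simp: split_beta)
  have "pairing ` Cl \<inter> (\<Inter>U\<in>Cl. \<psi> U ` pairing ` Cl) \<noteq> {}"
  proof (rule compact_imp_fip_image[OF compact_pairing_Cl])
    fix U show "closed (\<psi> U ` pairing ` Cl)"
      by (intro compact_imp_closed_fun compact_continuous_image compact_pairing_Cl continuous_on_subset[OF cont]) auto
  next
    fix I assume "finite I" "I \<subseteq> Cl"
    then have "\<exists>Z\<in>Cl. \<forall>U\<in>I. \<exists>W\<in>Cl. Z = W \<circ> U"
    proof (induction I rule: finite_induct)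
      case empty
      then show ?case using P by blast
    next
      case (insert V I)
      then obtain Z where Z: "Z \<in> Cl" "\<forall>U\<in>I. \<exists>W\<in>Cl. Z = W \<circ> U" and V: "V \<in> Cl" by blast
      have "\<exists>W\<in>Cl. V \<circ> Z = W \<circ> U" if "U \<in> I" for U
      proof -
        obtain W where "W \<in> Cl" "Z = W \<circ> U" using Z(2) \<open>U \<in> I\<close> by blast
        then show ?thesis using Cl_compose[OF V] by (intro bexI[of _ "V \<circ> W"]) (auto simp: comp_assoc)
      qed
      moreover have "V \<circ> Z = Z \<circ> V" using commute Z V by blast
      then have "\<exists>W\<in>Cl. V \<circ> Z = W \<circ> V" using Z(1) by blast
      ultimately have "\<forall>U\<in>insert V I. \<exists>W\<in>Cl. V \<circ> Z = W \<circ> U" by blast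
      then show ?case using Cl_compose[OF V Z(1)] by blast
    qed
    then obtain Z where Z: "Z \<in> Cl" "\<And>U. U \<in> I \<Longrightarrow> \<exists>W\<in>Cl. Z = W \<circ> U" by blast
    have "pairing Z \<in> \<psi> U ` pairing ` Cl" if "U \<in> I" for U
      using Z(2)[OF that] \<psi> by (metis imageI)
    then show "pairing ` Cl \<inter> (\<Inter>U\<in>I. \<psi> U ` pairing ` Cl) \<noteq> {}" using Z(1) by blast
  qed
  then obtain k where k: "k \<in> Cl" "\<And>U. U \<in> Cl \<Longrightarrow> pairing k \<in> \<psi> U ` pairing ` Cl" by blast
  have "\<exists>W\<in>Cl. k = W \<circ> U" if "U \<in> Cl" for U
  proof -
    obtain W where W: "W \<in> Cl" "pairing k = \<psi> U (pairing W)" using k(2)[OF \<open>U \<in> Cl\<close>] by blast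
    then have "k = W \<circ> U" using pairing_inj by (simp add: \<psi>)
    with W(1) show ?thesis by blast
  qed
  with k(1) show ?thesis by blast
qed

text \<open>The common multiple \<open>k\<close> is also a multiple of \<open>k \<circ> k\<close>,
  which makes \<open>v \<circ> k\<close> idempotent. Its composite with \<open>P\<close> is an
  idempotent below \<open>P\<close>, hence equal to \<open>P\<close> by minimality, and
  \<open>U\<close> is a right factor of it because it is one of \<open>k\<close>.\<close>

lemma inverse_exists:
  assumes "U \<in> Cl" shows "\<exists>V\<in>Cl. V \<circ> U = P"
proof -
  obtain k where k: "k \<in> Cl" "\<And>U. U \<in> Cl \<Longrightarrow> \<exists>W\<in>Cl. k = W \<circ> U" using common_multiple by blast
  obtain v where v: "v \<in> Cl" "k = v \<circ> (k \<circ> k)" using k Cl_compose by blast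
  obtain W where W: "W \<in> Cl" "k = W \<circ> U" using k(2)[OF assms] by blast
  define e where "e = v \<circ> k"
  have e: "e \<in> Cl" unfolding e_def using v k Cl_compose by blast
  have "e \<circ> e = v \<circ> (k \<circ> v) \<circ> k" by (simp add: e_def comp_assoc)
  also have "k \<circ> v = v \<circ> k" using commute k v by blast
  also have "v \<circ> (v \<circ> k) \<circ> k = v \<circ> (v \<circ> (k \<circ> k))" by (simp add: comp_assoc)
  also have "\<dots> = e" using v(2) by (simp add: e_def)
  finally have ee: "e \<circ> e = e" .
  define Q where "Q = P \<circ> e"
  have Q: "Q \<in> Cl" unfolding Q_def using P e Cl_compose by blast
  have "Q \<circ> Q = P \<circ> (e \<circ> P) \<circ> e" by (simp add: Q_def comp_assoc)
  also have "e \<circ> P = P \<circ> e" using commute e P by blast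
  also have "P \<circ> (P \<circ> e) \<circ> e = (P \<circ> P) \<circ> (e \<circ> e)" by (simp add: comp_assoc)
  also have "\<dots> = Q" by (simp add: P ee Q_def)
  finally have "Q \<circ> Q = Q" .
  moreover have "P \<circ> Q = Q" unfolding Q_def using P(2) by (metis comp_assoc)
  ultimately have "Q \<circ> P = P" using P_minimal Q by blast
  moreover have "Q \<circ> P = P \<circ> Q" using commute Q P by blast
  ultimately have "Q = P" using \<open>P \<circ> Q = Q\<close> by simp
  then have "P = (P \<circ> v \<circ> W) \<circ> U" unfolding Q_def e_def using W(2) by (simp add: comp_assoc)
  moreover have "P \<circ> v \<circ> W \<in> Cl" using P v W Cl_compose by blast
  ultimately show ?thesis by metis
qed

end

lemma has_mean_in_closed_subspace:
  assumes "has_mean F c" "closed A" "0 \<in> A" "\<And>x y. x \<in> A \<Longrightarrow> y \<in> A \<Longrightarrow> x + y \<in> A"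
    "\<And>r x. x \<in> A \<Longrightarrow> r *\<^sub>R x \<in> A" "\<And>t. F t \<in> A"
  shows "c \<in> A"
proof -
  have sum: "(\<Sum>s\<leftarrow>xs. F (0 + s)) \<in> A" for xs
    by (induction xs) (use assms in auto)
  have "c \<in> closure A"
    unfolding closure_approachable
  proof (intro allI impI)
    fix e :: real assume "e > 0"
    then obtain xs where "norm (avg xs F 0 - c) \<le> e / 2"
      using assms(1) unfolding has_mean_def by (meson half_gt_zero)
    moreover have "avg xs F 0 \<in> A" unfolding avg_def by (intro assms(5) sum)
    ultimately show "\<exists>y\<in>A. dist y c < e"
      using \<open>e > 0\<close> by (intro bexI[of _ "avg xs F 0"]) (auto simp: dist_norm)
  qed
  then show ?thesis using assms(2) by simp
qed

section \<open>Orbits with norm separable weak* closure\<close>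

context abelian_sun_semigroup
begin

lemma P_fixed: assumes "x \<in> P ` Xs" shows "x \<in> Xs" "P x = x"
  using assms Cl_in[OF P(1)] P(2) by (auto simp: fun_eq_iff)

lemma Cl_fixed: assumes "P x = x" "U \<in> Cl" shows "P (U x) = U x"
  using fun_cong[OF commute[OF P(1) assms(2)], of x] assms(1) by simp

lemma Cl_swap: "U \<in> Cl \<Longrightarrow> V \<in> Cl \<Longrightarrow> U (V y) = V (U y)"
  using fun_cong[OF commute[of U V], of y] by simp

lemma separable_imp_compact_orbit:
  assumes x: "x \<in> Xs" "P x = x"
    and sep: "norm_separable (weak_star_closure_sun cs T (sun_orbit cs T x))"
  shows "compact_orbit x"
  unfolding compact_orbit_def
proof (rule compact_closure_totally_bounded)
  fix e :: real assume "e > 0"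
  \<comment> \<open>A ball of radius \<delta> has diameter at most \<open>2 * \<delta>\<close>, and
    the operator that carries a piece of the orbit back from it has norm at most
    \<open>M\<close>.\<close>
  define \<delta> where "\<delta> = e / (4 * M)"
  have \<delta>: "\<delta> > 0" "M * (2 * \<delta>) < e" using \<open>e > 0\<close> M(1) by (auto simp: \<delta>_def)
  define W where "W = (\<lambda>U. U x) ` Cl"
  define E where "E = (\<lambda>(y :: 'a \<Rightarrow>\<^sub>L complex) g (v::'a). g (y, v) :: complex)"
  have E: "E y (pairing U) = blinfun_apply (U y)" for U and y :: "'a \<Rightarrow>\<^sub>L complex" by (auto simp: E_def pairing_def)
  have contE: "continuous_on UNIV (E y)" for y :: "'a \<Rightarrow>\<^sub>L complex" unfolding E_def
    by (intro continuous_on_coordinatewise_then_product continuous_on_product_coordinates)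
  define A where "A = blinfun_apply ` W"
  have "A = E x ` pairing ` Cl" by (auto simp: A_def W_def E image_image)
  then have compA: "compact A"
    by (auto intro!: compact_continuous_image compact_pairing_Cl continuous_on_subset[OF contE])
  obtain D where D: "D \<subseteq> W" "countable D" "W \<subseteq> closure D"
    using sep unfolding norm_separable_def weak_star_closure_orbit[OF x(1)] W_def by blast
  define B where "B = (\<lambda>d. blinfun_apply ` (W \<inter> cball d \<delta>))"
  \<comment> \<open>A closed norm ball is cut out by one inequality for each \<open>v\<close>, so it
    is closed for pointwise convergence, the topology in which Baire's theorem is applied.\<close>
  have B_eq: "B d = A \<inter> {f. \<forall>v. norm (f v - blinfun_apply d v) \<le> \<delta> * norm v}" for d
  proof -
    have "y \<in> cball d \<delta> \<longleftrightarrow> (\<forall>v. norm (blinfun_apply y v - blinfun_apply d v) \<le> \<delta> * norm v)" for y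
    proof
      assume y: "y \<in> cball d \<delta>"
      show "\<forall>v. norm (blinfun_apply y v - blinfun_apply d v) \<le> \<delta> * norm v"
      proof
        fix v
        have "norm (blinfun_apply (y - d) v) \<le> norm (y - d) * norm v" by (rule norm_blinfun)
        also have "\<dots> \<le> \<delta> * norm v" using y by (intro mult_right_mono) (auto simp: dist_norm norm_minus_commute)
        finally show "norm (blinfun_apply y v - blinfun_apply d v) \<le> \<delta> * norm v" by (simp add: blinfun.diff_left)
      qed
    next
      assume "\<forall>v. norm (blinfun_apply y v - blinfun_apply d v) \<le> \<delta> * norm v"
      then have "norm (y - d) \<le> \<delta>" using \<delta>(1) by (intro norm_blinfun_bound) (auto simp: blinfun.diff_left)
      then show "y \<in> cball d \<delta>" by (simp add: dist_norm norm_minus_commute)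
    qed
    then show ?thesis unfolding B_def A_def by auto
  qed
  let ?X = "top_of_set A"
  have closedB: "closedin ?X (B d)" for d
    unfolding B_eq
    by (intro closedin_closed_Int closed_Collect_all closed_Collect_le continuous_intros continuous_on_product_coordinates)
  have "\<Union>(B ` D) = A"
  proof
    show "\<Union>(B ` D) \<subseteq> A" using B_eq by blast
    show "A \<subseteq> \<Union>(B ` D)"
    proof
      fix f assume "f \<in> A"
      then obtain w where w: "w \<in> W" "f = blinfun_apply w" by (auto simp: A_def)
      then obtain d where "d \<in> D" "dist d w < \<delta>" using D(3) \<delta>(1) by (meson closure_approachable subsetD)
      then show "f \<in> \<Union>(B ` D)" using w by (auto simp: B_def intro!: bexI[of _ d])
    qed
  qed
  then have "?X interior_of \<Union>(B ` D) = A" by (metis interior_of_topspace topspace_euclidean_subtopology)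
  moreover have "A \<noteq> {}" using P by (auto simp: A_def W_def)
  moreover have "locally_compact_space ?X \<and> regular_space ?X"
  proof -
    have "Hausdorff_space (euclidean :: ('a \<Rightarrow> complex) topology)"
      by (metis Hausdorff_space_euclidean Hausdorff_space_product_topology euclidean_product_topology)
    then have "Hausdorff_space ?X" by (rule Hausdorff_space_subtopology)
    moreover have "compact_space ?X" using compA by (simp add: compact_space_subtopology)
    ultimately show ?thesis
      by (simp add: compact_Hausdorff_imp_regular_space compact_imp_locally_compact_space)
  qed
  ultimately obtain d where "?X interior_of (B d) \<noteq> {}"
    using Baire_category_alt[of ?X "B ` D"] D(2) closedB by (metis (no_types, lifting) countable_image imageE)
  then obtain O0 f0 where O0: "open O0" "f0 \<in> A" "f0 \<in> O0" "A \<inter> O0 \<subseteq> B d"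
    unfolding interior_of_def openin_open by auto
  obtain U0 where U0: "U0 \<in> Cl" "f0 = blinfun_apply (U0 x)" using O0(2) by (auto simp: A_def W_def)
  have "\<exists>V\<in>Cl. V (U x) = U0 x" if U: "U \<in> Cl" for U
  proof -
    obtain V where V: "V \<in> Cl" "V \<circ> U = P" using inverse_exists[OF U] by blast
    have "V (U x) = x" using fun_cong[OF V(2), of x] x(2) by (simp only: comp_apply)
    then have "(U0 \<circ> V) (U x) = U0 x" by simp
    then show ?thesis using Cl_compose[OF U0(1) V(1)] by blast
  qed
  then obtain V where V: "\<And>U. U \<in> Cl \<Longrightarrow> V U \<in> Cl" "\<And>U. U \<in> Cl \<Longrightarrow> V U (U x) = U0 x" by metis
  have "open (E y -` O0)" for y :: "'a \<Rightarrow>\<^sub>L complex"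
    using contE O0(1) by (simp add: open_vimage)
  \<comment> \<open>Since \<open>U\<close> commutes with \<open>V U\<close>, it sends
    \<open>V U x\<close> to \<open>U0 x\<close>, which corresponds to the point \<open>f0\<close> of
    \<open>O0\<close>. So each \<open>U\<close> lies in the open set with its own index.\<close>
  moreover have "pairing ` Cl \<subseteq> (\<Union>U\<in>Cl. E (V U x) -` O0)"
  proof
    fix g assume "g \<in> pairing ` Cl"
    then obtain U where U: "U \<in> Cl" "g = pairing U" by blast
    then have "U (V U x) = U0 x" using V Cl_swap by metis
    then have "g \<in> E (V U x) -` O0" using U O0(3) U0(2) by (simp add: E)
    with U show "g \<in> (\<Union>U\<in>Cl. E (V U x) -` O0)" by blast
  qed
  ultimately obtain N where N: "N \<subseteq> Cl" "finite N" "pairing ` Cl \<subseteq> (\<Union>U\<in>N. E (V U x) -` O0)"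
    using compactE_image[OF compact_pairing_Cl, of Cl "\<lambda>U. E (V U x) -` O0"] by metis
  define cls where "cls = (\<lambda>U. {R \<in> Cl. V U (R x) \<in> cball d \<delta>})"
  have cover: "\<exists>U\<in>N. R \<in> cls U" if R: "R \<in> Cl" for R
  proof -
    obtain U where U: "U \<in> N" "blinfun_apply (R (V U x)) \<in> O0" using N(3) R by (auto simp: E)
    have VU: "V U \<in> Cl" using U(1) N(1) V(1) by blast
    have "R (V U x) \<in> W" unfolding W_def
      using Cl_compose[OF R VU] by (intro image_eqI[of _ _ "R \<circ> V U"]) auto
    then have "blinfun_apply (R (V U x)) \<in> B d" using O0(4) U(2) by (auto simp: A_def)
    then have "R (V U x) \<in> cball d \<delta>" by (auto simp: B_def blinfun_apply_inject)
    then show ?thesis using U(1) R Cl_swap[OF VU R] by (intro bexI[of _ U]) (auto simp: cls_def)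
  qed
  have diam: "norm (R x - R' x) < e" if U: "U \<in> N" and RR: "R \<in> cls U" "R' \<in> cls U" for U R R'
  proof -
    have VU: "V U \<in> Cl" using U N(1) V(1) by blast
    have R: "R \<in> Cl" "R' \<in> Cl" using RR by (auto simp: cls_def)
    then have in_sun: "R x \<in> Xs" "R' x \<in> Xs" using x Cl_in by auto
    obtain Z where Z: "Z \<in> Cl" "Z \<circ> V U = P" using inverse_exists[OF VU] by blast
    have "dist (V U (R x)) (V U (R' x)) \<le> 2 * \<delta>"
      using RR dist_triangle2[of "V U (R x)" "V U (R' x)" d] by (auto simp: cls_def dist_commute)
    then have n: "norm (V U (R x - R' x)) \<le> 2 * \<delta>"
      using Cl_diff[OF VU in_sun] by (simp add: dist_norm)
    \<comment> \<open>Both vectors are fixed by \<open>P\<close>, so \<open>Z\<close> undoes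
      \<open>V U\<close> on their difference, at the cost of a factor \<open>M\<close>.\<close>
    have "R x - R' x = P (R x - R' x)"
      using Cl_diff[OF P(1) in_sun] Cl_fixed[OF x(2)] R by simp
    also have "\<dots> = Z (V U (R x - R' x))" using fun_cong[OF Z(2)] by simp
    finally have "norm (R x - R' x) \<le> M * norm (V U (R x - R' x))"
      using Cl_norm_le[OF Z(1) Cl_in[OF VU sun_diff[OF in_sun]]] by simp
    also have "\<dots> \<le> M * (2 * \<delta>)" using n M_nonneg by (rule mult_left_mono)
    finally show ?thesis using \<delta>(2) by simp
  qed
  define rep where "rep = (\<lambda>U. SOME R. R \<in> cls U)"
  have "sun_orbit cs T x \<subseteq> (\<Union>y\<in>(\<lambda>U. rep U x) ` N. ball y e)"
  proof
    fix y assume "y \<in> sun_orbit cs T x"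
    then obtain R where R: "R \<in> Cl" "y = R x" using S_in_Cl by (auto simp: sun_orbit_eq)
    then obtain U where U: "U \<in> N" "R \<in> cls U" using cover by blast
    then have "rep U \<in> cls U" unfolding rep_def by (metis someI)
    then have "dist (rep U x) y < e" using diam[OF U(1) _ U(2)] R by (simp add: dist_norm)
    then show "y \<in> (\<Union>y\<in>(\<lambda>U. rep U x) ` N. ball y e)" using U(1) by auto
  qed
  then show "\<exists>k. finite k \<and> sun_orbit cs T x \<subseteq> (\<Union>y\<in>k. ball y e)" using N(2) by blast
qed

subsection \<open>The one-parameter group on the range of the minimal idempotent\<close>

definition V :: "real \<Rightarrow> ('a \<Rightarrow>\<^sub>L complex) \<Rightarrow> ('a \<Rightarrow>\<^sub>L complex)" where
  "V t = (SOME U. U \<in> Cl \<and> U \<circ> S t = P)"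

lemma V: assumes "t \<ge> 0" shows "V t \<in> Cl" "V t \<circ> S t = P"
proof -
  have "\<exists>U. U \<in> Cl \<and> U \<circ> S t = P" using inverse_exists[OF S_in_Cl[OF assms]] by blast
  then have "V t \<in> Cl \<and> V t \<circ> S t = P" unfolding V_def by (rule someI_ex)
  then show "V t \<in> Cl" "V t \<circ> S t = P" by auto
qed

text \<open>The factor \<open>P\<close> turns the inverses modulo \<open>P\<close> into true
  inverses on its range, and makes additivity an identity of operators rather than one on that range
  only.\<close>

definition R :: "real \<Rightarrow> ('a \<Rightarrow>\<^sub>L complex) \<Rightarrow> ('a \<Rightarrow>\<^sub>L complex)" where
  "R t = (if t \<ge> 0 then S t \<circ> P else V (- t) \<circ> P)"

lemma R_Cl: "R t \<in> Cl"
  unfolding R_def using S_in_Cl V P Cl_compose by auto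

lemma S_add: assumes "s \<ge> 0" "t \<ge> 0" shows "S (s + t) = S s \<circ> S t"
proof
  fix y show "S (s + t) y = (S s \<circ> S t) y"
  proof (cases "y \<in> Xs")
    case True
    have "S (s + t) y = y o\<^sub>L (T t o\<^sub>L T s)" using True Tadd[OF assms(2,1)] by (simp add: S_apply add.commute)
    also have "\<dots> = (y o\<^sub>L T t) o\<^sub>L T s" by (rule blinfun_eqI) simp
    finally show ?thesis using True sun_compose[OF True assms(2)] by (simp add: S_apply)
  next
    case False
    then show ?thesis using S_apply[OF sun_0, of s] by (simp add: sun_op_def compose_zero_left)
  qed
qed

lemma S_R: assumes "u \<ge> 0" "u + t \<ge> 0" shows "S u \<circ> R t = S (u + t) \<circ> P"
proof (cases "t \<ge> 0")
  case True
  then show ?thesis using S_add[OF assms(1) True] by (simp add: R_def comp_assoc)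
next
  case False
  then have nt: "- t \<ge> 0" by simp
  have "S u = S (u + t) \<circ> S (- t)" using S_add[OF assms(2) nt] by simp
  then have "S u \<circ> R t = S (u + t) \<circ> ((S (- t) \<circ> V (- t)) \<circ> P)" using False by (simp add: R_def comp_assoc)
  also have "S (- t) \<circ> V (- t) = P" using V[OF nt] commute[OF S_in_Cl[OF nt]] by metis
  finally show ?thesis by (simp only: P(2))
qed

lemma R_P: "R t \<circ> P = R t"
  using P(2) by (simp add: R_def comp_assoc)

text \<open>Clearing denominators: after composition with \<open>S (u + w)\<close> all times are
  nonnegative and the semigroup law of \<open>S\<close> applies; \<open>V (u + w)\<close> then
  cancels this factor up to \<open>P\<close>, which changes neither side.\<close>

lemma R_add: "R s \<circ> R t = R (s + t)"
proof -
  define u w where "u = \<bar>s\<bar>" and "w = \<bar>t\<bar>"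
  have uw: "u \<ge> 0" "w \<ge> 0" "u + s \<ge> 0" "w + t \<ge> 0" by (auto simp: u_def w_def)
  have "S (u + w) \<circ> (R s \<circ> R t) = S u \<circ> (S w \<circ> R s) \<circ> R t" using S_add[OF uw(1,2)] by (simp add: comp_assoc)
  also have "S w \<circ> R s = R s \<circ> S w" using commute S_in_Cl[OF uw(2)] R_Cl by blast
  also have "S u \<circ> (R s \<circ> S w) \<circ> R t = (S u \<circ> R s) \<circ> (S w \<circ> R t)" by (simp add: comp_assoc)
  also have "\<dots> = (S (u + s) \<circ> P) \<circ> (S (w + t) \<circ> P)" using S_R uw by simp
  also have "\<dots> = S (u + s) \<circ> (P \<circ> S (w + t)) \<circ> P" by (simp add: comp_assoc)
  also have "P \<circ> S (w + t) = S (w + t) \<circ> P" using commute P(1) S_in_Cl[OF uw(4)] by blast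
  also have "S (u + s) \<circ> (S (w + t) \<circ> P) \<circ> P = (S (u + s) \<circ> S (w + t)) \<circ> (P \<circ> P)" by (simp add: comp_assoc)
  also have "\<dots> = S ((u + w) + (s + t)) \<circ> P" using S_add[OF uw(3,4)] P(2) by (simp add: algebra_simps)
  also have "\<dots> = S (u + w) \<circ> R (s + t)" using uw by (intro S_R[symmetric]) auto
  finally have "S (u + w) \<circ> (R s \<circ> R t) = S (u + w) \<circ> R (s + t)" .
  then have eq: "V (u + w) \<circ> S (u + w) \<circ> (R s \<circ> R t) = V (u + w) \<circ> S (u + w) \<circ> R (s + t)"
    by (simp only: comp_assoc)
  have VS: "V (u + w) \<circ> S (u + w) = P" using V(2) uw by simp
  have PR: "P \<circ> R s = R s" for s using commute[OF P(1) R_Cl, of s] R_P by simp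
  have "P \<circ> (R s \<circ> R t) = R s \<circ> R t" using PR by (metis comp_assoc)
  then show ?thesis using eq unfolding VS PR by simp
qed

context
  fixes x assumes x: "x \<in> Xs" "P x = x"
begin

lemma R_apply_add: "R (s + t) x = R s (R t x)"
  using fun_cong[OF R_add, of s t x] by simp

lemma R_0: "R 0 x = x"
  using x by (simp add: R_def S_apply T0) (rule blinfun_eqI, simp)

lemma S_R_apply: "s \<ge> 0 \<Longrightarrow> S s (R t x) = R (s + t) x"
  using Cl_fixed[OF x(2) R_Cl, of t] unfolding R_apply_add by (simp add: R_def[of s])

lemma R_sun: "R t x \<in> Xs"
  using Cl_in[OF R_Cl x(1)] .

text \<open>A translation by \<open>t\<close> acts through \<open>R t\<close>, of norm at most
  \<open>M\<close>, so a finite net for the points \<open>R s x\<close> is a net for the translates.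
  These points form a relatively compact set, because each \<open>R s\<close> is in
  \<open>Cl\<close> and the weak* closure of the orbit is its norm closure.\<close>

lemma almost_periodic_R: assumes "compact_orbit x" shows "almost_periodic (\<lambda>t. R t x)"
  unfolding almost_periodic_def
proof (intro allI impI)
  fix e :: real assume "e > 0"
  define K where "K = closure (range (\<lambda>t. R t x))"
  have "range (\<lambda>t. R t x) \<subseteq> closure (sun_orbit cs T x)"
    using weak_star_closure_orbit[OF x(1)] weak_star_closure_eq_closure[OF x(1) assms] R_Cl by auto
  then have "K \<subseteq> closure (sun_orbit cs T x)" unfolding K_def by (intro closure_minimal) auto
  then have "compact K"
    using assms compact_Int_closed[of "closure (sun_orbit cs T x)" K]
    by (simp add: compact_orbit_def K_def Int_absorb1)
  moreover have "e / M > 0" using \<open>e > 0\<close> M(1) by simp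
  then have "K \<subseteq> (\<Union>s\<in>UNIV. ball (R s x) (e / M))"
    unfolding K_def by (auto simp: closure_approachable)
  ultimately obtain N where N: "finite N" "K \<subseteq> (\<Union>s\<in>N. ball (R s x) (e / M))"
    using compactE_image[of K UNIV "\<lambda>s. ball (R s x) (e / M)"] by auto
  have "\<exists>n\<in>N. \<forall>t. norm (R (t + s) x - R (t + n) x) \<le> e" for s
  proof -
    have "R s x \<in> K" unfolding K_def by (rule closure_subset[THEN subsetD]) simp
    then obtain n where n: "n \<in> N" "dist (R n x) (R s x) < e / M" using N(2) by auto
    have "norm (R (t + s) x - R (t + n) x) \<le> e" for t
    proof -
      have "R (t + s) x - R (t + n) x = R t (R s x - R n x)"
        unfolding R_apply_add using Cl_diff[OF R_Cl R_sun R_sun] by simp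
      then have "norm (R (t + s) x - R (t + n) x) \<le> M * norm (R s x - R n x)"
        using Cl_norm_le[OF R_Cl sun_diff[OF R_sun R_sun]] by simp
      also have "\<dots> \<le> M * (e / M)"
        using n(2) M_nonneg by (intro mult_left_mono) (auto simp: dist_norm norm_minus_commute)
      finally show ?thesis using M(1) by simp
    qed
    with n(1) show ?thesis by blast
  qed
  with N(1) show "\<exists>N. finite N \<and> (\<forall>s. \<exists>n\<in>N. \<forall>t. norm (R (t + s) x - R (t + n) x) \<le> e)" by blast
qed

text \<open>\<open>S s\<close> passes inside the mean and shifts the variable by \<open>s\<close>,
  which multiplies \<open>y\<close> by \<open>cnj (\<xi> s)\<close>. So the orbit of
  \<open>y\<close> stays on the circle of unimodular multiples of \<open>y\<close>; this circle is
  norm compact, hence weak* closed, and therefore contains \<open>U y\<close> for every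
  \<open>U\<close> in the closure.\<close>

lemma mean_character_eigvec:
  assumes "character \<xi>" "has_mean (\<lambda>t. cscale (\<xi> t) (R t x)) y"
  shows "y \<in> unimodular_eigvecs cs T"
proof -
  have ySun: "y \<in> Xs"
    by (rule has_mean_in_closed_subspace[OF assms(2) sun_closed sun_0])
      (auto intro: sun_add sun_cscale R_sun simp: sun_cscale simp flip: cscale_of_real)
  have Sy: "S s y = cscale (cnj (\<xi> s)) y" if "s \<ge> 0" for s
  proof -
    have bl: "bounded_linear (\<lambda>f. f o\<^sub>L T s)"
      by (rule bounded_bilinear.bounded_linear_left[OF bounded_bilinear_blinfun_compose])
    have "has_mean (\<lambda>t. cscale (\<xi> t) (R t x) o\<^sub>L T s) (y o\<^sub>L T s)"
      by (rule has_mean_bounded_linear[OF bl assms(2)])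
    moreover have "cscale (\<xi> t) (R t x) o\<^sub>L T s = cscale (cnj (\<xi> s)) (cscale (\<xi> (t + s)) (R (t + s) x))" for t
    proof -
      have "R t x o\<^sub>L T s = R (t + s) x" using S_R_apply[OF that, of t] R_sun by (simp add: S_apply add.commute)
      moreover have "cnj (\<xi> s) * \<xi> (t + s) = \<xi> t"
      proof -
        have "\<xi> s * cnj (\<xi> s) = 1" using assms(1) unfolding character_def by (simp add: complex_norm_square[symmetric])
        then show ?thesis using assms(1) unfolding character_def by (simp add: algebra_simps)
      qed
      ultimately show ?thesis by (simp add: cscale_compose cscale_cscale)
    qed
    moreover have "has_mean (\<lambda>t. cscale (cnj (\<xi> s)) (cscale (\<xi> (t + s)) (R (t + s) x))) (cscale (cnj (\<xi> s)) y)"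
      by (intro has_mean_bounded_linear[OF bounded_bilinear.bounded_linear_right[OF bounded_bilinear_cscale]]
          has_mean_translate[OF assms(2)])
    ultimately have "y o\<^sub>L T s = cscale (cnj (\<xi> s)) y" using has_mean_unique by auto
    then show ?thesis using ySun by (simp add: S_apply)
  qed
  have "\<exists>c. cmod c = 1 \<and> U y = cscale c y" if U: "U \<in> Cl" for U
  proof -
    let ?K = "(\<lambda>c. cscale c y) ` sphere 0 1"
    have "sun_orbit cs T y \<subseteq> ?K"
    proof
      fix z assume "z \<in> sun_orbit cs T y"
      then obtain s where "s \<ge> 0" "z = S s y" by (auto simp: sun_orbit_eq)
      then have "z = cscale (cnj (\<xi> s)) y" using Sy by simp
      moreover have "cnj (\<xi> s) \<in> sphere 0 1" using assms(1) by (simp add: character_def)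
      ultimately show "z \<in> ?K" by blast
    qed
    moreover have "closed (blinfun_apply ` ?K)"
      by (intro compact_imp_closed_fun compact_continuous_image continuous_on_blinfun_apply_fun compact_cscale_sphere)
    ultimately have "closure (blinfun_apply ` sun_orbit cs T y) \<subseteq> blinfun_apply ` ?K"
      by (intro closure_minimal image_mono)
    moreover have "U y \<in> weak_star_closure_sun cs T (sun_orbit cs T y)"
      using U weak_star_closure_orbit[OF ySun] by blast
    ultimately have "U y \<in> ?K" unfolding weak_star_closure_iff by (auto simp: blinfun_apply_inject)
    then show ?thesis by auto
  qed
  then obtain lam where "\<And>U. U \<in> Cl \<Longrightarrow> cmod (lam U) = 1 \<and> U y = cscale (lam U) y" by metis
  then show ?thesis using ySun unfolding unimodular_eigvecs_def by blast
qed

end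

end

text \<open>The quadratic form of \<open>h\<close> is the mean of the squared modulus of the
  function \<open>?g\<close>, a linear combination of translates of \<open>u\<close>.\<close>

lemma autocorrelation_positive_definite:
  fixes u :: "'g::ab_group_add \<Rightarrow> real"
  assumes u: "almost_periodic u"
  defines "h \<equiv> conv (\<lambda>t. complex_of_real (u t)) (\<lambda>t. complex_of_real (u (- t)))"
  shows "almost_periodic h" "positive_definite h" "\<And>t. has_mean (\<lambda>s. complex_of_real (u (s + t) * u s)) (h t)"
proof -
  have cu: "almost_periodic (\<lambda>t. complex_of_real (u t))" by (rule almost_periodic_bounded_linear[OF bounded_linear_of_real u])
  have cu': "almost_periodic (\<lambda>t. complex_of_real (u (- t)))" by (rule almost_periodic_reflect[OF cu])
  show "almost_periodic h" unfolding h_def by (rule almost_periodic_conv[OF cu cu'])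
  show hm: "has_mean (\<lambda>s. complex_of_real (u (s + t) * u s)) (h t)" for t
    using has_mean_reflect[OF has_mean_conv[OF cu cu', of t]] unfolding h_def by (simp add: add.commute)
  show "positive_definite h"
    unfolding positive_definite_def
  proof (intro conjI allI)
    fix t
    have "has_mean (\<lambda>s. cnj (complex_of_real (u (s + t) * u s))) (cnj (h t))"
      by (rule has_mean_bounded_linear[OF bounded_linear_cnj hm])
    moreover have "has_mean (\<lambda>s. complex_of_real (u (s + t + - t) * u (s + t))) (h (- t))"
      by (rule has_mean_translate[OF hm])
    ultimately show "h (- t) = cnj (h t)" by (simp add: mult.commute has_mean_unique)
  next
    fix n :: nat and w and c :: "nat \<Rightarrow> complex"
    let ?g = "\<lambda>s. \<Sum>i<n. c i * complex_of_real (u (s + w i))"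
    have "has_mean (\<lambda>s. \<Sum>i<n. \<Sum>j<n. c i * cnj (c j) * complex_of_real (u (s + w i) * u (s + w j)))
        (\<Sum>i<n. \<Sum>j<n. c i * cnj (c j) * h (w i - w j))"
    proof (intro has_mean_sum has_mean_bounded_linear[OF bounded_linear_mult_right] finite_lessThan)
      fix i j
      show "has_mean (\<lambda>s. complex_of_real (u (s + w i) * u (s + w j))) (h (w i - w j))"
        using has_mean_translate[OF hm[of "w i - w j"], of "w j"] by (simp add: add.assoc)
    qed
    moreover have "(\<Sum>i<n. \<Sum>j<n. c i * cnj (c j) * complex_of_real (u (s + w i) * u (s + w j))) = of_real ((norm (?g s))\<^sup>2)" for s
      unfolding complex_norm_square cnj_sum sum_product by (simp add: algebra_simps)
    ultimately have "has_mean (\<lambda>s. of_real ((norm (?g s))\<^sup>2)) (\<Sum>i<n. \<Sum>j<n. c i * cnj (c j) * h (w i - w j))"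
      by (simp only:)
    from has_mean_bounded_linear[OF bounded_linear_Re this]
    have "has_mean (\<lambda>s. (norm (?g s))\<^sup>2) (Re (\<Sum>i<n. \<Sum>j<n. c i * cnj (c j) * h (w i - w j)))"
      by (simp only: Re_complex_of_real)
    then show "0 \<le> Re (\<Sum>i<n. \<Sum>j<n. c i * cnj (c j) * h (w i - w j))"
      by (rule has_mean_nonneg) simp
  qed
qed

section \<open>From compact orbits to eigenvectors\<close>

context abelian_sun_semigroup
begin

text \<open>The nonnegative weight \<open>hr\<close> lives where \<open>F t\<close> is within
  \<open>e / 4\<close> of \<open>x\<close>, so weighting by it leads to within
  \<open>(e / 4) * m\<close> of \<open>m *\<^sub>R x\<close>, where \<open>m\<close> is its mean.
  Replacing \<open>h\<close> by a trigonometric polynomial costs at most another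
  \<open>(e / 4) * m\<close>, and division by \<open>m\<close> leaves a combination of eigenvectors
  within \<open>e / 2\<close> of \<open>x\<close>.\<close>

lemma compact_orbit_imp_uds:
  assumes x: "x \<in> Xs" "P x = x" and comp: "compact_orbit x"
  shows "x \<in> X_uds cs T"
  unfolding X_uds_def closure_approachable
proof (intro allI impI)
  fix e :: real assume "e > 0"
  define F where "F = (\<lambda>t. R t x)"
  have apF: "almost_periodic F" unfolding F_def by (rule almost_periodic_R[OF x comp])
  have FSun: "F t \<in> Xs" for t unfolding F_def by (rule R_sun[OF x])
  obtain B where B: "\<And>t. norm (F t) \<le> B" using almost_periodic_bounded[OF apF] by blast
  then have "B \<ge> 0" using norm_ge_zero order_trans by blast
  \<comment> \<open>Chosen so that \<open>\<delta> + M * \<delta> \<le> e / 4\<close>, which is what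
    \<open>supp\<close> needs.\<close>
  define \<delta> where "\<delta> = e / (8 * M)"
  have \<delta>: "\<delta> > 0" "2 * M * \<delta> = e / 4" using \<open>e > 0\<close> M(1) by (auto simp: \<delta>_def)
  define u where "u = (\<lambda>t. max 0 (\<delta> - norm (F t - x)))"
  have apu: "almost_periodic u"
  proof (rule almost_periodic_Lipschitz[OF apF, of _ 1])
    fix s t
    have "\<bar>norm (F s - x) - norm (F t - x)\<bar> \<le> norm ((F s - x) - (F t - x))" by (rule norm_triangle_ineq3)
    then show "norm (u s - u t) \<le> 1 * norm (F s - F t)" unfolding u_def by (simp add: max_def) linarith
  qed
  define h where "h = conv (\<lambda>t. complex_of_real (u t)) (\<lambda>t. complex_of_real (u (- t)))"
  note h = autocorrelation_positive_definite[OF apu, folded h_def]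
  define hr where "hr = (\<lambda>t. Re (h t))"
  have hr: "has_mean (\<lambda>s. u (s + t) * u s) (hr t)" for t
    using has_mean_bounded_linear[OF bounded_linear_Re h(3)[of t]] by (simp add: hr_def)
  have h_hr: "h t = of_real (hr t)" for t
    using has_mean_unique[OF h(3)[of t] has_mean_bounded_linear[OF bounded_linear_of_real hr[of t]]] .
  have aphr: "almost_periodic hr" unfolding hr_def by (rule almost_periodic_Re[OF h(1)])
  have u_nonneg: "u t \<ge> 0" for t by (simp add: u_def)
  have hr_nonneg: "hr t \<ge> 0" for t by (rule has_mean_nonneg[OF hr]) (simp add: u_nonneg)
  have "u 0 = \<delta>" using \<delta>(1) R_0[OF x] by (simp add: u_def F_def)
  have hr0: "hr 0 > 0"
  proof (rule has_mean_pos[OF _ hr, of _ 0])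
    show "almost_periodic (\<lambda>s. u (s + 0) * u s)" using almost_periodic_mult[OF apu apu] by simp
  qed (use \<delta>(1) \<open>u 0 = \<delta>\<close> u_nonneg in auto)
  define m where "m = mean hr"
  have m: "has_mean hr m" unfolding m_def by (rule has_mean_mean[OF aphr])
  have "m > 0" by (rule has_mean_pos[OF aphr m hr_nonneg hr0])
  \<comment> \<open>A nonzero mean requires some \<open>s\<close> for which \<open>F s\<close> and
    \<open>F (s + t)\<close> are both within \<delta> of \<open>x\<close>. As
    \<open>F (s + t) = R t (F s)\<close> and \<open>F t = R t x\<close>, the error at
    \<open>t\<close> is at most that at \<open>s + t\<close> plus \<open>M\<close> times that at
    \<open>s\<close>.\<close>
  have supp: "norm (F t - x) \<le> e / 4" if "hr t \<noteq> 0" for t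
  proof -
    have "\<exists>s. u (s + t) * u s \<noteq> 0"
    proof (rule ccontr)
      assume "\<nexists>s. u (s + t) * u s \<noteq> 0"
      then have "(\<lambda>s. u (s + t) * u s) = (\<lambda>_. 0)" by blast
      then have "has_mean (\<lambda>s. u (s + t) * u s) 0" by (simp only: has_mean_const)
      then show False using has_mean_unique[OF hr[of t]] that by blast
    qed
    then obtain s where s: "u (s + t) \<noteq> 0" "u s \<noteq> 0" by auto
    then have 1: "norm (F (s + t) - x) < \<delta>" "norm (F s - x) < \<delta>" by (auto simp: u_def max_def split: if_splits)
    have "F (s + t) = R t (F s)" using R_apply_add[OF x, of t s] by (simp add: F_def add.commute)
    moreover have "F t = R t x" by (simp add: F_def)
    ultimately have "F t - x = (F (s + t) - x) - R t (F s - x)"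
      using Cl_diff[OF R_Cl FSun x(1)] by simp
    then have "norm (F t - x) \<le> norm (F (s + t) - x) + norm (R t (F s - x))" using norm_triangle_ineq4 by metis
    moreover have "norm (R t (F s - x)) \<le> M * norm (F s - x)"
      by (rule Cl_norm_le[OF R_Cl sun_diff[OF FSun x(1)]])
    moreover have "M * norm (F s - x) \<le> M * \<delta>" using 1 M_nonneg by (intro mult_left_mono) auto
    moreover have "\<delta> \<le> M * \<delta>" using M(1) \<delta>(1) by simp
    ultimately show ?thesis using 1 \<delta>(2) by linarith
  qed
  \<comment> \<open>This makes \<open>\<eta> * B\<close> at most \<open>(e / 4) * m\<close>; the
    summand \<open>1\<close> covers \<open>B = 0\<close>.\<close>
  define \<eta> where "\<eta> = (e / 4) * m / (B + 1)"
  have "\<eta> > 0" using \<open>m > 0\<close> \<open>e > 0\<close> \<open>B \<ge> 0\<close> by (simp add: \<eta>_def)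
  obtain n :: nat and c \<xi> where ch: "\<And>i. i < n \<Longrightarrow> character (\<xi> i)"
    and k: "\<And>t. norm (h t - (\<Sum>i<n. c i * \<xi> i t)) \<le> \<eta>"
    using trigonometric_approximation[OF h(1,2) \<open>\<eta> > 0\<close>] by blast
  define y where "y = (\<lambda>i. mean (\<lambda>t. cscale (\<xi> i t) (F t)))"
  have y: "has_mean (\<lambda>t. cscale (\<xi> i t) (F t)) (y i)" if "i < n" for i
    unfolding y_def by (intro has_mean_mean almost_periodic_bilinear[OF bounded_bilinear_cscale] apF almost_periodic_character ch that)
  have eig: "y i \<in> unimodular_eigvecs cs T" if "i < n" for i
    using mean_character_eigvec[OF x ch[OF that]] y[OF that] by (simp add: F_def)
  define z where "z = (\<Sum>i<n. cscale (c i) (y i))"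
  have hz: "has_mean (\<lambda>t. \<Sum>i<n. cscale (c i) (cscale (\<xi> i t) (F t))) z"
    unfolding z_def
    by (intro has_mean_sum has_mean_bounded_linear[OF bounded_bilinear.bounded_linear_right[OF bounded_bilinear_cscale]] y) auto
  have "has_mean (\<lambda>t. hr t *\<^sub>R x) (m *\<^sub>R x)"
    by (rule has_mean_bounded_linear[OF bounded_linear_scaleR_left m])
  from has_mean_diff[OF hz this]
  have hd: "has_mean (\<lambda>t. (\<Sum>i<n. cscale (c i) (cscale (\<xi> i t) (F t))) - hr t *\<^sub>R x) (z - m *\<^sub>R x)" .
  have hg: "has_mean (\<lambda>t. \<eta> * B + (e / 4) * hr t) (\<eta> * B + (e / 4) * m)"
    by (intro has_mean_add has_mean_const has_mean_bounded_linear[OF bounded_linear_mult_right] m)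
  have "norm (z - m *\<^sub>R x) \<le> \<eta> * B + (e / 4) * m"
  proof (rule has_mean_norm_mono[OF hd hg])
    fix t
    have "(\<Sum>i<n. cscale (c i) (cscale (\<xi> i t) (F t))) = cscale (\<Sum>i<n. c i * \<xi> i t) (F t)"
      by (simp add: cscale_cscale bounded_bilinear.sum_left[OF bounded_bilinear_cscale])
    moreover have "hr t *\<^sub>R F t = cscale (h t) (F t)" by (simp add: h_hr cscale_of_real)
    ultimately have "(\<Sum>i<n. cscale (c i) (cscale (\<xi> i t) (F t))) - hr t *\<^sub>R x
       = cscale ((\<Sum>i<n. c i * \<xi> i t) - h t) (F t) + hr t *\<^sub>R (F t - x)"
      by (simp add: bounded_bilinear.diff_left[OF bounded_bilinear_cscale] scaleR_diff_right)
    moreover have "norm (cscale ((\<Sum>i<n. c i * \<xi> i t) - h t) (F t)) \<le> \<eta> * B"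
      using k[of t] B[of t] \<open>\<eta> > 0\<close>
      by (intro order_trans[OF norm_cscale_le] mult_mono) (auto simp: norm_minus_commute)
    moreover have "norm (hr t *\<^sub>R (F t - x)) \<le> (e / 4) * hr t"
      using supp[of t] hr_nonneg[of t] by (cases "hr t = 0") (auto simp: mult.commute mult_left_mono)
    ultimately show "norm ((\<Sum>i<n. cscale (c i) (cscale (\<xi> i t) (F t))) - hr t *\<^sub>R x) \<le> \<eta> * B + (e / 4) * hr t"
      by (simp only:) (intro norm_triangle_le add_mono)
  qed
  also have "\<eta> * B \<le> (e / 4) * m"
  proof -
    have nz: "B + 1 \<noteq> 0" using \<open>B \<ge> 0\<close> by simp
    have "\<eta> * B \<le> \<eta> * (B + 1)" using \<open>\<eta> > 0\<close> by simp
    also have "\<dots> = (e / 4) * m" by (rule nonzero_eq_divide_eq[OF nz, THEN iffD1, OF \<eta>_def])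
    finally show ?thesis .
  qed
  finally have zm: "norm (z - m *\<^sub>R x) \<le> (e / 2) * m" by simp
  define w where "w = (\<Sum>i<n. cscale (of_real (1 / m) * c i) (y i))"
  have "w = cscale (of_real (1 / m)) z"
    unfolding w_def z_def bounded_bilinear.sum_right[OF bounded_bilinear_cscale] cscale_cscale ..
  then have "w - x = (1 / m) *\<^sub>R (z - m *\<^sub>R x)"
    using \<open>m > 0\<close> by (simp only: cscale_of_real) (simp add: scaleR_diff_right)
  then have "norm (w - x) = (1 / m) * norm (z - m *\<^sub>R x)" using \<open>m > 0\<close> by simp
  also have "\<dots> \<le> (1 / m) * ((e / 2) * m)" using zm \<open>m > 0\<close> by (intro mult_left_mono) auto
  also have "\<dots> < e" using \<open>m > 0\<close> \<open>e > 0\<close> by simp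
  finally have "dist w x < e" by (simp add: dist_norm)
  moreover have "w \<in> cspan (unimodular_eigvecs cs T)"
    unfolding cspan_def w_def using eig
    by (intro CollectI exI[of _ "{..<n}"] exI[of _ "\<lambda>i. of_real (1 / m) * c i"] exI[of _ y]) auto
  ultimately show "\<exists>y\<in>cspan (unimodular_eigvecs cs T). dist y x < e" by blast
qed

end

theorem theorem4p8:
  fixes cs :: "complex \<Rightarrow> 'a::banach \<Rightarrow> 'a"
    and T :: "real \<Rightarrow> 'a \<Rightarrow>\<^sub>L 'a"
    and P :: "('a \<Rightarrow>\<^sub>L complex) \<Rightarrow> ('a \<Rightarrow>\<^sub>L complex)"
    and x :: "'a \<Rightarrow>\<^sub>L complex"
  assumes "cplx_struct cs"
    and "bounded_C0_semigroup cs T"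
    and "\<forall>U\<in>wstar_closure cs T. \<forall>V\<in>wstar_closure cs T. U \<circ> V = V \<circ> U"
    and "minimal_idempotent cs T P"
    and "x \<in> P ` sun_dual cs T"
  shows "(norm_separable (weak_star_closure_sun cs T (sun_orbit cs T x)) \<longleftrightarrow> x \<in> X_uds cs T)
       \<and> (x \<in> X_uds cs T \<longleftrightarrow> compact (closure (sun_orbit cs T x)))"
proof -
  interpret abelian_sun_semigroup cs T P
    by unfold_locales (use assms in auto)
  note x = P_fixed[OF assms(5)]
  show ?thesis
    using separable_imp_compact_orbit[OF x] compact_orbit_imp_separable[OF x(1)]
      uds_imp_compact_orbit[OF x(1)] compact_orbit_imp_uds[OF x]
    unfolding compact_orbit_def by blast
qed

end
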